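(* Let $I=[0,\infty)$, let $X$ be a complex Banach space, let $\mathcal{A}$ be a multivalued linear operator in $X$ satisfying condition (P) (stated in the context) with constants $c>0$ and $\beta\in(0,1]$, let $(T(t))_{t>0}$ be the degenerate semigroup generated by $\mathcal{A}$, let $M>0$ be a constant with $\|T(t)\|\le Me^{-ct}t^{\beta-1}$ for $t>0$, and let $u_0\in X$ be a point of continuity of $(T(t))_{t>0}$. Let $f:I\times X\to X$ and suppose that the following conditions hold: (i) $g\in APS^p(I\times X:X)$ with $p\ge1$, and there exists a constant $L>0$ such that $\|g(t,x)-g(t,y)\|\le L\|x-y\|$ for all $t\in I$ and $x,y\in X$. (ii) $f(t,x)=g(t,x)+q(t,x)$ for all $t\ge0$ and $x\in X$, where $\hat q\in C_0(I\times X:L^p([0,1]:X))$. (iii) $\beta=1$ provided $p=1$, and $\frac p{p-1}<\frac1{1-\beta}$ provided $p>1$. (iv) There is a locally bounded positive function $L_f(\cdot)$ such that $\|f(t,x)-f(t,y)\|\le L_f(t)\|x-y\|$ for a.e. $t>0$ and all $x,y\in X$, and such that $M_n<1$ for some $n\in\mathbb{N}$, where $$M_n:=M^n\sup_{t\ge0}e^{-ct}\int_0^t\int_0^{x_n}\cdots\int_0^{x_2}e^{cx_1}(t-x_n)^{\beta-1}\prod_{i=2}^n(x_i-x_{i-1})^{\beta-1}\prod_{i=1}^nL_f(x_i)\,dx_1\,dx_2\cdots dx_n.$$ Then there exists a unique asymptotically almost periodic (mild) solution of the inclusion $$u'(t)\in\mathcal{A}u(t)+f(t,u(t)),\ t\ge0,\qquad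 u(0)=u_0.$$
   Context: A multivalued linear operator (MLO) in $X$ is a map $\mathcal{A}:X\to P(X)$ whose graph $\{(x,y):y\in\mathcal{A}x\}$ is a linear subspace of $X\times X$ (with $D(\mathcal{A})=\{x:\mathcal{A}x\ne\emptyset\}$). Its resolvent set $\rho(\mathcal{A})$ is the set of $\lambda\in\mathbb{C}$ such that $R(\lambda-\mathcal{A})=X$ (range) and $R(\lambda:\mathcal{A}):=(\lambda-\mathcal{A})^{-1}$ is a single-valued bounded operator on $X$. Condition (P): there exist finite constants $c,M_0>0$ and $\beta\in(0,1]$ such that $\Psi:=\{\lambda\in\mathbb{C}:\Re\lambda\ge-c(|\Im\lambda|+1)\}\subseteq\rho(\mathcal{A})$ and $\|R(\lambda:\mathcal{A})\|\le M_0(1+|\lambda|)^{-\beta}$ for $\lambda\in\Psi$. Under (P), $\mathcal{A}$ generates a degenerate strongly continuous semigroup $(T(t))_{t>0}\subseteq L(X)$, given by $T(t)=\frac1{2\pi i}\int_\Gamma e^{\lambda t}R(\lambda:\mathcal{A})\,d\lambda$, $t>0$, where $\Gamma$ is the curve $\lambda=-c(|\eta|+1)+i\eta$, $\eta$ running from $-\infty$ to $\infty$; it satisfies $\|T(t)\|=O(e^{-ct}t^{\beta-1})$, $t>0$. A point $u_0$ is a point of continuity of the semigroup if $\lim_{t\to0+}T(t)u_0=u_0$; put $T(0)u_0:=u_0$. A mild solution of the inclusion is a function $u\in C([0,\infty):X)$ with $u(t)=T(t)u_0+\int_0^tT(t-s)f(s,u(s))\,ds$ for all $t\ge0$. Convention: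 $1/(1-\beta)=+\infty$ if $\beta=1$. A bounded continuous $u:[0,\infty)\to X$ is asymptotically almost periodic if for every $\epsilon>0$ there are $l>0$, $m>0$ such that every subinterval of $[0,\infty)$ of length $l$ contains $\tau$ with $\|u(t+\tau)-u(t)\|\le\epsilon$ for all $t\ge m$. For $F:I\times X\to X$ put $\hat F(t,x):=F(t+\cdot,x)$, a function on $[0,1]$. $APS^p(I\times X:X)$ is the set of $F:I\times X\to X$ such that $\hat F:I\times X\to L^p([0,1]:X)$ is almost periodic, i.e. bounded, continuous, and such that for every $\epsilon>0$ and compact $K\subseteq X$ there is $l>0$ such that every subinterval of $I$ of length $l$ contains $\tau$ with $\|\hat F(t+\tau,x)-\hat F(t,x)\|\le\epsilon$ for all $t\in I$, $x\in K$. For a Banach space $Z$, $C_0(I\times X:Z)$ is the space of continuous $\phi:I\times X\to Z$ with $\lim_{t\to\infty}\phi(t,x)=0$ uniformly for $x$ in any compact subset of $X$. *)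

theory Defs
  imports "HOL-Analysis.Analysis"
begin

section \<open>Complex Banach spaces\<close>

class complex_banach = banach +
  fixes scaleC :: "complex \<Rightarrow> 'a \<Rightarrow> 'a"  (infixr \<open>*\<^sub>C\<close> 75)
  assumes scaleC_add_right: "a *\<^sub>C (x + y) = a *\<^sub>C x + a *\<^sub>C y"
    and scaleC_add_left: "(a + b) *\<^sub>C x = a *\<^sub>C x + b *\<^sub>C x"
    and scaleC_scaleC: "a *\<^sub>C (b *\<^sub>C x) = (a * b) *\<^sub>C x"
    and scaleR_eq_scaleC: "r *\<^sub>R x = complex_of_real r *\<^sub>C x"
    and norm_scaleC: "norm (a *\<^sub>C x) = cmod a * norm x"

instantiation complex :: complex_banach
begin

definition scaleC_complex :: "complex \<Rightarrow> complex \<Rightarrow> complex"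
  where "scaleC_complex a x = a * x"

instance
  by standard (simp_all add: scaleC_complex_def algebra_simps norm_mult scaleR_conv_of_real)

end

lemma bounded_linear_scaleC: "bounded_linear (scaleC a :: 'a::complex_banach \<Rightarrow> 'a)"
proof (rule bounded_linear_intro[where K = "cmod a"])
  show "a *\<^sub>C (x + y) = a *\<^sub>C x + a *\<^sub>C y" for x y :: 'a
    by (rule scaleC_add_right)
  show "a *\<^sub>C (r *\<^sub>R x) = r *\<^sub>R (a *\<^sub>C x)" for r and x :: 'a
    by (simp add: scaleR_eq_scaleC scaleC_scaleC mult.commute)
  show "norm (a *\<^sub>C x) \<le> norm x * cmod a" for x :: 'a
    by (simp add: norm_scaleC mult.commute)
qed

text \<open>The bounded operators are real-linear by type; scalar multiplication of an operator
  by a complex number is post-composition with the following one.\<close>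

definition scaleC_op :: "complex \<Rightarrow> 'a::complex_banach \<Rightarrow>\<^sub>L 'a"
  where "scaleC_op a = Blinfun (scaleC a)"

lemma scaleC_op_apply [simp]: "blinfun_apply (scaleC_op a) x = a *\<^sub>C x"
  by (simp add: scaleC_op_def bounded_linear_Blinfun_apply bounded_linear_scaleC)


section \<open>Multivalued linear operators\<close>

definition mlo :: "('a::complex_banach \<Rightarrow> 'a set) \<Rightarrow> bool"
  where "mlo A \<longleftrightarrow>
    0 \<in> A 0 \<and>
    (\<forall>x y x' y'. y \<in> A x \<longrightarrow> y' \<in> A x' \<longrightarrow> y + y' \<in> A (x + x')) \<and>
    (\<forall>a x y. y \<in> A x \<longrightarrow> a *\<^sub>C y \<in> A (a *\<^sub>C x))"

definition mlo_shift :: "complex \<Rightarrow> ('a::complex_banach \<Rightarrow> 'a set) \<Rightarrow> 'a \<Rightarrow> 'a set"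
  where "mlo_shift z A x = {z *\<^sub>C x - y |y. y \<in> A x}"

definition mlo_range :: "('a \<Rightarrow> 'a set) \<Rightarrow> 'a set"
  where "mlo_range A = (\<Union>x. A x)"

definition mlo_inverse :: "('a \<Rightarrow> 'a set) \<Rightarrow> 'a \<Rightarrow> 'a set"
  where "mlo_inverse A y = {x. y \<in> A x}"

text \<open>Complex linearity of the resolvent is automatic, since the graph of \<open>A\<close> is a complex subspace.\<close>

definition mlo_resolvent_set :: "('a::complex_banach \<Rightarrow> 'a set) \<Rightarrow> complex set"
  where "mlo_resolvent_set A =
    {z. mlo_range (mlo_shift z A) = UNIV \<and>
        (\<exists>R :: 'a \<Rightarrow>\<^sub>L 'a. \<forall>y. mlo_inverse (mlo_shift z A) y = {blinfun_apply R y})}"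

definition mlo_resolvent :: "('a::complex_banach \<Rightarrow> 'a set) \<Rightarrow> complex \<Rightarrow> 'a \<Rightarrow>\<^sub>L 'a"
  where "mlo_resolvent A z =
    (THE R. \<forall>y. mlo_inverse (mlo_shift z A) y = {blinfun_apply R y})"

definition P_region :: "real \<Rightarrow> complex set"
  where "P_region c = {z. Re z \<ge> - c * (\<bar>Im z\<bar> + 1)}"

definition condition_P :: "('a::complex_banach \<Rightarrow> 'a set) \<Rightarrow> real \<Rightarrow> real \<Rightarrow> bool"
  where "condition_P A c \<beta> \<longleftrightarrow>
    c > 0 \<and> 0 < \<beta> \<and> \<beta> \<le> 1 \<and>
    P_region c \<subseteq> mlo_resolvent_set A \<and>
    (\<exists>M\<^sub>0>0. \<forall>z\<in>P_region c. norm (mlo_resolvent A z) \<le> M\<^sub>0 * (1 + cmod z) powr (- \<beta>))"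


section \<open>The degenerate semigroup\<close>

definition P_curve :: "real \<Rightarrow> real \<Rightarrow> complex"
  where "P_curve c \<eta> = Complex (- c * (\<bar>\<eta>\<bar> + 1)) \<eta>"

text \<open>The contour integral is pulled back along \<open>P_curve c\<close>, whose derivative at
  \<open>\<eta> \<noteq> 0\<close> is \<open>- c * sgn \<eta> + \<i>\<close>. The integral is taken in the Banach space of bounded operators.\<close>

definition P_semigroup :: "('a::complex_banach \<Rightarrow> 'a set) \<Rightarrow> real \<Rightarrow> real \<Rightarrow> 'a \<Rightarrow>\<^sub>L 'a"
  where "P_semigroup A c t =
    integral UNIV (\<lambda>\<eta>.
      scaleC_op (1 / (2 * of_real pi * \<i>) * exp (P_curve c \<eta> * of_real t) * Complex (- c * sgn \<eta>) 1)
      o\<^sub>L mlo_resolvent A (P_curve c \<eta>))"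

definition point_of_continuity :: "(real \<Rightarrow> 'a::complex_banach \<Rightarrow>\<^sub>L 'a) \<Rightarrow> 'a \<Rightarrow> bool"
  where "point_of_continuity T u\<^sub>0 \<longleftrightarrow> ((\<lambda>t. blinfun_apply (T t) u\<^sub>0) \<longlongrightarrow> u\<^sub>0) (at_right 0)"


section \<open>Bochner integrability and mild solutions\<close>

text \<open>The library's Bochner integral needs a second countable range, which is not available
  here. For Bochner integrable functions the Henstock-Kurzweil integral is defined in every Banach
  space and has the same value.\<close>

definition strongly_measurable_on :: "real set \<Rightarrow> (real \<Rightarrow> 'a::real_normed_vector) \<Rightarrow> bool"
  where "strongly_measurable_on S h \<longleftrightarrow>
    (\<exists>\<phi>. (\<forall>n::nat. simple_function (lebesgue_on S) (\<phi> n)) \<and>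
         (AE s in lebesgue_on S. (\<lambda>n. \<phi> n s) \<longlonglongrightarrow> h s))"

definition bochner_integrable_on :: "(real \<Rightarrow> 'a::real_normed_vector) \<Rightarrow> real set \<Rightarrow> bool"
  where "bochner_integrable_on h S \<longleftrightarrow>
    strongly_measurable_on S h \<and> integrable (lebesgue_on S) (\<lambda>s. norm (h s))"

text \<open>\<open>T\<close> is a semigroup on the open half line, extended to \<open>t = 0\<close> by \<open>T 0 u\<^sub>0 = u\<^sub>0\<close>.
  Only the restriction of \<open>u\<close> to the nonnegative reals is relevant.\<close>

definition mild_solution ::
    "(real \<Rightarrow> 'a::complex_banach \<Rightarrow>\<^sub>L 'a) \<Rightarrow> (real \<Rightarrow> 'a \<Rightarrow> 'a) \<Rightarrow> 'a \<Rightarrow> (real \<Rightarrow> 'a) \<Rightarrow> bool"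
  where "mild_solution T f u\<^sub>0 u \<longleftrightarrow>
    continuous_on {0..} u \<and>
    (\<forall>t\<ge>0. bochner_integrable_on (\<lambda>s. blinfun_apply (T (t - s)) (f s (u s))) {0..t} \<and>
      u t = (if t = 0 then u\<^sub>0 else blinfun_apply (T t) u\<^sub>0)
            + integral {0..t} (\<lambda>s. blinfun_apply (T (t - s)) (f s (u s))))"


section \<open>Almost periodicity\<close>

definition asymptotically_almost_periodic :: "(real \<Rightarrow> 'a::real_normed_vector) \<Rightarrow> bool"
  where "asymptotically_almost_periodic u \<longleftrightarrow>
    bounded (u ` {0..}) \<and> continuous_on {0..} u \<and>
    (\<forall>\<epsilon>>0. \<exists>l>0. \<exists>m>0. \<forall>a\<ge>0. \<exists>\<tau>\<in>{a..a + l}. \<forall>t\<ge>m. norm (u (t + \<tau>) - u t) \<le> \<epsilon>)"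

definition in_Lp :: "real \<Rightarrow> (real \<Rightarrow> 'a::real_normed_vector) \<Rightarrow> bool"
  where "in_Lp p h \<longleftrightarrow>
    strongly_measurable_on {0..1} h \<and> integrable (lebesgue_on {0..1}) (\<lambda>s. norm (h s) powr p)"

definition Lp_norm :: "real \<Rightarrow> (real \<Rightarrow> 'a::real_normed_vector) \<Rightarrow> real"
  where "Lp_norm p h = (LINT s|lebesgue_on {0..1}. norm (h s) powr p) powr (1 / p)"

definition hat :: "(real \<Rightarrow> 'a \<Rightarrow> 'b) \<Rightarrow> real \<Rightarrow> 'a \<Rightarrow> real \<Rightarrow> 'b"
  where "hat F t x = (\<lambda>s. F (t + s) x)"

text \<open>Elements of \<open>L\<^sup>p([0,1]:X)\<close> are represented by functions, so that continuity of a map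
  into this space is expressed through the \<open>L\<^sup>p\<close>-norm of differences.\<close>

definition Lp_continuous ::
    "real \<Rightarrow> (real \<Rightarrow> 'a::real_normed_vector \<Rightarrow> real \<Rightarrow> 'b::real_normed_vector) \<Rightarrow> bool"
  where "Lp_continuous p \<Phi> \<longleftrightarrow>
    (\<forall>t\<ge>0. \<forall>x. in_Lp p (\<Phi> t x) \<and>
      ((\<lambda>z. Lp_norm p (\<lambda>s. \<Phi> (fst z) (snd z) s - \<Phi> t x s)) \<longlongrightarrow> 0)
        (at (t, x) within {0..} \<times> UNIV))"

definition APS :: "real \<Rightarrow> (real \<Rightarrow> 'a::real_normed_vector \<Rightarrow> 'b::real_normed_vector) set"
  where "APS p = {F.
    Lp_continuous p (hat F) \<and>
    (\<exists>B. \<forall>t\<ge>0. \<forall>x. Lp_norm p (hat F t x) \<le> B) \<and>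
    (\<forall>\<epsilon>>0. \<forall>K. compact K \<longrightarrow>
      (\<exists>l>0. \<forall>a\<ge>0. \<exists>\<tau>\<in>{a..a + l}. \<forall>t\<ge>0. \<forall>x\<in>K.
        Lp_norm p (\<lambda>s. hat F (t + \<tau>) x s - hat F t x s) \<le> \<epsilon>))}"

definition C0_Lp ::
    "real \<Rightarrow> (real \<Rightarrow> 'a::real_normed_vector \<Rightarrow> real \<Rightarrow> 'b::real_normed_vector) set"
  where "C0_Lp p = {\<Phi>.
    Lp_continuous p \<Phi> \<and>
    (\<forall>K. compact K \<longrightarrow> uniform_limit K (\<lambda>t x. Lp_norm p (\<Phi> t x)) (\<lambda>_. 0) at_top)}"


section \<open>The constants \<open>M\<^sub>n\<close>\<close>

text \<open>\<open>iterated_integral n t F x\<close> integrates \<open>F\<close> over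
  \<open>0 \<le> x 1 \<le> x 2 \<le> \<dots> \<le> x n \<le> t\<close>, innermost over \<open>x 1\<close>; the values of the argument \<open>x\<close> at
  the indices \<open>1, \<dots>, n\<close> are overwritten.\<close>

fun iterated_integral ::
    "nat \<Rightarrow> real \<Rightarrow> ((nat \<Rightarrow> real) \<Rightarrow> ennreal) \<Rightarrow> (nat \<Rightarrow> real) \<Rightarrow> ennreal"
  where
    "iterated_integral 0 t F x = F x"
  | "iterated_integral (Suc k) t F x =
      (\<integral>\<^sup>+s\<in>{0..t}. iterated_integral k s F (x(Suc k := s)) \<partial>lebesgue)"

definition M_const :: "real \<Rightarrow> real \<Rightarrow> real \<Rightarrow> (real \<Rightarrow> real) \<Rightarrow> nat \<Rightarrow> ennreal"
  where "M_const M c \<beta> L n =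
    ennreal (M ^ n) *
    (SUP t\<in>{0..}. ennreal (exp (- c * t)) *
      iterated_integral n t
        (\<lambda>x. ennreal (exp (c * x 1) * (t - x n) powr (\<beta> - 1) *
               (\<Prod>i=2..n. (x i - x (i - 1)) powr (\<beta> - 1)) * (\<Prod>i=1..n. L (x i))))
        (\<lambda>_. 0))"

end

theory Submission
  imports Defs
begin

text \<open>A mild solution is a fixed point of \<open>\<Gamma> u t = T t u\<^sub>0 + \<integral>\<^sub>0\<^sup>t T (t - s) (f s (u s)) ds\<close>. Only two
  properties of \<open>T\<close> matter: norm continuity on \<open>(0, \<infinity>)\<close>, which comes from the resolvent identity,
  and the bound \<open>M * exp (- c * t) * t powr (\<beta> - 1)\<close>.

  The distances of iterates satisfy \<open>norm (\<Gamma>\<^sup>n u t - \<Gamma>\<^sup>n v t) \<le> M\<^sub>n * sup norm (u - v)\<close>, so \<open>\<Gamma>\<^sup>n\<close> is a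
  contraction in the sup norm, and it remains to see that \<open>\<Gamma>\<close> preserves asymptotic almost
  periodicity. By Young's inequality (the exponent conjugate to \<open>p\<close> is admissible for the kernel) the
  convolution of \<open>T\<close> with a Stepanov asymptotically almost periodic function is asymptotically almost
  periodic. The function \<open>f s (u s)\<close> itself need not be Stepanov almost periodic, since \<open>L\<^sub>f\<close> is only
  locally bounded. However, \<open>M\<^sub>n < 1\<close> forces the first iterated kernel
  \<open>\<integral>\<^sub>0\<^sup>t M * exp (- c * (t - s)) * (t - s) powr (\<beta> - 1) * L\<^sub>f s ds\<close> to be at most \<open>n\<close>, because the kernel is
  decreasing. Hence replacing \<open>f s (u s)\<close> by \<open>\<Sum>x. \<alpha> x (u s) *\<^sub>R f s x\<close>, for a partition of unity \<open>\<alpha>\<close>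
  subordinate to a finite \<open>\<epsilon>\<close>-net of the relatively compact range of \<open>u\<close>, changes the convolution by
  at most \<open>\<epsilon> * n\<close>, and the replacement is Stepanov asymptotically almost periodic.\<close>

section \<open>Strong measurability\<close>

text \<open>The criterion of Pettis, which passes to almost everywhere limits without a choice of
  approximating simple functions. Functions on a set are cut off by \<open>0\<close> outside it.\<close>

definition smeas :: "(real \<Rightarrow> 'a::metric_space) \<Rightarrow> bool"
  where "smeas h \<longleftrightarrow> (\<exists>C. countable C \<and> (AE s in lebesgue. h s \<in> closure C)) \<and>
    (\<forall>y. (\<lambda>s. dist (h s) y) \<in> borel_measurable lebesgue)"

lemma smeas_dist: "smeas h \<Longrightarrow> (\<lambda>s. dist (h s) y) \<in> borel_measurable lebesgue"
  by (simp add: smeas_def)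

lemma smeas_norm: "smeas h \<Longrightarrow> (\<lambda>s. norm (h s)) \<in> borel_measurable lebesgue"
  for h :: "real \<Rightarrow> 'a::real_normed_vector"
  using smeas_dist[of h 0] by simp

lemma borel_measurable_LIMSEQ_AE:
  fixes f :: "real \<Rightarrow> real"
  assumes "\<And>n. F n \<in> borel_measurable lebesgue" "AE s in lebesgue. (\<lambda>n. F n s) \<longlonglongrightarrow> f s"
  shows "f \<in> borel_measurable lebesgue"
proof -
  obtain N where N: "N \<in> null_sets lebesgue" "\<And>s. s \<notin> N \<Longrightarrow> (\<lambda>n. F n s) \<longlonglongrightarrow> f s"
    using assms(2) unfolding completion.AE_iff_null_sets by auto
  define g where "g s = (if s \<in> N then 0 else f s)" for s
  have m: "(\<lambda>s. if s \<in> N then 0 else F n s) \<in> borel_measurable lebesgue" for n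
    using N(1) assms(1) by (intro measurable_If_set) (auto simp: null_setsD2)
  have "g \<in> borel_measurable lebesgue"
    by (rule borel_measurable_LIMSEQ_real[where u="\<lambda>n s. if s \<in> N then 0 else F n s"])
      (auto simp: g_def N(2) m)
  moreover have "AE s in lebesgue. g s = f s"
    using AE_not_in[OF N(1)] by eventually_elim (simp add: g_def)
  ultimately show ?thesis by (rule borel_measurable_AE)
qed

lemma smeas_LIMSEQ_AE:
  assumes H: "\<And>n. smeas (H n)" and lim: "AE s in lebesgue. (\<lambda>n. H n s) \<longlonglongrightarrow> h s"
  shows "smeas h"
proof -
  obtain C where C: "\<And>n::nat. countable (C n)" "\<And>n. AE s in lebesgue. H n s \<in> closure (C n)"
    using H unfolding smeas_def by metis
  have "AE s in lebesgue. \<forall>n. H n s \<in> closure (C n)"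
    using C(2) by (simp add: AE_all_countable)
  with lim have "AE s in lebesgue. h s \<in> closure (\<Union>n. C n)"
  proof eventually_elim
    case (elim s)
    have "H n s \<in> closure (\<Union>n. C n)" for n
      using elim(2) closure_mono[of "C n" "\<Union>n. C n"] by blast
    then show ?case
      using elim(1) closed_sequentially[OF closed_closure] by metis
  qed
  moreover have "(\<lambda>s. dist (h s) y) \<in> borel_measurable lebesgue" for y
    by (rule borel_measurable_LIMSEQ_AE[OF smeas_dist[OF H]])
      (use lim in eventually_elim, auto intro: tendsto_intros)
  ultimately show ?thesis
    unfolding smeas_def using C(1) by (meson countable_UN countableI_type)
qed

lemma smeas_cong_AE: "smeas h \<Longrightarrow> AE s in lebesgue. h s = k s \<Longrightarrow> smeas k"
  by (rule smeas_LIMSEQ_AE[of "\<lambda>_. h"]) auto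

lemma smeas_const [simp]: "smeas (\<lambda>_. y)"
  unfolding smeas_def by (auto intro!: exI[of _ "{y}"])

lemma smeas_select:
  assumes G: "\<And>i. i \<in> I \<Longrightarrow> smeas (G i)" and g: "g \<in> lebesgue \<rightarrow>\<^sub>M count_space I" and I: "countable I"
  shows "smeas (\<lambda>s. G (g s) s)"
proof -
  have "\<forall>i\<in>I. \<exists>C. countable C \<and> (AE s in lebesgue. G i s \<in> closure C)"
    using G unfolding smeas_def by metis
  then obtain C where C: "\<And>i. i \<in> I \<Longrightarrow> countable (C i)"
      "\<And>i. i \<in> I \<Longrightarrow> AE s in lebesgue. G i s \<in> closure (C i)"
    by metis
  have "AE s in lebesgue. \<forall>i\<in>I. G i s \<in> closure (C i)"
    using C(2) by (simp add: AE_ball_countable I)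
  then have "AE s in lebesgue. G (g s) s \<in> closure (\<Union>i\<in>I. C i)"
  proof eventually_elim
    case (elim s)
    have "g s \<in> I" using measurable_space[OF g] by simp
    then show ?case using elim closure_mono[of "C (g s)" "\<Union>i\<in>I. C i"] by blast
  qed
  moreover have "(\<lambda>s. dist (G (g s) s) y) \<in> borel_measurable lebesgue" for y
    by (rule measurable_compose_countable'[OF _ g I]) (simp add: smeas_dist G)
  ultimately show ?thesis
    unfolding smeas_def using C(1) I by (meson countable_UN)
qed

lemma measurable_simple_function_count_space:
  assumes "simple_function M \<phi>"
  shows "\<phi> \<in> M \<rightarrow>\<^sub>M count_space (\<phi> ` space M)" "countable (\<phi> ` space M)"
  using assms by (auto simp: simple_function_def measurable_count_space_eq2 countable_finite)

lemma smeas_simple_function: "simple_function lebesgue \<phi> \<Longrightarrow> smeas \<phi>"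
  using smeas_select[where G="\<lambda>y s. y", OF _ measurable_simple_function_count_space] by simp

text \<open>The approximants are nearest-point projections onto finite parts of the countable set.\<close>

lemma smeas_simple_approx:
  assumes h: "smeas h"
  obtains \<phi> where "\<And>n::nat. simple_function lebesgue (\<phi> n)"
    "AE s in lebesgue. (\<lambda>n. \<phi> n s) \<longlonglongrightarrow> h s"
proof -
  obtain C where C: "countable C" "AE s in lebesgue. h s \<in> closure C"
    using h unfolding smeas_def by auto
  have "C \<noteq> {}"
  proof
    assume "C = {}"
    with C(2) have "UNIV \<in> null_sets (lebesgue::real measure)"
      by (simp add: completion.AE_iff_null_sets)
    then show False by (simp add: null_sets_def)
  qed
  define e where "e = from_nat_into C"
  have e: "range e = C" by (simp add: e_def C(1) \<open>C \<noteq> {}\<close> range_from_nat_into)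
  define near where "near n s j \<longleftrightarrow> j \<le> n \<and> (\<forall>i\<le>n. dist (h s) (e j) \<le> dist (h s) (e i))"
    for n s and j :: nat
  define J where "J n s = (LEAST j. near n s j)" for n s
  have ex: "\<exists>j. near n s j" for n s
  proof -
    have "\<exists>j\<in>{..n}. \<forall>i\<in>{..n}. dist (h s) (e j) \<le> dist (h s) (e i)"
      using arg_min_if_finite(1)[of "{..n}" "\<lambda>j. dist (h s) (e j)"]
        arg_min_least[of "{..n}" _ "\<lambda>j. dist (h s) (e j)"] by auto
    then show ?thesis unfolding near_def by auto
  qed
  have J: "near n s (J n s)" for n s
    unfolding J_def using ex by (rule LeastI_ex)
  have nm [measurable]: "Measurable.pred lebesgue (\<lambda>s. near n s j)" for n j
  proof -
    have [measurable]: "(\<lambda>s. dist (h s) y) \<in> borel_measurable lebesgue" for y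
      by (rule smeas_dist[OF h])
    show ?thesis unfolding near_def by measurable
  qed
  have Jm: "J n \<in> lebesgue \<rightarrow>\<^sub>M count_space UNIV" for n
    unfolding J_def by measurable
  have sJ: "simple_function lebesgue (J n)" for n
    unfolding simple_function_def
  proof safe
    have "range (J n) \<subseteq> {..n}" using J by (auto simp: near_def)
    then show "finite (J n ` space lebesgue)" using finite_subset by auto
    show "J n -` {J n s} \<inter> space lebesgue \<in> sets lebesgue" for s
      using measurable_sets[OF Jm, of "{J n s}" n] by simp
  qed
  show thesis
  proof (rule that)
    show "simple_function lebesgue (\<lambda>s. e (J n s))" for n
      by (rule simple_function_compose1[OF sJ])
    show "AE s in lebesgue. (\<lambda>n. e (J n s)) \<longlonglongrightarrow> h s"
      using C(2)
    proof eventually_elim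
      case (elim s)
      show ?case
      proof (rule metric_LIMSEQ_I)
        fix r :: real assume "r > 0"
        then obtain y where "y \<in> C" "dist y (h s) < r"
          using elim closure_approachable by blast
        then obtain i where i: "dist (e i) (h s) < r" using e by auto
        have "dist (e (J n s)) (h s) < r" if "n \<ge> i" for n
          using J[of n s] that i unfolding near_def by (metis dist_commute le_less_trans)
        then show "\<exists>no. \<forall>n\<ge>no. dist (e (J n s)) (h s) < r" by blast
      qed
    qed
  qed
qed

lemma smeas_compose:
  assumes G: "\<And>x. smeas (G x)" and cont: "AE s in lebesgue. \<forall>x. isCont (\<lambda>x. G x s) x" and h: "smeas h"
  shows "smeas (\<lambda>s. G (h s) s)"
proof -
  obtain \<phi> where \<phi>: "\<And>n::nat. simple_function lebesgue (\<phi> n)" "AE s in lebesgue. (\<lambda>n. \<phi> n s) \<longlonglongrightarrow> h s"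
    using smeas_simple_approx[OF h] by blast
  show ?thesis
  proof (rule smeas_LIMSEQ_AE)
    show "smeas (\<lambda>s. G (\<phi> n s) s)" for n
      using smeas_select[OF G measurable_simple_function_count_space[OF \<phi>(1)]] .
    show "AE s in lebesgue. (\<lambda>n. G (\<phi> n s) s) \<longlonglongrightarrow> G (h s) s"
      using cont \<phi>(2) by eventually_elim (auto intro: isCont_tendsto_compose)
  qed
qed

lemma smeas_add:
  fixes h k :: "real \<Rightarrow> 'a::real_normed_vector"
  assumes h: "smeas h" and k: "smeas k"
  shows "smeas (\<lambda>s. h s + k s)"
proof (rule smeas_compose[where G="\<lambda>x s. x + k s", OF _ _ h])
  fix x
  obtain C where C: "countable C" "AE s in lebesgue. k s \<in> closure C"
    using k unfolding smeas_def by auto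
  have "AE s in lebesgue. x + k s \<in> closure ((+) x ` C)"
    using C(2) by eventually_elim (simp add: closure_translation)
  moreover have "dist (x + k s) y = dist (k s) (y - x)" for y s
    by (simp add: dist_norm algebra_simps)
  ultimately show "smeas (\<lambda>s. x + k s)"
    unfolding smeas_def using C(1) smeas_dist[OF k] by auto
qed (auto intro!: always_eventually continuous_intros)

lemma smeas_continuous_compose:
  assumes "\<And>x. isCont G x" and h: "smeas h"
  shows "smeas (\<lambda>s. G (h s))"
  by (rule smeas_compose[where G="\<lambda>x s. G x", OF _ _ h]) (use assms in auto)

lemma smeas_diff:
  fixes h k :: "real \<Rightarrow> 'a::real_normed_vector"
  assumes h: "smeas h" and k: "smeas k"
  shows "smeas (\<lambda>s. h s - k s)"
  using smeas_add[OF h smeas_continuous_compose[OF _ k, of uminus]]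
  by (simp add: continuous_intros)

lemma smeas_continuous_on:
  fixes h :: "real \<Rightarrow> 'a::metric_space"
  assumes h: "continuous_on S h" and S: "S \<in> sets lebesgue"
  shows "smeas (\<lambda>s. if s \<in> S then h s else y)"
proof -
  obtain D where D: "countable D" "D \<subseteq> S" "S \<subseteq> closure D" by (rule separable)
  have "h s \<in> closure (h ` D)" if sS: "s \<in> S" for s
  proof -
    obtain x where x: "\<And>n::nat. x n \<in> D" "x \<longlonglongrightarrow> s"
      using subsetD[OF D(3) sS] unfolding closure_sequential by blast
    have "(\<lambda>n. h (x n)) \<longlonglongrightarrow> h s"
      by (rule continuous_on_tendsto_compose[OF h x(2) sS]) (use x(1) D(2) in \<open>auto intro!: always_eventually\<close>)
    then show ?thesis
      unfolding closure_sequential using x(1) by (metis image_eqI)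
  qed
  then have "(if s \<in> S then h s else y) \<in> closure (insert y (h ` D))" for s
    using closure_mono[of "h ` D" "insert y (h ` D)"] closure_subset[of "insert y (h ` D)"] by auto
  moreover have "(\<lambda>s. dist (if s \<in> S then h s else y) z) \<in> borel_measurable lebesgue" for z
  proof -
    have "(\<lambda>s. dist (h s) z) \<in> borel_measurable (lebesgue_on S)"
      by (rule continuous_imp_measurable_on_sets_lebesgue[OF _ S]) (intro continuous_intros h)
    then have "(\<lambda>s. if s \<in> S then dist (h s) z else 0) \<in> borel_measurable lebesgue"
      by (rule borel_measurable_if_I[OF _ S])
    moreover have "(\<lambda>s. dist y z * indicator (UNIV - S) s) \<in> borel_measurable lebesgue"
      using sets.compl_sets[OF S]
      by (intro borel_measurable_times borel_measurable_const borel_measurable_indicator) simp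
    ultimately have "(\<lambda>s. (if s \<in> S then dist (h s) z else 0) + dist y z * indicator (UNIV - S) s)
        \<in> borel_measurable lebesgue" by (rule borel_measurable_add)
    moreover have "(\<lambda>s. (if s \<in> S then dist (h s) z else 0) + dist y z * indicator (UNIV - S) s)
        = (\<lambda>s. dist (if s \<in> S then h s else y) z)" by (auto simp: indicator_def)
    ultimately show ?thesis by simp
  qed
  ultimately show ?thesis
    unfolding smeas_def using D(1) countable_insert countable_image always_eventually
    by (metis (no_types, lifting))
qed

lemma smeas_shift:
  assumes h: "smeas h"
  shows "smeas (\<lambda>s. h (a + s))"
proof -
  have T: "(\<lambda>s. a + s) \<in> lebesgue \<rightarrow>\<^sub>M lebesgue"
    using lebesgue_affine_measurable[of "\<lambda>_. 1::real" a] by simp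
  obtain C where C: "countable C" "AE s in lebesgue. h s \<in> closure C"
    using h unfolding smeas_def by auto
  have "(AE s in distr lebesgue lebesgue (\<lambda>s. a + s). h s \<in> closure C)"
    using C(2) lebesgue_real_affine[of 1 a]
    by (metis (no_types, lifting) AE_density C(2) abs_one density_1 ennreal_1 mult_1 zero_neq_one ext)
  then have "AE s in lebesgue. h (a + s) \<in> closure C"
    by (rule AE_distrD[OF T])
  moreover have "(\<lambda>s. dist (h (a + s)) y) \<in> borel_measurable lebesgue" for y
    using measurable_compose[OF T smeas_dist[OF h]] by simp
  ultimately show ?thesis
    unfolding smeas_def using C(1) by auto
qed

lemma strongly_measurable_on_iff_smeas:
  fixes h :: "real \<Rightarrow> 'a::real_normed_vector"
  assumes S: "S \<in> sets lebesgue"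
  shows "strongly_measurable_on S h \<longleftrightarrow> smeas (\<lambda>s. if s \<in> S then h s else 0)"
proof
  assume "strongly_measurable_on S h"
  then obtain \<phi> where \<phi>: "\<And>n::nat. simple_function (lebesgue_on S) (\<phi> n)"
     "AE s in lebesgue_on S. (\<lambda>n. \<phi> n s) \<longlonglongrightarrow> h s"
    unfolding strongly_measurable_on_def by auto
  define \<psi> where "\<psi> n s = (if s \<in> S then \<phi> n s else 0)" for n s
  have sf: "simple_function lebesgue (\<psi> n)" for n
    unfolding simple_function_def
  proof safe
    have "range (\<psi> n) \<subseteq> insert 0 (\<phi> n ` S)" by (auto simp: \<psi>_def)
    then show "finite (\<psi> n ` space lebesgue)"
      using \<phi>(1)[of n] by (auto simp: simple_function_def intro: finite_subset)
    fix s
    have *: "\<phi> n -` {y} \<inter> S \<in> sets lebesgue" for y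
      using simple_functionD(2)[OF \<phi>(1), of n "{y}"] S by (auto simp: sets_restrict_space_iff)
    have "\<psi> n -` {y} = (\<phi> n -` {y} \<inter> S) \<union> (if y = 0 then UNIV - S else {})" for y
      by (auto simp: \<psi>_def split: if_splits)
    then show "\<psi> n -` {\<psi> n s} \<inter> space lebesgue \<in> sets lebesgue"
      using * S sets.compl_sets[OF S] by (simp add: sets.Un)
  qed
  show "smeas (\<lambda>s. if s \<in> S then h s else 0)"
  proof (rule smeas_LIMSEQ_AE[OF smeas_simple_function[OF sf]])
    have "AE s in lebesgue. s \<in> S \<longrightarrow> (\<lambda>n. \<phi> n s) \<longlonglongrightarrow> h s"
      using \<phi>(2) S by (simp add: AE_restrict_space_iff)
    then show "AE s in lebesgue. (\<lambda>n. \<psi> n s) \<longlonglongrightarrow> (if s \<in> S then h s else 0)"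
      by eventually_elim (auto simp: \<psi>_def)
  qed
next
  assume "smeas (\<lambda>s. if s \<in> S then h s else 0)"
  then obtain \<phi> where \<phi>: "\<And>n::nat. simple_function lebesgue (\<phi> n)"
     "AE s in lebesgue. (\<lambda>n. \<phi> n s) \<longlonglongrightarrow> (if s \<in> S then h s else 0)"
    using smeas_simple_approx by blast
  show "strongly_measurable_on S h"
    unfolding strongly_measurable_on_def
  proof (intro exI conjI allI)
    show "simple_function (lebesgue_on S) (\<phi> n)" for n
      unfolding simple_function_def
    proof safe
      show "finite (\<phi> n ` space (lebesgue_on S))"
        using \<phi>(1)[of n] by (auto simp: simple_function_def intro: finite_subset[OF image_mono])
      show "\<phi> n -` {\<phi> n s} \<inter> space (lebesgue_on S) \<in> sets (lebesgue_on S)" for s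
        using simple_functionD(2)[OF \<phi>(1), of n "{\<phi> n s}"] S
        by (auto simp: sets_restrict_space_iff space_restrict_space)
    qed
    show "AE s in lebesgue_on S. (\<lambda>n. \<phi> n s) \<longlonglongrightarrow> h s"
      using \<phi>(2) S by (auto simp: AE_restrict_space_iff elim: eventually_mono)
  qed
qed

section \<open>The Henstock--Kurzweil integral of Bochner integrable functions\<close>

lemma bochner_integrable_on_iff:
  fixes h :: "real \<Rightarrow> 'a::real_normed_vector"
  assumes S: "S \<in> sets lebesgue"
  shows "bochner_integrable_on h S \<longleftrightarrow>
    smeas (\<lambda>s. if s \<in> S then h s else 0) \<and> (\<integral>\<^sup>+s\<in>S. ennreal (norm (h s)) \<partial>lebesgue) < \<infinity>"
proof -
  have *: "norm (norm (h s)) * indicator S s = norm (if s \<in> S then h s else 0)" for s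
    by (simp add: indicator_def)
  have "integrable (lebesgue_on S) (\<lambda>s. norm (h s)) \<longleftrightarrow>
      (\<integral>\<^sup>+s\<in>S. ennreal (norm (h s)) \<partial>lebesgue) < \<infinity>"
    if sm: "smeas (\<lambda>s. if s \<in> S then h s else 0)"
  proof -
    have "(\<lambda>s. if s \<in> S then norm (h s) else 0) \<in> borel_measurable lebesgue"
      using smeas_norm[OF sm] by (simp add: if_distrib[of norm] cong: if_cong)
    then have "(\<lambda>s. norm (h s)) \<in> borel_measurable (lebesgue_on S)"
      by (rule borel_measurable_if_D)
    moreover have "(\<integral>\<^sup>+s. ennreal (norm (norm (h s))) \<partial>lebesgue_on S) =
        (\<integral>\<^sup>+s\<in>S. ennreal (norm (h s)) \<partial>lebesgue)"
      using S by (subst nn_integral_restrict_space) auto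
    ultimately show ?thesis by (simp add: integrable_iff_bounded)
  qed
  then show ?thesis
    unfolding bochner_integrable_on_def strongly_measurable_on_iff_smeas[OF S] by auto
qed

lemma simple_function_integrable_on:
  fixes \<psi> :: "real \<Rightarrow> 'a::banach"
  assumes "simple_function lebesgue \<psi>"
  shows "\<psi> integrable_on {a..b}"
proof -
  have fin: "finite (range \<psi>)" and ms: "\<psi> -` {y} \<in> sets lebesgue" for y
    using simple_functionD(1)[OF assms] simple_functionD(2)[OF assms, of "{y}"] by auto
  have "(\<lambda>s. indicat_real (\<psi> -` {y}) s *\<^sub>R y) integrable_on {a..b}" for y
  proof -
    have "\<psi> -` {y} \<inter> {a..b} \<in> lmeasurable"
      using ms by (intro bounded_set_imp_lmeasurable) (auto intro: bounded_subset[of "{a..b}"])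
    then have "indicat_real (\<psi> -` {y}) integrable_on {a..b}"
      by (simp add: integrable_on_indicator)
    then show ?thesis
      by (rule integrable_on_scaleR_left)
  qed
  then have "(\<lambda>s. \<Sum>y\<in>range \<psi>. indicat_real (\<psi> -` {y}) s *\<^sub>R y) integrable_on {a..b}"
    by (intro integrable_sum fin)
  moreover have "(\<Sum>y\<in>range \<psi>. indicat_real (\<psi> -` {y}) s *\<^sub>R y) = \<psi> s" for s
  proof -
    have "(\<Sum>y\<in>range \<psi>. indicat_real (\<psi> -` {y}) s *\<^sub>R y) = (\<Sum>y\<in>range \<psi>. if y = \<psi> s then y else 0)"
      by (intro sum.cong) (auto simp: indicator_def)
    then show ?thesis using fin by simp
  qed
  ultimately show ?thesis by simp
qed

text \<open>Riemann sums of \<open>h\<close> are compared with those of a simple \<open>\<psi>\<close> close to \<open>h\<close> in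
  \<open>L\<^sup>1\<close>; the difference is controlled by Riemann sums of the real function \<open>norm (\<psi> - h)\<close>.\<close>

lemma has_integral_L1_limit:
  fixes h :: "real \<Rightarrow> 'a::banach" and \<psi> :: "nat \<Rightarrow> real \<Rightarrow> 'a"
  assumes \<psi>: "\<And>n. \<psi> n integrable_on {a..b}"
    and D: "\<And>n. ((\<lambda>s. norm (\<psi> n s - h s)) has_integral \<delta> n) {a..b}" and lim: "\<delta> \<longlonglongrightarrow> 0"
  shows "h integrable_on {a..b}"
proof -
  have tri: "norm (b - c) \<le> norm (a - b) + norm (a - d) + norm (d - c)" for a b c d :: 'a
    using norm_triangle_ineq[of "b - a" "a - c"] norm_triangle_ineq[of "a - d" "d - c"]
    by (simp add: norm_minus_commute)
  define I where "I n = integral {a..b} (\<psi> n)" for n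
  have I: "norm (I n - I m) \<le> \<delta> n + \<delta> m" for n m
  proof -
    have "norm (integral {a..b} (\<lambda>s. \<psi> n s - \<psi> m s)) \<le>
        integral {a..b} (\<lambda>s. norm (\<psi> n s - h s) + norm (\<psi> m s - h s))"
    proof (rule integral_norm_bound_integral)
      show "(\<lambda>s. norm (\<psi> n s - h s) + norm (\<psi> m s - h s)) integrable_on {a..b}"
        using D by (intro integrable_add) blast+
      show "norm (\<psi> n s - \<psi> m s) \<le> norm (\<psi> n s - h s) + norm (\<psi> m s - h s)" for s
        using norm_triangle_ineq4[of "\<psi> n s - h s" "\<psi> m s - h s"] by simp
    qed (intro integrable_diff \<psi>)
    also have "\<dots> = \<delta> n + \<delta> m"
      using has_integral_add[OF D D] by (rule integral_unique)
    finally show ?thesis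
      by (simp add: I_def integral_diff \<psi>)
  qed
  have "Cauchy I"
  proof (rule metric_CauchyI)
    fix e :: real assume "e > 0"
    then obtain N where N: "\<And>n. n \<ge> N \<Longrightarrow> \<bar>\<delta> n\<bar> < e / 2"
      using LIMSEQ_D[OF lim, of "e / 2"] by auto
    have "dist (I m) (I n) < e" if "m \<ge> N" "n \<ge> N" for m n
      using N[OF that(1)] N[OF that(2)] I[of m n] by (simp add: dist_norm)
    then show "\<exists>N. \<forall>m\<ge>N. \<forall>n\<ge>N. dist (I m) (I n) < e" by blast
  qed
  then obtain J where J: "I \<longlonglongrightarrow> J"
    using Cauchy_convergent_iff convergent_def by blast
  have "(h has_integral J) (cbox a b)"
    unfolding has_integral
  proof (intro allI impI)
    fix e :: real assume e: "e > 0"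
    have "\<forall>\<^sub>F n in sequentially. norm (\<delta> n) < e / 5 \<and> norm (I n - J) < e / 5"
      using tendstoD[OF lim, of "e/5"] tendstoD[OF J, of "e/5"] e
      by (auto simp: dist_norm eventually_conj_iff)
    then obtain n where n: "norm (\<delta> n) < e / 5" "norm (I n - J) < e / 5"
      using eventually_happens'[OF sequentially_bot] by blast
    have "(\<psi> n has_integral I n) (cbox a b)"
      using \<psi>[of n] by (simp add: I_def has_integral_integral)
    from this[unfolded has_integral, rule_format, of "e / 5"] e
    obtain \<gamma>1 where g1: "gauge \<gamma>1" "\<And>\<D>. \<D> tagged_division_of (cbox a b) \<Longrightarrow> \<gamma>1 fine \<D> \<Longrightarrow>
        norm ((\<Sum>(x,k)\<in>\<D>. measure lborel k *\<^sub>R \<psi> n x) - I n) < e / 5"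
      by auto
    have "((\<lambda>s. norm (\<psi> n s - h s)) has_integral \<delta> n) (cbox a b)"
      using D by simp
    from this[unfolded has_integral, rule_format, of "e / 5"] e
    obtain \<gamma>2 where g2: "gauge \<gamma>2" "\<And>\<D>. \<D> tagged_division_of (cbox a b) \<Longrightarrow> \<gamma>2 fine \<D> \<Longrightarrow>
        norm ((\<Sum>(x,k)\<in>\<D>. measure lborel k *\<^sub>R norm (\<psi> n x - h x)) - \<delta> n) < e / 5"
      by auto
    have "norm ((\<Sum>(x,k)\<in>\<D>. measure lborel k *\<^sub>R h x) - J) < e"
      if T: "\<D> tagged_division_of (cbox a b)" "(\<lambda>x. \<gamma>1 x \<inter> \<gamma>2 x) fine \<D>" for \<D>
    proof -
      have "norm ((\<Sum>(x,k)\<in>\<D>. measure lborel k *\<^sub>R \<psi> n x) - (\<Sum>(x,k)\<in>\<D>. measure lborel k *\<^sub>R h x))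
          = norm (\<Sum>(x,k)\<in>\<D>. measure lborel k *\<^sub>R (\<psi> n x - h x))"
        by (simp add: sum_subtractf[symmetric] scaleR_diff_right split_def)
      also have "\<dots> \<le> (\<Sum>(x,k)\<in>\<D>. measure lborel k *\<^sub>R norm (\<psi> n x - h x))"
        by (rule sum_norm_le) (auto simp: split_def)
      finally have "norm ((\<Sum>(x,k)\<in>\<D>. measure lborel k *\<^sub>R \<psi> n x) - (\<Sum>(x,k)\<in>\<D>. measure lborel k *\<^sub>R h x))
        \<le> (\<Sum>(x,k)\<in>\<D>. measure lborel k *\<^sub>R norm (\<psi> n x - h x))" .
      moreover have "norm ((\<Sum>(x,k)\<in>\<D>. measure lborel k *\<^sub>R norm (\<psi> n x - h x)) - \<delta> n) < e / 5"
        using T by (intro g2) (auto simp: fine_Int)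
      moreover have "norm ((\<Sum>(x,k)\<in>\<D>. measure lborel k *\<^sub>R \<psi> n x) - I n) < e / 5"
        using T by (intro g1) (auto simp: fine_Int)
      moreover have "norm ((\<Sum>(x,k)\<in>\<D>. measure lborel k *\<^sub>R h x) - J)
        \<le> norm ((\<Sum>(x,k)\<in>\<D>. measure lborel k *\<^sub>R \<psi> n x) - (\<Sum>(x,k)\<in>\<D>. measure lborel k *\<^sub>R h x))
          + norm ((\<Sum>(x,k)\<in>\<D>. measure lborel k *\<^sub>R \<psi> n x) - I n) + norm (I n - J)"
        by (rule tri)
      ultimately show ?thesis
        using n e by (simp only: real_norm_def)
    qed
    then show "\<exists>\<gamma>. gauge \<gamma> \<and> (\<forall>\<D>. \<D> tagged_division_of cbox a b \<and> \<gamma> fine \<D> \<longrightarrow>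
        norm ((\<Sum>(x,k)\<in>\<D>. measure lborel k *\<^sub>R h x) - J) < e)"
      using gauge_Int[OF g1(1) g2(1)] by blast
  qed
  then show ?thesis by auto
qed

lemma bochner_integrable_on_imp:
  fixes h :: "real \<Rightarrow> 'a::banach"
  assumes h: "bochner_integrable_on h {a..b}"
  shows "h integrable_on {a..b}"
    and "ennreal (norm (integral {a..b} h)) \<le> (\<integral>\<^sup>+s\<in>{a..b}. ennreal (norm (h s)) \<partial>lebesgue)"
proof -
  define h' where "h' s = (if s \<in> {a..b} then h s else 0)" for s
  have h': "smeas h'" and int: "(\<integral>\<^sup>+s\<in>{a..b}. ennreal (norm (h s)) \<partial>lebesgue) < \<infinity>"
    using h bochner_integrable_on_iff[of "{a..b}" h] by (simp_all add: h'_def[abs_def])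
  have nm: "(\<integral>\<^sup>+s. ennreal (norm (h' s)) \<partial>lebesgue) = (\<integral>\<^sup>+s\<in>{a..b}. ennreal (norm (h s)) \<partial>lebesgue)"
    by (intro nn_integral_cong) (auto simp: h'_def indicator_def)
  have int': "integrable lebesgue (\<lambda>s. norm (h' s))"
    using smeas_norm[OF h'] int nm by (intro integrableI_bounded) auto
  obtain \<phi> where \<phi>: "\<And>n::nat. simple_function lebesgue (\<phi> n)" "AE s in lebesgue. (\<lambda>n. \<phi> n s) \<longlonglongrightarrow> h' s"
    using smeas_simple_approx[OF h'] by blast
  define \<psi> where "\<psi> n s = (if norm (\<phi> n s - h' s) \<le> norm (h' s) then \<phi> n s else 0)" for n s
  have sm: "smeas (\<lambda>s. \<phi> n s - h' s)" for n
    by (intro smeas_diff smeas_simple_function \<phi> h')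
  have sf: "simple_function lebesgue (\<psi> n)" for n
    unfolding \<psi>_def
  proof (rule simple_function_If[OF \<phi>(1)])
    have [measurable]: "(\<lambda>s. norm (\<phi> n s - h' s)) \<in> borel_measurable lebesgue"
        "(\<lambda>s. norm (h' s)) \<in> borel_measurable lebesgue"
      by (auto intro: smeas_norm sm h')
    show "{s \<in> space lebesgue. norm (\<phi> n s - h' s) \<le> norm (h' s)} \<in> sets lebesgue" by measurable
  qed simp
  have sm\<psi>: "smeas (\<lambda>s. \<psi> n s - h' s)" for n
    by (intro smeas_diff smeas_simple_function sf h')
  have le: "norm (\<psi> n s - h' s) \<le> norm (h' s)" for n s
    by (simp add: \<psi>_def)
  have conv: "AE s in lebesgue. (\<lambda>n. norm (\<psi> n s - h' s)) \<longlonglongrightarrow> 0"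
    using \<phi>(2)
  proof eventually_elim
    case (elim s)
    have lim: "(\<lambda>n. norm (\<phi> n s - h' s)) \<longlonglongrightarrow> 0"
      using tendsto_norm_zero[OF LIM_zero[OF elim]] .
    show ?case
    proof (cases "h' s = 0")
      case True
      then have "norm (\<psi> n s - h' s) = 0" for n by (simp add: \<psi>_def)
      then show ?thesis by simp
    next
      case False
      then have "\<forall>\<^sub>F n in sequentially. norm (\<phi> n s - h' s) < norm (h' s)"
        using order_tendstoD(2)[OF lim] by simp
      then have "\<forall>\<^sub>F n in sequentially. norm (\<phi> n s - h' s) = norm (\<psi> n s - h' s)"
        by eventually_elim (simp add: \<psi>_def)
      with lim show ?thesis by (simp add: tendsto_cong)
    qed
  qed
  define \<delta> where "\<delta> n = (LINT s|lebesgue. norm (\<psi> n s - h' s))" for n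
  have \<delta>: "\<delta> \<longlonglongrightarrow> 0"
    using integral_dominated_convergence[of "\<lambda>_. 0" lebesgue "\<lambda>n s. norm (\<psi> n s - h' s)" "\<lambda>s. norm (h' s)"]
      smeas_norm[OF sm\<psi>] int' conv le by (simp add: \<delta>_def[abs_def])
  have i\<psi>: "integrable lebesgue (\<lambda>s. norm (\<psi> n s - h' s))" for n
    by (rule Bochner_Integration.integrable_bound[OF int']) (use smeas_norm[OF sm\<psi>] le in auto)
  have zero: "\<psi> n s - h' s = 0" if "s \<notin> {a..b}" for n s
    using that le[of n s] by (auto simp: h'_def)
  have D': "((\<lambda>s. norm (\<psi> n s - h' s)) has_integral \<delta> n) {a..b}" for n
  proof -
    have "((\<lambda>s. norm (\<psi> n s - h' s)) has_integral \<delta> n) UNIV"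
      using has_integral_integral_lebesgue[OF i\<psi>] by (simp add: \<delta>_def)
    then have "((\<lambda>s. if s \<in> {a..b} then norm (\<psi> n s - h' s) else 0) has_integral \<delta> n) UNIV"
      by (rule has_integral_eq[rotated]) (use zero in auto)
    then show ?thesis by (simp only: has_integral_restrict_UNIV)
  qed
  have D: "((\<lambda>s. norm (\<psi> n s - h s)) has_integral \<delta> n) {a..b}" for n
    by (rule has_integral_eq[OF _ D']) (simp add: h'_def)
  show hi: "h integrable_on {a..b}"
    using has_integral_L1_limit[OF simple_function_integrable_on[OF sf] D \<delta>] .
  have "((\<lambda>s. norm (h' s)) has_integral (LINT s|lebesgue. norm (h' s))) UNIV"
    using has_integral_integral_lebesgue[OF int'] .
  then have "((\<lambda>s. if s \<in> {a..b} then norm (h s) else 0) has_integral (LINT s|lebesgue. norm (h' s))) UNIV"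
    by (rule has_integral_eq[rotated]) (auto simp: h'_def)
  then have N: "((\<lambda>s. norm (h s)) has_integral (LINT s|lebesgue. norm (h' s))) {a..b}"
    by (simp only: has_integral_restrict_UNIV)
  have "norm (integral {a..b} h) \<le> integral {a..b} (\<lambda>s. norm (h s))"
    by (rule integral_norm_bound_integral[OF hi]) (use N in auto)
  also have "\<dots> = (LINT s|lebesgue. norm (h' s))"
    using N by (rule integral_unique)
  finally have "ennreal (norm (integral {a..b} h)) \<le> ennreal (LINT s|lebesgue. norm (h' s))"
    by (rule ennreal_leI)
  also have "\<dots> = (\<integral>\<^sup>+s. ennreal (norm (h' s)) \<partial>lebesgue)"
    using nn_integral_eq_integral[OF int'] by simp
  finally show "ennreal (norm (integral {a..b} h)) \<le> (\<integral>\<^sup>+s\<in>{a..b}. ennreal (norm (h s)) \<partial>lebesgue)"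
    by (simp add: nm)
qed

section \<open>Norm continuity of the semigroup\<close>

lemma mlo_inverse_resolvent:
  assumes "z \<in> mlo_resolvent_set A"
  shows "mlo_inverse (mlo_shift z A) y = {blinfun_apply (mlo_resolvent A z) y}"
proof -
  have "\<exists>!R. \<forall>y. mlo_inverse (mlo_shift z A) y = {blinfun_apply R y}"
  proof (rule ex_ex1I)
    show "\<exists>R. \<forall>y. mlo_inverse (mlo_shift z A) y = {blinfun_apply R y}"
      using assms by (auto simp: mlo_resolvent_set_def)
  qed (auto intro: blinfun_eqI)
  from theI'[OF this] show ?thesis
    unfolding mlo_resolvent_def by blast
qed

lemma mlo_resolvent_identity:
  assumes z: "z \<in> mlo_resolvent_set A" and w: "w \<in> mlo_resolvent_set A"
  shows "mlo_resolvent A w y =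
    mlo_resolvent A z y + mlo_resolvent A z ((z - w) *\<^sub>C mlo_resolvent A w y)"
proof -
  define x where "x = mlo_resolvent A w y"
  have "x \<in> mlo_inverse (mlo_shift w A) y"
    by (simp add: mlo_inverse_resolvent[OF w] x_def)
  then obtain a where a: "a \<in> A x" "y = w *\<^sub>C x - a"
    by (auto simp: mlo_inverse_def mlo_shift_def)
  have "y + (z - w) *\<^sub>C x = z *\<^sub>C x - a"
    using scaleC_add_left[of w "z - w" x] by (simp add: a(2))
  then have "x \<in> mlo_inverse (mlo_shift z A) (y + (z - w) *\<^sub>C x)"
    using a(1) by (auto simp: mlo_inverse_def mlo_shift_def)
  then have "x = mlo_resolvent A z (y + (z - w) *\<^sub>C x)"
    by (simp add: mlo_inverse_resolvent[OF z])
  then show ?thesis by (simp add: x_def blinfun.add_right)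
qed

lemma norm_mlo_resolvent_diff_le:
  assumes z: "z \<in> mlo_resolvent_set A" and w: "w \<in> mlo_resolvent_set A"
  shows "norm (mlo_resolvent A w - mlo_resolvent A z)
    \<le> norm (mlo_resolvent A z) * cmod (z - w) * norm (mlo_resolvent A w)"
proof (rule norm_blinfun_bound)
  fix y
  have "norm ((mlo_resolvent A w - mlo_resolvent A z) y) =
      norm (mlo_resolvent A z ((z - w) *\<^sub>C mlo_resolvent A w y))"
    by (subst minus_blinfun.rep_eq, subst mlo_resolvent_identity[OF z w]) simp
  also have "\<dots> \<le> norm (mlo_resolvent A z) * (cmod (z - w) * norm (mlo_resolvent A w y))"
    using norm_blinfun[of "mlo_resolvent A z"] by (metis norm_scaleC)
  also have "\<dots> \<le> norm (mlo_resolvent A z) * (cmod (z - w) * (norm (mlo_resolvent A w) * norm y))"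
    by (intro mult_left_mono norm_blinfun) auto
  finally show "norm ((mlo_resolvent A w - mlo_resolvent A z) y)
    \<le> norm (mlo_resolvent A z) * cmod (z - w) * norm (mlo_resolvent A w) * norm y"
    by (simp add: mult.assoc)
qed simp

lemma norm_scaleC_op_le: "norm (scaleC_op a) \<le> cmod a"
  by (rule norm_blinfun_bound) (auto simp: norm_scaleC)

lemma continuous_on_scaleC_op: "continuous_on UNIV (scaleC_op :: complex \<Rightarrow> 'a::complex_banach \<Rightarrow>\<^sub>L 'a)"
proof -
  have "bounded_linear (scaleC_op :: complex \<Rightarrow> 'a \<Rightarrow>\<^sub>L 'a)"
  proof (rule bounded_linear_intro[where K=1])
    show "scaleC_op (x + y) = (scaleC_op x + scaleC_op y :: 'a \<Rightarrow>\<^sub>L 'a)" for x y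
      by (rule blinfun_eqI) (simp add: scaleC_add_left blinfun.add_left)
    show "scaleC_op (r *\<^sub>R x) = (r *\<^sub>R scaleC_op x :: 'a \<Rightarrow>\<^sub>L 'a)" for r x
      by (rule blinfun_eqI)
        (simp add: blinfun.scaleR_left scaleR_eq_scaleC[where 'a='a] scaleC_scaleC scaleR_conv_of_real)
    show "norm (scaleC_op x :: 'a \<Rightarrow>\<^sub>L 'a) \<le> norm x * 1" for x
      by (simp add: norm_scaleC_op_le)
  qed
  then show ?thesis
    by (rule linear_continuous_on)
qed

lemma integrable_exp_abs:
  assumes a: "a > 0"
  shows "(\<lambda>x::real. exp (- a * \<bar>x\<bar>)) integrable_on UNIV"
proof -
  have "((\<lambda>x. exp (- a * x)) has_integral exp (- a * 0) / a) {0..}"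
    using a by (rule has_integral_exp_minus_to_infinity)
  then have "(\<lambda>x. exp (- a * x)) absolutely_integrable_on {0..}"
    by (intro nonnegative_absolutely_integrable_1) auto
  then have 1: "integrable lebesgue (\<lambda>x. indicator {0..} x *\<^sub>R exp (- a * x))"
    by (simp add: set_integrable_def)
  then have 2: "integrable lebesgue (\<lambda>x. indicator {0..} (0 + (-1) * x) *\<^sub>R exp (- a * (0 + (-1) * x)))"
    by (subst lebesgue_integrable_real_affine_iff) auto
  have "integrable lebesgue (\<lambda>x. exp (- a * \<bar>x\<bar>))"
    by (rule Bochner_Integration.integrable_bound[OF Bochner_Integration.integrable_add[OF 1 2]])
      (auto simp: indicator_def intro!: measurable_completion)
  then show ?thesis by (rule integrable_on_lebesgue)
qed

lemma continuous_on_P_curve: "continuous_on S (P_curve c)"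
  unfolding P_curve_def by (intro continuous_on_Complex continuous_intros)

lemma continuous_P_semigroup:
  assumes P: "condition_P A c \<beta>"
  shows "continuous_on {0<..} (P_semigroup A c)"
proof -
  let ?K = "\<lambda>\<sigma> t \<eta>. 1 / (2 * of_real pi * \<i>) * exp (P_curve c \<eta> * of_real t) * Complex (- c * \<sigma>) 1"
  define G where "G \<sigma> t \<eta> = scaleC_op (?K \<sigma> t \<eta>) o\<^sub>L mlo_resolvent A (P_curve c \<eta>)" for \<sigma> t \<eta>
  define F where "F t \<eta> = G (sgn \<eta>) t \<eta>" for t \<eta> :: real
  have T: "P_semigroup A c t = integral UNIV (F t)" for t
    unfolding P_semigroup_def F_def[abs_def] G_def ..
  obtain M0 where c: "c > 0" and beta: "\<beta> > 0" and sub: "P_region c \<subseteq> mlo_resolvent_set A" and "M0 > 0"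
    and M0': "\<And>z. z \<in> P_region c \<Longrightarrow> norm (mlo_resolvent A z) \<le> M0 * (1 + cmod z) powr (- \<beta>)"
    using P unfolding condition_P_def by auto
  have M0: "norm (mlo_resolvent A z) \<le> M0" if "z \<in> P_region c" for z
  proof -
    have "(1 + cmod z) powr (- \<beta>) \<le> 1"
      using beta powr_mono[of "- \<beta>" 0 "1 + cmod z"] by (auto split: if_splits)
    then have "M0 * (1 + cmod z) powr (- \<beta>) \<le> M0 * 1"
      using \<open>M0 > 0\<close> by (intro mult_left_mono) auto
    then show ?thesis using M0'[OF that] by linarith
  qed
  have cur: "P_curve c \<eta> \<in> P_region c" for \<eta>
    by (simp add: P_region_def P_curve_def)
  have Rc: "continuous_on UNIV (\<lambda>\<eta>. mlo_resolvent A (P_curve c \<eta>))"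
  proof -
    have "continuous_on (P_region c) (mlo_resolvent A)"
    proof (rule lipschitz_on_continuous_on[of "M0 * M0"], rule lipschitz_onI)
      fix z w assume zw: "z \<in> P_region c" "w \<in> P_region c"
      have "norm (mlo_resolvent A z - mlo_resolvent A w)
          \<le> norm (mlo_resolvent A w) * cmod (w - z) * norm (mlo_resolvent A z)"
        using zw sub by (intro norm_mlo_resolvent_diff_le) auto
      also have "\<dots> \<le> M0 * cmod (w - z) * M0"
        using zw M0 \<open>M0 > 0\<close> by (intro mult_mono) auto
      finally show "dist (mlo_resolvent A z) (mlo_resolvent A w) \<le> M0 * M0 * dist z w"
        by (simp add: dist_norm norm_minus_commute mult_ac)
    qed (use \<open>M0 > 0\<close> in auto)
    then show ?thesis
      by (rule continuous_on_compose2) (use cur continuous_on_P_curve in auto)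
  qed
  have Gc: "continuous_on UNIV (\<lambda>(t, \<eta>). G \<sigma> t \<eta>)" for \<sigma>
    unfolding G_def split_def
  proof (rule bounded_bilinear.continuous_on[OF bounded_bilinear_blinfun_compose])
    have "continuous_on UNIV (\<lambda>x. ?K \<sigma> (fst x) (snd x))"
      by (intro continuous_intros continuous_on_compose2[OF continuous_on_P_curve[of UNIV]]) auto
    then show "continuous_on UNIV (\<lambda>x. scaleC_op (?K \<sigma> (fst x) (snd x)) :: 'a \<Rightarrow>\<^sub>L 'a)"
      by (rule continuous_on_compose2[OF continuous_on_scaleC_op]) auto
    show "continuous_on UNIV (\<lambda>x. mlo_resolvent A (P_curve c (snd x)))"
      by (rule continuous_on_compose2[OF Rc]) (auto intro: continuous_intros)
  qed
  define C where "C = cmod (1 / (2 * of_real pi * \<i>)) * (c + 1) * M0"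
  have C0: "C \<ge> 0" using c \<open>M0 > 0\<close> by (simp add: C_def)
  have bound: "norm (F t \<eta>) \<le> C * exp (- (c * \<delta>) * \<bar>\<eta>\<bar>)" if t: "t \<ge> \<delta>" and \<delta>: "\<delta> > 0" for t \<eta> \<delta>
  proof -
    have "cmod (Complex (- c * sgn \<eta>) 1) \<le> \<bar>- c * sgn \<eta>\<bar> + \<bar>1\<bar>"
      by (metis cmod_le complex.sel)
    also have "\<dots> \<le> c + 1" using c by (auto simp: sgn_if)
    finally have 1: "cmod (Complex (- c * sgn \<eta>) 1) \<le> c + 1" .
    have "c * \<delta> * \<bar>\<eta>\<bar> \<le> c * (\<bar>\<eta>\<bar> + 1) * t"
      using c t \<delta> mult_mono[of \<delta> t "\<bar>\<eta>\<bar>" "\<bar>\<eta>\<bar> + 1"]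
      by (simp add: mult_ac)
    then have 2: "cmod (exp (P_curve c \<eta> * of_real t)) \<le> exp (- (c * \<delta>) * \<bar>\<eta>\<bar>)"
      by (simp add: P_curve_def)
    have "norm (F t \<eta>) \<le> norm (scaleC_op (?K (sgn \<eta>) t \<eta>) :: 'a \<Rightarrow>\<^sub>L 'a) * norm (mlo_resolvent A (P_curve c \<eta>))"
      unfolding F_def G_def by (rule norm_blinfun_compose)
    also have "\<dots> \<le> cmod (?K (sgn \<eta>) t \<eta>) * M0"
      by (intro mult_mono norm_scaleC_op_le M0 cur) auto
    also have "\<dots> \<le> (cmod (1 / (2 * of_real pi * \<i>)) * exp (- (c * \<delta>) * \<bar>\<eta>\<bar>) * (c + 1)) * M0"
      unfolding norm_mult using 1 2 \<open>M0 > 0\<close> c by (intro mult_mono mult_nonneg_nonneg) auto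
    finally show ?thesis by (simp add: C_def mult_ac)
  qed
  have int0: "(F t has_integral (integral {-r..0} (G (-1) t) + integral {0..r} (G 1 t))) {-r..r}"
    if r: "r \<ge> 0" for t r
  proof (rule has_integral_combine)
    have *: "continuous_on S (G \<sigma> t)" for S \<sigma>
    proof -
      have "continuous_on S (\<lambda>\<eta>. (t, \<eta>))" by (intro continuous_intros)
      from continuous_on_compose2[OF Gc[of \<sigma>] this] show ?thesis by simp
    qed
    show "(F t has_integral integral {-r..0} (G (-1) t)) {-r..0}"
      by (rule has_integral_spike_finite[of "{0}", OF _ _ integrable_integral[OF integrable_continuous_real[OF *]]])
        (auto simp: F_def)
    show "(F t has_integral integral {0..r} (G 1 t)) {0..r}"
      by (rule has_integral_spike_finite[of "{0}", OF _ _ integrable_integral[OF integrable_continuous_real[OF *]]])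
        (auto simp: F_def)
  qed (use r in auto)
  have intF: "F t integrable_on UNIV" if t: "t > 0" for t
  proof (rule integrable_on_all_intervals_integrable_bound)
    show "(\<lambda>x. if x \<in> UNIV then F t x else 0) integrable_on cbox a b" for a b
    proof -
      have "F t integrable_on {- (\<bar>a\<bar> + \<bar>b\<bar>)..\<bar>a\<bar> + \<bar>b\<bar>}"
        using int0[of "\<bar>a\<bar> + \<bar>b\<bar>" t] by auto
      then show ?thesis
        by (simp, rule integrable_subinterval_real) auto
    qed
    show "(\<lambda>x. C * exp (- (c * t) * \<bar>x\<bar>)) integrable_on UNIV"
      using c t by (intro integrable_on_mult_right integrable_exp_abs) auto
    show "norm (F t x) \<le> C * exp (- (c * t) * \<bar>x\<bar>)" for x
      using bound[of t t] t by simp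
  qed
  define J where "J n t = integral {- real n..0} (G (-1) t) + integral {0..real n} (G 1 t)" for n t
  have Jc: "continuous_on S (J n)" for n S
  proof -
    have "continuous_on S (\<lambda>t. integral (cbox a b) (G \<sigma> t))" for a b \<sigma>
      by (rule integral_continuous_on_param) (rule continuous_on_subset[OF Gc], auto)
    from this[of "- real n" 0 "-1"] this[of 0 "real n" 1] show ?thesis
      unfolding J_def[abs_def] by (intro continuous_on_add) auto
  qed
  have *: "continuous_on {\<delta>..} (P_semigroup A c)" if \<delta>: "\<delta> > 0" for \<delta>
  proof (rule uniform_limit_theorem)
    define Z where "Z = integral UNIV (\<lambda>x::real. exp (- (c * \<delta> / 2) * \<bar>x\<bar>))"
    have le: "norm (J n t - P_semigroup A c t) \<le> exp (- (c * \<delta> / 2) * real n) * (C * Z)"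
      if t: "t \<ge> \<delta>" for n t
    proof -
      define F1 where "F1 \<eta> = (if \<eta> \<in> {- real n..real n} then F t \<eta> else 0)" for \<eta>
      have "(F1 has_integral J n t) UNIV"
        unfolding F1_def[abs_def] has_integral_restrict_UNIV J_def by (rule int0) simp
      then have F1: "F1 integrable_on UNIV" "integral UNIV F1 = J n t" by auto
      have iF: "F t integrable_on UNIV" using intF t \<delta> by auto
      have "norm (integral UNIV (\<lambda>\<eta>. F1 \<eta> - F t \<eta>))
          \<le> integral UNIV (\<lambda>\<eta>. exp (- (c * \<delta> / 2) * real n) * (C * exp (- (c * \<delta> / 2) * \<bar>\<eta>\<bar>)))"
      proof (rule integral_norm_bound_integral)
        show "(\<lambda>\<eta>. exp (- (c * \<delta> / 2) * real n) * (C * exp (- (c * \<delta> / 2) * \<bar>\<eta>\<bar>))) integrable_on UNIV"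
          using c \<delta> by (intro integrable_on_mult_right integrable_exp_abs) auto
        fix \<eta> :: real
        show "norm (F1 \<eta> - F t \<eta>) \<le> exp (- (c * \<delta> / 2) * real n) * (C * exp (- (c * \<delta> / 2) * \<bar>\<eta>\<bar>))"
        proof (cases "\<eta> \<in> {- real n..real n}")
          case True
          then show ?thesis using C0 by (simp add: F1_def)
        next
          case False
          then have F10: "F1 \<eta> = 0" by (simp only: F1_def if_False)
          have "real n \<le> \<bar>\<eta>\<bar>" using False by auto
          then have "- (c * \<delta>) * \<bar>\<eta>\<bar> \<le> - (c * \<delta> / 2) * real n + - (c * \<delta> / 2) * \<bar>\<eta>\<bar>"
            using c \<delta> mult_left_mono[of "real n" "\<bar>\<eta>\<bar>" "c * \<delta>"] by (simp add: field_simps)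
          then have "exp (- (c * \<delta>) * \<bar>\<eta>\<bar>) \<le> exp (- (c * \<delta> / 2) * real n) * exp (- (c * \<delta> / 2) * \<bar>\<eta>\<bar>)"
            by (simp only: exp_add[symmetric] exp_le_cancel_iff)
          then have "C * exp (- (c * \<delta>) * \<bar>\<eta>\<bar>) \<le> C * (exp (- (c * \<delta> / 2) * real n) * exp (- (c * \<delta> / 2) * \<bar>\<eta>\<bar>))"
            using C0 by (rule mult_left_mono)
          then show ?thesis
            using F10 bound[OF t \<delta>, of \<eta>] by (simp add: mult_ac)
        qed
      qed (intro integrable_diff F1 iF)
      also have "\<dots> = exp (- (c * \<delta> / 2) * real n) * (C * Z)"
        by (simp add: Z_def)
      finally show ?thesis
        by (simp add: integral_diff F1 iF T)
    qed
    show "uniform_limit {\<delta>..} J (P_semigroup A c) sequentially"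
    proof (rule uniform_limitI)
      fix e :: real assume e: "e > 0"
      have "(\<lambda>n. exp (- (c * \<delta> / 2) * real n) * (C * Z)) \<longlonglongrightarrow> 0"
      proof -
        have "(\<lambda>n. exp (- (c * \<delta> / 2)) ^ n) \<longlonglongrightarrow> 0"
          using c \<delta> by (intro LIMSEQ_realpow_zero) auto
        then show ?thesis
          by (intro tendsto_mult_left_zero) (simp add: exp_of_nat_mult[symmetric] mult_ac)
      qed
      then have "\<forall>\<^sub>F n in sequentially. exp (- (c * \<delta> / 2) * real n) * (C * Z) < e"
        using e by (rule order_tendstoD)
      then show "\<forall>\<^sub>F n in sequentially. \<forall>t\<in>{\<delta>..}. dist (J n t) (P_semigroup A c t) < e"
        by eventually_elim (use le in \<open>auto simp: dist_norm intro: le_less_trans\<close>)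
    qed
  qed (simp_all add: Jc)
  have "isCont (P_semigroup A c) t" if "t > 0" for t
  proof (rule continuous_on_interior[OF *[of "t / 2"]])
    show "t \<in> interior {t / 2..}" using that by simp
  qed (use that in auto)
  then show ?thesis by (auto intro: continuous_at_imp_continuous_on)
qed

section \<open>Asymptotically almost periodic quasi-distances\<close>

text \<open>Almost periodicity in norm and in the sense of Stepanov are treated together through
  \<open>D s t = norm (u s - u t)\<close> and \<open>D s t = \<integral>\<^sub>0\<^sup>1 norm (h (s + r) - h (t + r)) powr p dr\<close>. The
  factor \<open>K\<close> makes up for the missing \<open>p\<close>-th root.\<close>

definition almost_periods :: "(real \<Rightarrow> real \<Rightarrow> bool) \<Rightarrow> bool"
  where "almost_periods P \<longleftrightarrow> (\<exists>l>0. \<exists>m>0. \<forall>a\<ge>0. \<exists>\<tau>\<in>{a..a + l}. \<forall>t\<ge>m. P t \<tau>)"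

lemma almost_periods_mono:
  assumes P: "almost_periods P" and d: "d \<ge> 0"
    and Q: "\<And>m \<tau> t. m > 0 \<Longrightarrow> \<tau> \<ge> 0 \<Longrightarrow> (\<And>t. t \<ge> m \<Longrightarrow> P t \<tau>) \<Longrightarrow> t \<ge> m + d \<Longrightarrow> Q t \<tau>"
  shows "almost_periods Q"
proof -
  obtain l m where lm: "l > 0" "m > 0" "\<And>a. a \<ge> 0 \<Longrightarrow> \<exists>\<tau>\<in>{a..a + l}. \<forall>t\<ge>m. P t \<tau>"
    using P unfolding almost_periods_def by blast
  have "\<exists>\<tau>\<in>{a..a + l}. \<forall>t\<ge>m + d. Q t \<tau>" if a: "a \<ge> 0" for a
  proof -
    obtain \<tau> where \<tau>: "\<tau> \<in> {a..a + l}" "\<And>t. t \<ge> m \<Longrightarrow> P t \<tau>" using lm(3)[OF a] by blast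
    then have "Q t \<tau>" if "t \<ge> m + d" for t using Q[OF lm(2) _ \<tau>(2) that] a by simp
    then show ?thesis using \<tau>(1) by blast
  qed
  moreover have "m + d > 0" using lm(2) d by simp
  ultimately show ?thesis
    unfolding almost_periods_def using lm(1) by blast
qed

lemma almost_periods_tail:
  assumes P: "\<And>t \<tau>. t \<ge> m \<Longrightarrow> \<tau> \<ge> 0 \<Longrightarrow> P t \<tau>"
  shows "almost_periods P"
  unfolding almost_periods_def
proof (intro exI conjI allI impI)
  show "\<exists>\<tau>\<in>{a..a + 1}. \<forall>t\<ge>max m 1. P t \<tau>" if "a \<ge> 0" for a :: real
    using that P by (auto intro!: bexI[of _ a])
qed auto

definition aap_dist :: "real \<Rightarrow> (real \<Rightarrow> real \<Rightarrow> real) \<Rightarrow> bool"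
  where "aap_dist K D \<longleftrightarrow> K \<ge> 1 \<and>
    (\<forall>s\<ge>0. \<forall>t\<ge>0. 0 \<le> D s t \<and> D s t = D t s) \<and> (\<forall>t\<ge>0. D t t = 0) \<and>
    (\<forall>r\<ge>0. \<forall>s\<ge>0. \<forall>t\<ge>0. D r t \<le> K * (D r s + D s t)) \<and>
    (\<forall>t\<ge>0. ((\<lambda>s. D s t) \<longlongrightarrow> 0) (at t within {0..})) \<and>
    (\<forall>\<epsilon>>0. almost_periods (\<lambda>t \<tau>. D (t + \<tau>) t \<le> \<epsilon>))"

context
  fixes K :: real and D :: "real \<Rightarrow> real \<Rightarrow> real"
  assumes D: "aap_dist K D"
begin

lemma aap_dist_K: "K \<ge> 1"
  using D[unfolded aap_dist_def, THEN conjunct1] .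

lemma aap_dist_nonneg: "s \<ge> 0 \<Longrightarrow> t \<ge> 0 \<Longrightarrow> 0 \<le> D s t"
  using D[unfolded aap_dist_def, THEN conjunct2, THEN conjunct1] by simp

lemma aap_dist_sym: "s \<ge> 0 \<Longrightarrow> t \<ge> 0 \<Longrightarrow> D s t = D t s"
  using D[unfolded aap_dist_def, THEN conjunct2, THEN conjunct1] by blast

lemma aap_dist_self: "t \<ge> 0 \<Longrightarrow> D t t = 0"
  using D[unfolded aap_dist_def, THEN conjunct2, THEN conjunct2, THEN conjunct1] by simp

lemma aap_dist_triangle: "r \<ge> 0 \<Longrightarrow> s \<ge> 0 \<Longrightarrow> t \<ge> 0 \<Longrightarrow> D r t \<le> K * (D r s + D s t)"
  using D[unfolded aap_dist_def, THEN conjunct2, THEN conjunct2, THEN conjunct2, THEN conjunct1] by simp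

lemma aap_dist_continuous: "t \<ge> 0 \<Longrightarrow> ((\<lambda>s. D s t) \<longlongrightarrow> 0) (at t within {0..})"
  using D[unfolded aap_dist_def, THEN conjunct2, THEN conjunct2, THEN conjunct2, THEN conjunct2, THEN conjunct1] by simp

lemma aap_dist_almost_periods: "\<epsilon> > 0 \<Longrightarrow> almost_periods (\<lambda>t \<tau>. D (t + \<tau>) t \<le> \<epsilon>)"
  using D[unfolded aap_dist_def, THEN conjunct2, THEN conjunct2, THEN conjunct2, THEN conjunct2, THEN conjunct2] by simp

lemma aap_dist_period:
  assumes "\<epsilon> > 0"
  obtains l m where "l > 0" "m > 0" "\<And>a. a \<ge> 0 \<Longrightarrow> \<exists>\<tau>\<in>{a..a + l}. \<forall>t\<ge>m. D (t + \<tau>) t \<le> \<epsilon>"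
  using aap_dist_almost_periods[OF assms] that unfolding almost_periods_def by metis

lemma aap_dist_uniform_compact:
  assumes "\<epsilon> > 0"
  obtains \<delta> where "\<delta> > 0" "\<And>s t. s \<in> {0..b} \<Longrightarrow> t \<in> {0..b} \<Longrightarrow> \<bar>s - t\<bar> < \<delta> \<Longrightarrow> D s t \<le> \<epsilon>"
proof -
  have K: "K \<ge> 1" by (rule aap_dist_K)
  have "\<forall>x\<in>{0..b}. \<exists>d>0. \<forall>s\<ge>0. \<bar>s - x\<bar> < d \<longrightarrow> D s x \<le> \<epsilon> / (2 * K)"
  proof
    fix x assume x: "x \<in> {0..b}"
    have "\<epsilon> / (2 * K) > 0" using K assms by simp
    then have "\<forall>\<^sub>F s in at x within {0..}. dist (D s x) 0 < \<epsilon> / (2 * K)"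
      using aap_dist_continuous[of x] x by (intro tendstoD) auto
    then obtain d where d: "d > 0" "\<And>s. s \<ge> 0 \<Longrightarrow> s \<noteq> x \<Longrightarrow> dist s x < d \<Longrightarrow> \<bar>D s x\<bar> < \<epsilon> / (2 * K)"
      unfolding eventually_at by auto
    have "D s x \<le> \<epsilon> / (2 * K)" if "s \<ge> 0" "\<bar>s - x\<bar> < d" for s
      using d(2)[of s] that aap_dist_self[of x] x \<open>\<epsilon> / (2 * K) > 0\<close>
      by (cases "s = x") (auto simp: dist_real_def)
    then show "\<exists>d>0. \<forall>s\<ge>0. \<bar>s - x\<bar> < d \<longrightarrow> D s x \<le> \<epsilon> / (2 * K)" using d(1) by blast
  qed
  then obtain d where d: "\<And>x. x \<in> {0..b} \<Longrightarrow> d x > 0"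
      "\<And>x s. x \<in> {0..b} \<Longrightarrow> s \<ge> 0 \<Longrightarrow> \<bar>s - x\<bar> < d x \<Longrightarrow> D s x \<le> \<epsilon> / (2 * K)"
    by metis
  have cover: "{0..b} \<subseteq> \<Union>((\<lambda>x. ball x (d x)) ` {0..b})"
    using d(1) by force
  have op: "open G" if "G \<in> (\<lambda>x. ball x (d x)) ` {0..b}" for G
    using that by auto
  obtain e where e: "e > 0"
      "\<And>x. x \<in> {0..b} \<Longrightarrow> \<exists>G\<in>(\<lambda>x. ball x (d x)) ` {0..b}. ball x e \<subseteq> G"
    using Heine_Borel_lemma[OF compact_Icc cover op] by metis
  have "D s t \<le> \<epsilon>" if st: "s \<in> {0..b}" "t \<in> {0..b}" "\<bar>s - t\<bar> < e" for s t
  proof -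
    obtain x where x: "x \<in> {0..b}" "ball s e \<subseteq> ball x (d x)" using e(2) st(1) by blast
    have "s \<in> ball s e" "t \<in> ball s e" using st(3) e(1) by (auto simp: dist_real_def)
    then have "\<bar>s - x\<bar> < d x" "\<bar>t - x\<bar> < d x"
      using x(2) by (auto simp: dist_real_def abs_minus_commute subset_iff)
    then have "D s x \<le> \<epsilon> / (2 * K)" "D t x \<le> \<epsilon> / (2 * K)" using d(2) x(1) st by auto
    moreover have "D s t \<le> K * (D s x + D x t)"
      using st x(1) by (intro aap_dist_triangle) auto
    moreover have "D x t = D t x" using st x(1) by (intro aap_dist_sym) auto
    ultimately have "D s t \<le> K * (\<epsilon> / (2 * K) + \<epsilon> / (2 * K))"
      using K by (smt (verit) mult_left_mono)
    then show ?thesis using K by simp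
  qed
  then show thesis using that e(1) by blast
qed

lemma aap_dist_uniform:
  assumes "\<epsilon> > 0"
  obtains \<delta> where "\<delta> > 0" "\<And>s t. s \<ge> 0 \<Longrightarrow> t \<ge> 0 \<Longrightarrow> \<bar>s - t\<bar> < \<delta> \<Longrightarrow> D s t \<le> \<epsilon>"
proof -
  have K: "K \<ge> 1" by (rule aap_dist_K)
  define e where "e = \<epsilon> / (3 * K * K)"
  have e: "e > 0" using K assms by (simp add: e_def)
  have eK: "3 * K * K * e = \<epsilon>" using K by (simp add: e_def)
  obtain l m where lm: "l > 0" "m > 0" "\<And>a. a \<ge> 0 \<Longrightarrow> \<exists>\<tau>\<in>{a..a + l}. \<forall>t\<ge>m. D (t + \<tau>) t \<le> e"
    by (rule aap_dist_period[OF e]) blast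
  obtain \<delta> where \<delta>: "\<delta> > 0"
      "\<And>s t. s \<in> {0..m + l + 2} \<Longrightarrow> t \<in> {0..m + l + 2} \<Longrightarrow> \<bar>s - t\<bar> < \<delta> \<Longrightarrow> D s t \<le> e"
    using aap_dist_uniform_compact[OF e, of "m + l + 2"] by metis
  have le: "e \<le> \<epsilon>"
    using K e mult_mono[of 1 K 1 K] by (simp add: eK[symmetric])
  have main: "D s t \<le> \<epsilon>" if st: "0 \<le> s" "s \<le> t" "t - s < min \<delta> 1" for s t
  proof (cases "s \<le> m + l + 1")
    case True
    then have "D s t \<le> e" using st by (intro \<delta>) auto
    then show ?thesis using le by simp
  next
    case False
    obtain \<tau> where \<tau>: "\<tau> \<in> {s - m - l..s - m - l + l}" "\<And>t. t \<ge> m \<Longrightarrow> D (t + \<tau>) t \<le> e"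
      using lm(3)[of "s - m - l"] False by auto
    define s' where "s' = s - \<tau>"
    define t' where "t' = t - \<tau>"
    have s't': "s' \<ge> m" "t' \<ge> m" "s' \<le> m + l" "t' \<le> m + l + 1" using \<tau>(1) st by (auto simp: s'_def t'_def)
    have 1: "D s s' \<le> e" using \<tau>(2)[of s'] s't' by (simp add: s'_def)
    have "D t t' \<le> e" using \<tau>(2)[of t'] s't' by (simp add: t'_def)
    then have 2: "D t' t \<le> e" using aap_dist_sym[of t t'] st s't' lm(2) by simp
    have 3: "D s' t' \<le> e" using s't' lm(2) st by (intro \<delta>(2)) (auto simp: s'_def t'_def)
    have "D s' t \<le> K * (D s' t' + D t' t)" using s't' st lm(2) by (intro aap_dist_triangle) auto
    also have "\<dots> \<le> K * (e + e)" using 2 3 K by (intro mult_left_mono) auto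
    finally have 4: "D s' t \<le> K * (e + e)" .
    have "e \<le> K * e" using K e by simp
    have "D s t \<le> K * (D s s' + D s' t)" using s't' st lm(2) by (intro aap_dist_triangle) auto
    also have "\<dots> \<le> K * (K * e + K * (e + e))" using 1 4 K \<open>e \<le> K * e\<close> by (intro mult_left_mono) auto
    also have "\<dots> = \<epsilon>" using eK by (simp add: algebra_simps)
    finally show ?thesis .
  qed
  have "D s t \<le> \<epsilon>" if st: "0 \<le> s" "0 \<le> t" "\<bar>s - t\<bar> < min \<delta> 1" for s t
  proof (cases "s \<le> t")
    case True
    then show ?thesis using main[of s t] st by auto
  next
    case False
    then show ?thesis using main[of t s] st aap_dist_sym[of s t] by auto
  qed
  then show thesis using that[of "min \<delta> 1"] \<delta>(1) by simp
qed

lemma aap_dist_bounded: "\<exists>B. \<forall>t\<ge>0. D t 0 \<le> B"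
proof -
  have K: "K \<ge> 1" by (rule aap_dist_K)
  obtain \<delta> where \<delta>: "\<delta> > 0" "\<And>s t. s \<ge> 0 \<Longrightarrow> t \<ge> 0 \<Longrightarrow> \<bar>s - t\<bar> < \<delta> \<Longrightarrow> D s t \<le> 1"
    by (rule aap_dist_uniform[of 1]) auto
  have local: "\<exists>B. \<forall>t\<in>{0..real n * (\<delta> / 2)}. D t 0 \<le> B" for n
  proof (induction n)
    case 0
    then show ?case using aap_dist_self[of 0] by auto
  next
    case (Suc n)
    then obtain B where B: "\<And>t. t \<in> {0..real n * (\<delta> / 2)} \<Longrightarrow> D t 0 \<le> B" by blast
    have "D t 0 \<le> K * (1 + B)" if t: "t \<in> {0..real (Suc n) * (\<delta> / 2)}" for t
    proof -
      define t' where "t' = max 0 (t - \<delta> / 2)"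
      have t': "t' \<in> {0..real n * (\<delta> / 2)}" using t \<delta>(1) mult_nonneg_nonneg[of \<delta> "real n"] by (auto simp: t'_def max_def algebra_simps)
      have "D t t' \<le> 1" using t \<delta>(1) by (intro \<delta>(2)) (auto simp: t'_def)
      moreover have "D t 0 \<le> K * (D t t' + D t' 0)" using t t' by (intro aap_dist_triangle) auto
      ultimately show ?thesis
        using B[OF t'] K by (smt (verit) mult_left_mono)
    qed
    then show ?case by blast
  qed
  obtain l m where lm: "l > 0" "m > 0" "\<And>a. a \<ge> 0 \<Longrightarrow> \<exists>\<tau>\<in>{a..a + l}. \<forall>t\<ge>m. D (t + \<tau>) t \<le> 1"
    by (rule aap_dist_period[of 1]) auto
  obtain n where n: "m + l \<le> real n * (\<delta> / 2)"
    using reals_Archimedean3[of "\<delta> / 2"] \<delta>(1) by (metis half_gt_zero less_eq_real_def)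
  obtain B where B: "\<And>t. t \<in> {0..real n * (\<delta> / 2)} \<Longrightarrow> D t 0 \<le> B" using local by blast
  have "D t 0 \<le> max B (K * (1 + B))" if t: "t \<ge> 0" for t
  proof (cases "t \<le> m + l")
    case True
    then show ?thesis using B[of t] n t by auto
  next
    case False
    obtain \<tau> where \<tau>: "\<tau> \<in> {t - m - l..t - m - l + l}" "\<And>t. t \<ge> m \<Longrightarrow> D (t + \<tau>) t \<le> 1"
      using lm(3)[of "t - m - l"] False by auto
    have "D t (t - \<tau>) \<le> 1" using \<tau>(1) \<tau>(2)[of "t - \<tau>"] by auto
    moreover have "D (t - \<tau>) 0 \<le> B" using \<tau>(1) lm n by (intro B) auto
    moreover have "D t 0 \<le> K * (D t (t - \<tau>) + D (t - \<tau>) 0)"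
      using t \<tau>(1) lm by (intro aap_dist_triangle) auto
    ultimately have "D t 0 \<le> K * (1 + B)" using K by (smt (verit) mult_left_mono)
    then show ?thesis by simp
  qed
  then show ?thesis by blast
qed

end

text \<open>Common almost periods of two families: by the pigeonhole principle the differences
  \<open>\<tau> k - \<sigma> k\<close> of almost periods \<open>\<tau> k\<close>, \<open>\<sigma> k\<close> of \<open>D1\<close>, \<open>D2\<close> taken from the same interval are, up to
  \<open>\<delta>\<close>, among those with \<open>k \<le> R\<close>; then \<open>\<tau> k - \<tau> r\<close> is close to \<open>\<sigma> k - \<sigma> r\<close> for some \<open>r \<le> R\<close>.\<close>

lemma aap_dist_add:
  assumes D1: "aap_dist K1 D1" and D2: "aap_dist K2 D2"
  shows "aap_dist (max K1 K2) (\<lambda>s t. D1 s t + D2 s t)"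
proof -
  define K where "K = max K1 K2"
  have K: "K \<ge> 1" using aap_dist_K[OF D1] by (simp add: K_def)
  have tri1: "D1 r t \<le> K * (D1 r s + D1 s t)" if "r \<ge> 0" "s \<ge> 0" "t \<ge> 0" for r s t
  proof -
    have "K1 * (D1 r s + D1 s t) \<le> K * (D1 r s + D1 s t)"
      using that aap_dist_nonneg[OF D1] by (intro mult_right_mono) (auto simp: K_def)
    then show ?thesis using aap_dist_triangle[OF D1 that] by linarith
  qed
  have tri2: "D2 r t \<le> K * (D2 r s + D2 s t)" if "r \<ge> 0" "s \<ge> 0" "t \<ge> 0" for r s t
  proof -
    have "K2 * (D2 r s + D2 s t) \<le> K * (D2 r s + D2 s t)"
      using that aap_dist_nonneg[OF D2] by (intro mult_right_mono) (auto simp: K_def)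
    then show ?thesis using aap_dist_triangle[OF D2 that] by linarith
  qed
  have "almost_periods (\<lambda>t \<tau>. D1 (t + \<tau>) t + D2 (t + \<tau>) t \<le> \<epsilon>)"
    if \<epsilon>: "\<epsilon> > 0" for \<epsilon>
  proof -
    define e where "e = \<epsilon> / (8 * K * K)"
    have e: "e > 0" using K \<epsilon> by (simp add: e_def)
    have eK: "8 * K * K * e = \<epsilon>" using K by (simp add: e_def)
    obtain \<delta> where \<delta>: "\<delta> > 0" "\<And>s t. s \<ge> 0 \<Longrightarrow> t \<ge> 0 \<Longrightarrow> \<bar>s - t\<bar> < \<delta> \<Longrightarrow> D2 s t \<le> e"
      by (rule aap_dist_uniform[OF D2 e]) blast
    obtain l1 m1 where lm1: "l1 > 0" "m1 > 0" "\<And>a. a \<ge> 0 \<Longrightarrow> \<exists>\<tau>\<in>{a..a + l1}. \<forall>t\<ge>m1. D1 (t + \<tau>) t \<le> e"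
      by (rule aap_dist_period[OF D1 e]) blast
    obtain l2 m2 where lm2: "l2 > 0" "m2 > 0" "\<And>a. a \<ge> 0 \<Longrightarrow> \<exists>\<tau>\<in>{a..a + l2}. \<forall>t\<ge>m2. D2 (t + \<tau>) t \<le> e"
      by (rule aap_dist_period[OF D2 e]) blast
    define l where "l = max l1 l2"
    define m where "m = max m1 m2"
    have l: "l > 0" and m: "m > 0" using lm1 lm2 by (auto simp: l_def m_def)
    have "\<exists>\<tau>\<in>{real k * l..real k * l + l}. \<forall>t\<ge>m. D1 (t + \<tau>) t \<le> e" for k
      using lm1(3)[of "real k * l"] l by (force simp: l_def m_def)
    then obtain \<tau> where \<tau>: "\<And>k. \<tau> k \<in> {real k * l..real k * l + l}" "\<And>k t. t \<ge> m \<Longrightarrow> D1 (t + \<tau> k) t \<le> e"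
      by metis
    have "\<exists>\<tau>\<in>{real k * l..real k * l + l}. \<forall>t\<ge>m. D2 (t + \<tau>) t \<le> e" for k
      using lm2(3)[of "real k * l"] l by (force simp: l_def m_def)
    then obtain \<sigma> where \<sigma>: "\<And>k. \<sigma> k \<in> {real k * l..real k * l + l}" "\<And>k t. t \<ge> m \<Longrightarrow> D2 (t + \<sigma> k) t \<le> e"
      by metis
    define j where "j k = \<lfloor>(\<tau> k - \<sigma> k) / \<delta>\<rfloor>" for k
    have "range j \<subseteq> {\<lfloor>- l / \<delta>\<rfloor>..\<lfloor>l / \<delta>\<rfloor>}"
    proof safe
      fix k
      have "- l \<le> \<tau> k - \<sigma> k" "\<tau> k - \<sigma> k \<le> l" using \<tau>(1)[of k] \<sigma>(1)[of k] by auto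
      then have "- l / \<delta> \<le> (\<tau> k - \<sigma> k) / \<delta>" "(\<tau> k - \<sigma> k) / \<delta> \<le> l / \<delta>"
        using \<delta>(1) divide_right_mono[of "- l" "\<tau> k - \<sigma> k" \<delta>]
          divide_right_mono[of "\<tau> k - \<sigma> k" l \<delta>] by auto
      then show "j k \<in> {\<lfloor>- l / \<delta>\<rfloor>..\<lfloor>l / \<delta>\<rfloor>}" by (auto simp: j_def intro: floor_mono)
    qed
    then have "finite (range j)" by (rule finite_subset) simp
    then obtain S where S: "finite S" "range j = j ` S"
      using finite_subset_image[of "range j" j UNIV] by auto
    obtain R where R: "\<And>r. r \<in> S \<Longrightarrow> r \<le> R" using S(1) by (meson finite_nat_set_iff_bounded_le)
    have rep: "\<exists>r\<le>R. \<bar>(\<tau> k - \<sigma> k) - (\<tau> r - \<sigma> r)\<bar> < \<delta>" for k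
    proof -
      obtain r where r: "r \<in> S" "j k = j r" using S(2) by blast
      have "\<bar>(\<tau> k - \<sigma> k) / \<delta> - (\<tau> r - \<sigma> r) / \<delta>\<bar> < 1"
        using r(2) unfolding j_def by linarith
      then have "\<bar>((\<tau> k - \<sigma> k) - (\<tau> r - \<sigma> r)) / \<delta>\<bar> < 1" by (simp add: diff_divide_distrib)
      then have "\<bar>(\<tau> k - \<sigma> k) - (\<tau> r - \<sigma> r)\<bar> < \<delta>" using \<delta>(1) by (simp add: abs_divide)
      then show ?thesis using R[OF r(1)] by blast
    qed
    have "\<exists>\<theta>\<in>{a..a + (real R + 3) * l}. \<forall>t\<ge>m + (real R + 1) * l. D1 (t + \<theta>) t + D2 (t + \<theta>) t \<le> \<epsilon>"
      if a: "a \<ge> 0" for a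
    proof -
      define k where "k = nat \<lceil>a / l\<rceil> + R + 1"
      obtain r where r: "r \<le> R" "\<bar>(\<tau> k - \<sigma> k) - (\<tau> r - \<sigma> r)\<bar> < \<delta>" using rep by blast
      have rR: "real r * l \<le> real R * l" using r l by simp
      have "real k = of_int \<lceil>a / l\<rceil> + real R + 1" using a l by (simp add: k_def)
      then have "a / l + real R + 1 \<le> real k" "real k \<le> a / l + real R + 2" by linarith+
      then have "(a / l + real R + 1) * l \<le> real k * l" "real k * l \<le> (a / l + real R + 2) * l"
        using l by (auto intro: mult_right_mono)
      then have k: "a + real R * l + l \<le> real k * l" "real k * l \<le> a + real R * l + 2 * l"
        using l by (simp_all add: distrib_right)
      define \<theta> where "\<theta> = \<tau> k - \<tau> r"
      have \<tau>kr: "real k * l \<le> \<tau> k" "\<tau> k \<le> real k * l + l" "real r * l \<le> \<tau> r" "\<tau> r \<le> real r * l + l"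
          "0 \<le> real r * l"
        using \<tau>(1)[of k] \<tau>(1)[of r] l by auto
      have "a \<le> \<theta>" using \<tau>kr k rR unfolding \<theta>_def by linarith
      moreover have "\<theta> \<le> a + (real R + 3) * l" using \<tau>kr k rR unfolding \<theta>_def distrib_right by linarith
      ultimately have "\<theta> \<in> {a..a + (real R + 3) * l}" by simp
      moreover have "D1 (t + \<theta>) t + D2 (t + \<theta>) t \<le> \<epsilon>" if t: "t \<ge> m + (real R + 1) * l" for t
      proof -
        have ge: "t - \<tau> r \<ge> m" "t - \<sigma> r \<ge> m"
          using \<tau>(1)[of r] \<sigma>(1)[of r] t rR by (auto simp: algebra_simps)
        have pos: "\<tau> i \<ge> 0" "\<sigma> i \<ge> 0" for i
          using \<tau>(1)[of i] \<sigma>(1)[of i] l order_trans[of 0 "real i * l" "\<tau> i"]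
            order_trans[of 0 "real i * l" "\<sigma> i"] by auto
        have nn: "t \<ge> 0" "\<tau> r \<ge> 0" "\<tau> k \<ge> 0" "\<sigma> r \<ge> 0" "\<sigma> k \<ge> 0" "t + \<theta> \<ge> 0"
          using m ge pos[of r] pos[of k] by (auto simp: \<theta>_def)
        have "D1 (t + \<theta>) t \<le> K * (D1 (t + \<theta>) (t - \<tau> r) + D1 (t - \<tau> r) t)"
          using nn ge m by (intro tri1) auto
        also have "D1 (t - \<tau> r) t = D1 t (t - \<tau> r)"
          using nn ge m by (intro aap_dist_sym[OF D1]) auto
        also have "K * (D1 (t + \<theta>) (t - \<tau> r) + D1 t (t - \<tau> r)) \<le> K * (e + e)"
          using \<tau>(2)[OF ge(1), of k] \<tau>(2)[OF ge(1), of r] K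
          by (intro mult_left_mono) (auto simp: \<theta>_def algebra_simps)
        finally have A: "D1 (t + \<theta>) t \<le> K * (e + e)" .
        define \<eta> where "\<eta> = \<sigma> k - \<sigma> r"
        have "D2 (t + \<eta>) t \<le> K * (D2 (t + \<eta>) (t - \<sigma> r) + D2 (t - \<sigma> r) t)"
          using nn ge m by (intro tri2) (auto simp: \<eta>_def)
        also have "D2 (t - \<sigma> r) t = D2 t (t - \<sigma> r)"
          using nn ge m by (intro aap_dist_sym[OF D2]) auto
        also have "K * (D2 (t + \<eta>) (t - \<sigma> r) + D2 t (t - \<sigma> r)) \<le> K * (e + e)"
          using \<sigma>(2)[OF ge(2), of k] \<sigma>(2)[OF ge(2), of r] K
          by (intro mult_left_mono) (auto simp: \<eta>_def algebra_simps)
        finally have B: "D2 (t + \<eta>) t \<le> K * (e + e)" .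
        have "D2 (t + \<theta>) (t + \<eta>) \<le> e"
          using nn ge m r(2) by (intro \<delta>(2)) (auto simp: \<theta>_def \<eta>_def algebra_simps)
        then have "K * (D2 (t + \<theta>) (t + \<eta>) + D2 (t + \<eta>) t) \<le> K * (e + K * (e + e))"
          using B K by (intro mult_left_mono) auto
        moreover have "D2 (t + \<theta>) t \<le> K * (D2 (t + \<theta>) (t + \<eta>) + D2 (t + \<eta>) t)"
          using nn ge m by (intro tri2) (auto simp: \<eta>_def)
        ultimately have "D1 (t + \<theta>) t + D2 (t + \<theta>) t \<le> K * (e + e) + K * (e + K * (e + e))"
          using A by linarith
        also have "\<dots> = 3 * (K * e) + 2 * (K * K * e)" by (simp add: algebra_simps)
        also have "\<dots> \<le> 5 * (K * K * e)" using K e by (simp add: mult_left_mono[of 1 K "K * e"] mult_ac)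
        also have "\<dots> \<le> \<epsilon>" using eK K e by (simp add: eK[symmetric])
        finally show ?thesis .
      qed
      ultimately show ?thesis by blast
    qed
    moreover have "(real R + 3) * l > 0" "m + (real R + 1) * l > 0" using l m 
      by (auto intro!: mult_pos_pos add_nonneg_pos add_pos_pos[of m])
    ultimately show ?thesis unfolding almost_periods_def by blast
  qed
  moreover have "D1 r t + D2 r t \<le> K * (D1 r s + D2 r s + (D1 s t + D2 s t))"
    if "r \<ge> 0" "s \<ge> 0" "t \<ge> 0" for r s t
    using tri1[OF that] tri2[OF that] by (simp add: algebra_simps)
  moreover have "((\<lambda>s. D1 s t + D2 s t) \<longlongrightarrow> 0) (at t within {0..})" if "t \<ge> 0" for t
    using tendsto_add[OF aap_dist_continuous[OF D1 that] aap_dist_continuous[OF D2 that]] by simp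
  ultimately show ?thesis
    unfolding aap_dist_def K_def[symmetric]
    using K aap_dist_nonneg[OF D1] aap_dist_nonneg[OF D2] aap_dist_sym[OF D1] aap_dist_sym[OF D2]
      aap_dist_self[OF D1] aap_dist_self[OF D2]
    by (simp add: add_nonneg_nonneg)
qed

section \<open>Asymptotically almost periodic functions\<close>

lemma aap_dist_norm:
  assumes u: "continuous_on {0..} u"
    and per: "\<And>\<epsilon>. \<epsilon> > 0 \<Longrightarrow> almost_periods (\<lambda>t \<tau>. norm (u (t + \<tau>) - u t) \<le> \<epsilon>)"
  shows "aap_dist 1 (\<lambda>s t. norm (u s - u t))"
  unfolding aap_dist_def
proof (intro conjI allI impI)
  show "norm (u r - u t) \<le> 1 * (norm (u r - u s) + norm (u s - u t))" for r s t
    using norm_triangle_ineq[of "u r - u s" "u s - u t"] by simp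
  show "((\<lambda>s. norm (u s - u t)) \<longlongrightarrow> 0) (at t within {0..})" if "t \<ge> 0" for t
  proof -
    have "(u \<longlongrightarrow> u t) (at t within {0..})"
      using u that by (simp add: continuous_on)
    then show ?thesis by (intro tendsto_norm_zero LIM_zero)
  qed
  show "norm (u s - u t) = norm (u t - u s)" for s t by (rule norm_minus_commute)
qed (simp_all add: per)

lemma asymptotically_almost_periodic_iff_aap_dist:
  "asymptotically_almost_periodic u \<longleftrightarrow> aap_dist 1 (\<lambda>s t. norm (u s - u t))"
proof
  assume "asymptotically_almost_periodic u"
  then show "aap_dist 1 (\<lambda>s t. norm (u s - u t))"
    unfolding asymptotically_almost_periodic_def almost_periods_def[symmetric] by (intro aap_dist_norm) auto
next
  assume D: "aap_dist 1 (\<lambda>s t. norm (u s - u t))"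
  obtain B where B: "\<And>t. t \<ge> 0 \<Longrightarrow> norm (u t - u 0) \<le> B" using aap_dist_bounded[OF D] by blast
  have "norm (u t) \<le> B + norm (u 0)" if "t \<ge> 0" for t
    using B[OF that] norm_triangle_ineq[of "u t - u 0" "u 0"] by simp
  then have "bounded (u ` {0..})"
    unfolding bounded_iff by (auto intro: exI[of _ "B + norm (u 0)"])
  moreover have "continuous_on {0..} u"
    unfolding continuous_on using aap_dist_continuous[OF D]
    by (auto intro: LIM_zero_cancel tendsto_norm_zero_cancel)
  ultimately show "asymptotically_almost_periodic u"
    using aap_dist_period[OF D] unfolding asymptotically_almost_periodic_def by metis
qed

lemma asymptotically_almost_periodicI:
  assumes "continuous_on {0..} u"
    and "\<And>\<epsilon>. \<epsilon> > 0 \<Longrightarrow> almost_periods (\<lambda>t \<tau>. norm (u (t + \<tau>) - u t) \<le> \<epsilon>)"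
  shows "asymptotically_almost_periodic u"
  unfolding asymptotically_almost_periodic_iff_aap_dist using assms by (rule aap_dist_norm)

context
  fixes u :: "real \<Rightarrow> 'a::real_normed_vector"
  assumes u: "asymptotically_almost_periodic u"
begin

lemma aap_continuous_on: "continuous_on {0..} u"
  using u by (simp add: asymptotically_almost_periodic_def)

lemma aap_norm_bounded:
  obtains B where "B > 0" "\<And>t. t \<ge> 0 \<Longrightarrow> norm (u t) \<le> B"
proof -
  have "bounded (u ` {0..})"
    using u by (simp add: asymptotically_almost_periodic_def)
  then obtain B where "B > 0" "\<forall>x\<in>u ` {0..}. norm x \<le> B"
    unfolding bounded_pos by blast
  then show thesis using that by simp
qed

lemma aap_almost_periods: "\<epsilon> > 0 \<Longrightarrow> almost_periods (\<lambda>t \<tau>. norm (u (t + \<tau>) - u t) \<le> \<epsilon>)"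
  using u unfolding asymptotically_almost_periodic_def almost_periods_def by blast

lemma aap_cong:
  assumes uv: "\<And>t. t \<ge> 0 \<Longrightarrow> u t = v t"
  shows "asymptotically_almost_periodic v"
proof (rule asymptotically_almost_periodicI)
  show "continuous_on {0..} v"
    using aap_continuous_on by (rule continuous_on_eq) (use uv in auto)
  show "almost_periods (\<lambda>t \<tau>. norm (v (t + \<tau>) - v t) \<le> \<epsilon>)" if "\<epsilon> > 0" for \<epsilon>
    by (rule almost_periods_mono[OF aap_almost_periods[OF that] order_refl]) (simp flip: uv)
qed

lemma aap_add:
  assumes v: "asymptotically_almost_periodic v"
  shows "asymptotically_almost_periodic (\<lambda>t. u t + v t)"
proof (rule asymptotically_almost_periodicI)
  show "continuous_on {0..} (\<lambda>t. u t + v t)"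
    using u v by (intro continuous_intros) (auto simp: asymptotically_almost_periodic_def)
  have D: "aap_dist (max 1 1) (\<lambda>s t. norm (u s - u t) + norm (v s - v t))"
    using u v unfolding asymptotically_almost_periodic_iff_aap_dist by (rule aap_dist_add)
  have le: "norm (u s + v s - (u t + v t)) \<le> norm (u s - u t) + norm (v s - v t)" for s t
    using norm_triangle_ineq[of "u s - u t" "v s - v t"] by (simp add: algebra_simps)
  show "almost_periods (\<lambda>t \<tau>. norm (u (t + \<tau>) + v (t + \<tau>) - (u t + v t)) \<le> \<epsilon>)" if "\<epsilon> > 0" for \<epsilon>
    by (rule almost_periods_mono[OF aap_dist_almost_periods[OF D that] order_refl], rule order_trans[OF le]) simp
qed

lemma aap_compose:
  fixes \<phi> :: "'a \<Rightarrow> 'b::real_normed_vector"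
  assumes K: "compact K" "\<And>t. t \<ge> 0 \<Longrightarrow> u t \<in> K" and \<phi>: "continuous_on K \<phi>"
  shows "asymptotically_almost_periodic (\<lambda>t. \<phi> (u t))"
proof (rule asymptotically_almost_periodicI)
  show "continuous_on {0..} (\<lambda>t. \<phi> (u t))"
    by (rule continuous_on_compose2[OF \<phi> aap_continuous_on]) (use K(2) in auto)
  fix \<epsilon> :: real assume "\<epsilon> > 0"
  then obtain d where d: "d > 0" "\<And>x y. x \<in> K \<Longrightarrow> y \<in> K \<Longrightarrow> dist y x < d \<Longrightarrow> dist (\<phi> y) (\<phi> x) < \<epsilon>"
    using compact_uniformly_continuous[OF \<phi> K(1)] unfolding uniformly_continuous_on_def by metis
  then have "d / 2 > 0" by simp
  then show "almost_periods (\<lambda>t \<tau>. norm (\<phi> (u (t + \<tau>)) - \<phi> (u t)) \<le> \<epsilon>)"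
  proof (rule almost_periods_mono[OF aap_almost_periods order_refl])
    fix m \<tau> t :: real
    assume "m > 0" "\<tau> \<ge> 0" "t \<ge> m + 0" "\<And>t. t \<ge> m \<Longrightarrow> norm (u (t + \<tau>) - u t) \<le> d / 2"
    then have "norm (u (t + \<tau>) - u t) \<le> d / 2" "t \<ge> 0" "t + \<tau> \<ge> 0" by auto
    then show "norm (\<phi> (u (t + \<tau>)) - \<phi> (u t)) \<le> \<epsilon>"
      using d(2)[of "u t" "u (t + \<tau>)"] K(2) d(1) by (auto simp: dist_norm)
  qed
qed

end

lemma aap_compact_closure:
  fixes u :: "real \<Rightarrow> 'a::banach"
  assumes u: "asymptotically_almost_periodic u"
  shows "compact (closure (u ` {0..}))"
  unfolding compact_eq_totally_bounded
proof (intro conjI allI impI)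
  show "complete (closure (u ` {0..}))" by (simp add: complete_eq_closed)
  fix e :: real assume e: "e > 0"
  then have "e / 4 > 0" by simp
  then obtain l m where lm: "l > 0" "m > 0"
      "\<And>a. a \<ge> 0 \<Longrightarrow> \<exists>\<tau>\<in>{a..a + l}. \<forall>t\<ge>m. norm (u (t + \<tau>) - u t) \<le> e / 4"
    using aap_almost_periods[OF u] unfolding almost_periods_def by blast
  have "compact (u ` {0..m + l})"
    by (rule compact_continuous_image[OF continuous_on_subset[OF aap_continuous_on[OF u]]]) auto
  then obtain k where k: "finite k" "u ` {0..m + l} \<subseteq> (\<Union>x\<in>k. ball x (e / 4))"
    using \<open>e / 4 > 0\<close> unfolding compact_eq_totally_bounded by blast
  have "u t \<in> (\<Union>x\<in>k. cball x (e / 2))" if t: "t \<ge> 0" for t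
  proof -
    have "\<exists>t'\<in>{0..m + l}. norm (u t - u t') \<le> e / 4"
    proof (cases "t \<le> m + l")
      case True
      then show ?thesis using t e by (intro bexI[of _ t]) auto
    next
      case False
      then obtain \<tau> where \<tau>: "\<tau> \<in> {t - m - l..t - m - l + l}" "\<And>t. t \<ge> m \<Longrightarrow> norm (u (t + \<tau>) - u t) \<le> e / 4"
        using lm(3)[of "t - m - l"] by auto
      show ?thesis
        using \<tau>(1) \<tau>(2)[of "t - \<tau>"] lm by (intro bexI[of _ "t - \<tau>"]) auto
    qed
    then obtain t' where t': "t' \<in> {0..m + l}" "dist (u t) (u t') \<le> e / 4" by (auto simp: dist_norm)
    then obtain x where x: "x \<in> k" "dist x (u t') < e / 4" using k(2) by fastforce
    have "dist x (u t) \<le> e / 2"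
      using dist_triangle[of x "u t" "u t'"] t'(2) x(2) by (simp add: dist_commute)
    then show ?thesis using x(1) by auto
  qed
  then have "u ` {0..} \<subseteq> (\<Union>x\<in>k. cball x (e / 2))" by auto
  then have "closure (u ` {0..}) \<subseteq> (\<Union>x\<in>k. cball x (e / 2))"
    by (rule closure_minimal) (use k(1) in auto)
  also have "\<dots> \<subseteq> (\<Union>x\<in>k. ball x e)" using e by force
  finally show "\<exists>k. finite k \<and> closure (u ` {0..}) \<subseteq> (\<Union>x\<in>k. ball x e)" using k(1) by blast
qed

lemma aap_tendsto_zero:
  fixes u :: "real \<Rightarrow> 'a::real_normed_vector"
  assumes c: "continuous_on {0..} u" and lim: "(u \<longlongrightarrow> 0) at_top"
  shows "asymptotically_almost_periodic u"
proof (rule asymptotically_almost_periodicI[OF c])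
  fix \<epsilon> :: real assume "\<epsilon> > 0"
  then have "\<forall>\<^sub>F t in at_top. norm (u t) < \<epsilon> / 2"
    using tendstoD[OF lim, of "\<epsilon> / 2"] by simp
  then obtain m where m: "\<And>t. t \<ge> m \<Longrightarrow> norm (u t) < \<epsilon> / 2"
    unfolding eventually_at_top_linorder by blast
  have "norm (u (t + a) - u t) \<le> \<epsilon>" if "t \<ge> m" "a \<ge> 0" for a t
    using m[of t] m[of "t + a"] that norm_triangle_ineq4[of "u (t + a)" "u t"] by auto
  then show "almost_periods (\<lambda>t \<tau>. norm (u (t + \<tau>) - u t) \<le> \<epsilon>)"
    by (rule almost_periods_tail)
qed

lemma aap_uniform_limit:
  fixes u :: "real \<Rightarrow> 'a::real_normed_vector"
  assumes lim: "\<And>\<epsilon>. \<epsilon> > 0 \<Longrightarrow> \<exists>v. asymptotically_almost_periodic v \<and> (\<forall>t\<ge>0. norm (u t - v t) \<le> \<epsilon>)"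
  shows "asymptotically_almost_periodic u"
proof (rule asymptotically_almost_periodicI)
  have "\<exists>v. asymptotically_almost_periodic v \<and> (\<forall>t\<ge>0. norm (u t - v t) \<le> 1 / real (Suc n))" for n
    by (rule lim) simp
  then obtain v where v: "\<And>n. asymptotically_almost_periodic (v n)"
      "\<And>n t. t \<ge> 0 \<Longrightarrow> norm (u t - v n t) \<le> 1 / real (Suc n)"
    by metis
  show "continuous_on {0..} u"
  proof (rule uniform_limit_theorem)
    show "uniform_limit {0..} v u sequentially"
    proof (rule uniform_limitI)
      fix e :: real assume "e > 0"
      then have "\<forall>\<^sub>F n in sequentially. 1 / real (Suc n) < e"
        using LIMSEQ_Suc[OF lim_1_over_n] by (intro order_tendstoD) auto
      then show "\<forall>\<^sub>F n in sequentially. \<forall>x\<in>{0..}. dist (v n x) (u x) < e"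
        by eventually_elim (use v(2) in \<open>auto simp: dist_norm norm_minus_commute intro: le_less_trans\<close>)
    qed
  qed (use aap_continuous_on[OF v(1)] in auto)
  fix \<epsilon> :: real assume "\<epsilon> > 0"
  then have "\<epsilon> / 3 > 0" by simp
  then obtain w where w: "asymptotically_almost_periodic w" "\<And>t. t \<ge> 0 \<Longrightarrow> norm (u t - w t) \<le> \<epsilon> / 3"
    using lim by blast
  have "norm (u s - u t) \<le> \<epsilon>" if "norm (w s - w t) \<le> \<epsilon> / 3" "s \<ge> 0" "t \<ge> 0" for s t
  proof -
    have "norm (u s - u t) = norm ((u s - w s) + (w s - w t) - (u t - w t))" by simp
    also have "\<dots> \<le> norm (u s - w s) + norm (w s - w t) + norm (u t - w t)"
      by (intro order_trans[OF norm_triangle_ineq4] add_right_mono norm_triangle_ineq)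
    finally show ?thesis using w(2)[OF that(2)] w(2)[OF that(3)] that(1) by linarith
  qed
  then show "almost_periods (\<lambda>t \<tau>. norm (u (t + \<tau>) - u t) \<le> \<epsilon>)"
    by (intro almost_periods_mono[OF aap_almost_periods[OF w(1) \<open>\<epsilon> / 3 > 0\<close>] order_refl]) auto
qed

section \<open>Weighted integrals\<close>

lemma borel_measurable_lebesgue_ident [measurable]: "(\<lambda>s::real. s) \<in> borel_measurable lebesgue"
  by (simp add: measurable_completion)

lemma nn_integral_Icc_reflect:
  fixes F :: "real \<Rightarrow> ennreal"
  assumes F: "F \<in> borel_measurable lebesgue"
  shows "(\<integral>\<^sup>+s\<in>{0..t}. F (t - s) \<partial>lebesgue) = (\<integral>\<^sup>+s\<in>{0..t}. F s \<partial>lebesgue)"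
proof -
  have "(\<integral>\<^sup>+s\<in>{0..t}. F s \<partial>lebesgue) = ennreal \<bar>-1\<bar> * (\<integral>\<^sup>+s. F (t + (-1) * s) * indicator {0..t} (t + (-1) * s) \<partial>lebesgue)"
    using F by (intro nn_integral_real_affine_lebesgue[where f="\<lambda>s. F s * indicator {0..t} s"]) auto
  also have "\<dots> = (\<integral>\<^sup>+s\<in>{0..t}. F (t - s) \<partial>lebesgue)"
    by (simp, intro nn_integral_cong) (auto simp: indicator_def)
  finally show ?thesis ..
qed

lemma nn_integral_Icc_shift:
  fixes F :: "real \<Rightarrow> ennreal"
  assumes F: "F \<in> borel_measurable lebesgue"
  shows "(\<integral>\<^sup>+r\<in>{a..b}. F (x + r) \<partial>lebesgue) = (\<integral>\<^sup>+s\<in>{x + a..x + b}. F s \<partial>lebesgue)"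
proof -
  have "(\<integral>\<^sup>+s\<in>{x + a..x + b}. F s \<partial>lebesgue) = ennreal \<bar>1\<bar> * (\<integral>\<^sup>+s. F (x + 1 * s) * indicator {x + a..x + b} (x + 1 * s) \<partial>lebesgue)"
    using F by (intro nn_integral_real_affine_lebesgue[where f="\<lambda>s. F s * indicator {x + a..x + b} s"]) auto
  also have "\<dots> = (\<integral>\<^sup>+r\<in>{a..b}. F (x + r) \<partial>lebesgue)"
    by (simp, intro nn_integral_cong) (auto simp: indicator_def)
  finally show ?thesis ..
qed

lemma nn_integral_exp_windows:
  fixes F :: "real \<Rightarrow> ennreal"
  assumes F [measurable]: "F \<in> borel_measurable lebesgue" and c: "c > 0"
    and W: "\<And>x. x \<ge> 0 \<Longrightarrow> (\<integral>\<^sup>+s\<in>{x..x + 1}. F s \<partial>lebesgue) \<le> B" and t: "t \<ge> 0"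
  shows "(\<integral>\<^sup>+s\<in>{0..t}. ennreal (exp (- c * (t - s))) * F s \<partial>lebesgue) \<le> ennreal (1 / (1 - exp (- c))) * B"
proof -
  define S where "S = 1 / (1 - exp (- c))"
  have S: "S \<ge> 1" "exp (- c) * S + 1 = S" using c by (auto simp: S_def field_simps)
  have SB: "B \<le> ennreal S * B" using mult_right_mono[of 1 "ennreal S" B] S(1) by simp
  have "\<forall>t. 0 \<le> t \<and> t \<le> real (Suc n) \<longrightarrow>
      (\<integral>\<^sup>+s\<in>{0..t}. ennreal (exp (- c * (t - s))) * F s \<partial>lebesgue) \<le> ennreal S * B" for n
  proof (induction n)
    case 0
    have "(\<integral>\<^sup>+s\<in>{0..t}. ennreal (exp (- c * (t - s))) * F s \<partial>lebesgue) \<le> (\<integral>\<^sup>+s\<in>{0..0 + 1}. F s \<partial>lebesgue)"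
      if "0 \<le> t" "t \<le> 1" for t
      using c that mult_right_mono[of "ennreal (exp (- c * (t - s)))" 1 "F s" for s]
      by (intro nn_integral_mono) (auto simp: indicator_def)
    from order_trans[OF this order_trans[OF W[of 0] SB]] show ?case by simp
  next
    case (Suc n)
    show ?case
    proof safe
      fix t :: real assume t: "0 \<le> t" "t \<le> real (Suc (Suc n))"
      show "(\<integral>\<^sup>+s\<in>{0..t}. ennreal (exp (- c * (t - s))) * F s \<partial>lebesgue) \<le> ennreal S * B"
      proof (cases "t \<le> real (Suc n)")
        case True
        then show ?thesis using Suc t by simp
      next
        case False
        have pw: "ennreal (exp (- c * (t - s))) * F s * indicator {0..t} s \<le>
            ennreal (exp (- c)) * (ennreal (exp (- c * (t - 1 - s))) * F s * indicator {0..t - 1} s)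
            + F s * indicator {t - 1..t - 1 + 1} s" for s
        proof (cases "s \<in> {0..t - 1}")
          case True
          have "- c * (t - s) = - c + - c * (t - 1 - s)" by (simp add: algebra_simps)
          then have "exp (- c * (t - s)) = exp (- c) * exp (- c * (t - 1 - s))"
            by (simp only: exp_add)
          then show ?thesis using True by (simp add: ennreal_mult mult.assoc)
        next
          case False
          then show ?thesis
            using c mult_right_mono[of "ennreal (exp (- c * (t - s)))" 1 "F s"]
            by (auto simp: indicator_def)
        qed
        have "(\<integral>\<^sup>+s\<in>{0..t}. ennreal (exp (- c * (t - s))) * F s \<partial>lebesgue) \<le>
           (\<integral>\<^sup>+s. (ennreal (exp (- c)) * (ennreal (exp (- c * (t - 1 - s))) * F s * indicator {0..t - 1} s)
            + F s * indicator {t - 1..t - 1 + 1} s) \<partial>lebesgue)"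
          by (intro nn_integral_mono pw)
        also have "\<dots> = ennreal (exp (- c)) * (\<integral>\<^sup>+s\<in>{0..t - 1}. ennreal (exp (- c * (t - 1 - s))) * F s \<partial>lebesgue)
            + (\<integral>\<^sup>+s\<in>{t - 1..t - 1 + 1}. F s \<partial>lebesgue)"
          by (subst nn_integral_add) (auto simp: nn_integral_cmult)
        also have "\<dots> \<le> ennreal (exp (- c)) * (ennreal S * B) + B"
          using Suc t False by (intro add_mono mult_left_mono W) auto
        also have "\<dots> = ennreal (exp (- c) * S + 1) * B"
          using S(1) by (simp add: ennreal_mult ennreal_plus distrib_right mult.assoc)
        finally show ?thesis by (simp only: S(2))
      qed
    qed
  qed
  moreover obtain n where "t \<le> real (Suc n)"
    using real_nat_ceiling_ge[of t] by (metis lessI less_imp_le_nat of_nat_le_iff order_trans)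
  ultimately show ?thesis using t unfolding S_def by blast
qed

lemma nn_integral_exp_windows_eventually:
  fixes F :: "real \<Rightarrow> ennreal"
  assumes F [measurable]: "F \<in> borel_measurable lebesgue" and c: "c > 0"
    and W: "\<And>x. x \<ge> 0 \<Longrightarrow> (\<integral>\<^sup>+s\<in>{x..x + 1}. F s \<partial>lebesgue) \<le> B"
    and W': "\<And>x. x \<ge> m \<Longrightarrow> (\<integral>\<^sup>+s\<in>{x..x + 1}. F s \<partial>lebesgue) \<le> B'" and t: "0 \<le> m" "m \<le> t"
  shows "(\<integral>\<^sup>+s\<in>{0..t}. ennreal (exp (- c * (t - s))) * F s \<partial>lebesgue)
    \<le> ennreal (1 / (1 - exp (- c))) * (ennreal (exp (- c * (t - m))) * B + B')"
proof -
  define S where "S = ennreal (1 / (1 - exp (- c)))"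
  define F' where "F' s = F s * indicator {m..} s" for s
  have [measurable]: "F' \<in> borel_measurable lebesgue" unfolding F'_def by measurable
  have pw: "ennreal (exp (- c * (t - s))) * F s * indicator {0..t} s \<le>
      ennreal (exp (- c * (t - m))) * (ennreal (exp (- c * (m - s))) * F s * indicator {0..m} s)
      + ennreal (exp (- c * (t - s))) * F' s * indicator {0..t} s" for s
  proof (cases "s < m")
    case True
    have "- c * (t - s) = - c * (t - m) + - c * (m - s)" by (simp add: algebra_simps)
    then have "exp (- c * (t - s)) = exp (- c * (t - m)) * exp (- c * (m - s))"
      by (simp only: exp_add)
    then show ?thesis using True by (auto simp: indicator_def ennreal_mult mult.assoc)
  next
    case False
    then show ?thesis by (simp add: F'_def)
  qed
  have win: "(\<integral>\<^sup>+s\<in>{x..x + 1}. F' s \<partial>lebesgue) \<le> B'" if "x \<ge> 0" for x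
  proof -
    have "(\<integral>\<^sup>+s\<in>{x..x + 1}. F' s \<partial>lebesgue) \<le> (\<integral>\<^sup>+s\<in>{max x m..max x m + 1}. F s \<partial>lebesgue)"
      by (intro nn_integral_mono) (auto simp: F'_def indicator_def)
    also have "\<dots> \<le> B'" by (rule W') simp
    finally show ?thesis .
  qed
  have "(\<integral>\<^sup>+s\<in>{0..t}. ennreal (exp (- c * (t - s))) * F s \<partial>lebesgue) \<le>
     (\<integral>\<^sup>+s. (ennreal (exp (- c * (t - m))) * (ennreal (exp (- c * (m - s))) * F s * indicator {0..m} s)
      + ennreal (exp (- c * (t - s))) * F' s * indicator {0..t} s) \<partial>lebesgue)"
    by (intro nn_integral_mono pw)
  also have "\<dots> = ennreal (exp (- c * (t - m))) * (\<integral>\<^sup>+s\<in>{0..m}. ennreal (exp (- c * (m - s))) * F s \<partial>lebesgue)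
      + (\<integral>\<^sup>+s\<in>{0..t}. ennreal (exp (- c * (t - s))) * F' s \<partial>lebesgue)"
    by (subst nn_integral_add) (auto simp: nn_integral_cmult)
  also have "\<dots> \<le> ennreal (exp (- c * (t - m))) * (S * B) + S * B'"
    unfolding S_def using t
    by (intro add_mono mult_left_mono nn_integral_exp_windows win c W) auto
  finally show ?thesis by (simp add: S_def distrib_left mult_ac)
qed

lemma powr_add_le:
  fixes a b p :: real
  assumes "a \<ge> 0" "b \<ge> 0" "p \<ge> 0"
  shows "(a + b) powr p \<le> 2 powr p * (a powr p + b powr p)"
proof -
  have "(a + b) powr p \<le> (2 * max a b) powr p"
    using assms by (intro powr_mono2) auto
  also have "\<dots> = 2 powr p * max a b powr p"
    using assms by (simp add: powr_mult)
  also have "max a b powr p \<le> a powr p + b powr p"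
    by (cases "a \<le> b") (auto simp: max_def)
  finally show ?thesis by simp
qed

section \<open>Singular kernels\<close>

definition singular_kernel :: "real \<Rightarrow> real \<Rightarrow> real \<Rightarrow> real \<Rightarrow> real"
  where "singular_kernel M c \<beta> r = M * exp (- c * r) * r powr (\<beta> - 1)"

lemma singular_kernel_nonneg: "M \<ge> 0 \<Longrightarrow> singular_kernel M c \<beta> r \<ge> 0"
  by (simp add: singular_kernel_def)

lemma singular_kernel_measurable [measurable]: "singular_kernel M c \<beta> \<in> borel_measurable borel"
  unfolding singular_kernel_def[abs_def] by measurable

lemma singular_kernel_antimono:
  assumes "M \<ge> 0" "c \<ge> 0" "\<beta> \<le> 1" "0 < r" "r \<le> s"
  shows "singular_kernel M c \<beta> s \<le> singular_kernel M c \<beta> r"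
  unfolding singular_kernel_def using assms
  by (intro mult_mono powr_mono2') (auto intro: mult_left_mono)

lemma nn_integral_exp_powr_finite:
  fixes c \<gamma> :: real
  assumes c: "c > 0" and \<gamma>: "-1 < \<gamma>" "\<gamma> \<le> 0"
  shows "(\<integral>\<^sup>+r\<in>{0..}. ennreal (exp (- c * r) * r powr \<gamma>) \<partial>lebesgue) < \<infinity>"
proof -
  have "((\<lambda>r. r powr \<gamma>) has_integral (1 powr (\<gamma> + 1) / (\<gamma> + 1))) {0..1}"
    using \<gamma> by (intro has_integral_powr_from_0) auto
  then have 1: "(\<integral>\<^sup>+r. ennreal (indicator {0..1} r * r powr \<gamma>) \<partial>lborel) < \<infinity>"
    by (subst nn_integral_has_integral_lebesgue) auto
  have "((\<lambda>x. exp (- c * x)) has_integral exp (- c * 0) / c) {0..}"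
    using c by (rule has_integral_exp_minus_to_infinity)
  then have 2: "(\<integral>\<^sup>+r. ennreal (indicator {0..} r * exp (- c * r)) \<partial>lborel) < \<infinity>"
    by (subst nn_integral_has_integral_lebesgue) auto
  have "ennreal (exp (- c * r) * r powr \<gamma>) * indicator {0..} r \<le>
      ennreal (indicator {0..1} r * r powr \<gamma>) + ennreal (indicator {0..} r * exp (- c * r))" for r
  proof (cases "r < 0")
    case False
    have "exp (- c * r) * r powr \<gamma> \<le> indicator {0..1} r * r powr \<gamma> + exp (- c * r)"
    proof (cases "r \<le> 1")
      case True
      then have "exp (- c * r) * r powr \<gamma> \<le> 1 * r powr \<gamma>"
        using c False by (intro mult_right_mono) auto
      also have "1 * r powr \<gamma> = indicator {0..1} r * r powr \<gamma>" using True False by simp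
      finally show ?thesis using exp_ge_zero[of "- c * r"] by linarith
    next
      case r: False
      then have "r powr \<gamma> \<le> 1" using \<gamma> powr_mono[of \<gamma> 0 r] by simp
      then show ?thesis using r by (simp add: mult_left_le)
    qed
    then show ?thesis
      using False by (simp add: ennreal_plus[symmetric] del: ennreal_plus)
  qed simp
  then have "(\<integral>\<^sup>+r\<in>{0..}. ennreal (exp (- c * r) * r powr \<gamma>) \<partial>lborel) \<le>
      (\<integral>\<^sup>+r. ennreal (indicator {0..1} r * r powr \<gamma>) + ennreal (indicator {0..} r * exp (- c * r)) \<partial>lborel)"
    by (intro nn_integral_mono)
  also have "\<dots> = (\<integral>\<^sup>+r. ennreal (indicator {0..1} r * r powr \<gamma>) \<partial>lborel)
      + (\<integral>\<^sup>+r. ennreal (indicator {0..} r * exp (- c * r)) \<partial>lborel)"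
    by (intro nn_integral_add) auto
  also have "\<dots> < \<infinity>" using 1 2 by (simp add: less_top)
  finally show ?thesis by (subst nn_integral_completion) auto
qed

text \<open>Young's inequality with the conjugate exponent \<open>q\<close> of \<open>p\<close>; the hypothesis on \<open>p\<close> and \<open>\<beta>\<close>
  says that \<open>r powr ((\<beta> - 1) * q)\<close> is integrable at \<open>0\<close>.\<close>

lemma singular_kernel_young:
  fixes M c \<beta> p :: real
  assumes M: "M > 0" and c: "c > 0" and \<beta>: "\<beta> \<le> 1" and p: "p \<ge> 1" "p = 1 \<Longrightarrow> \<beta> = 1"
    "p > 1 \<Longrightarrow> \<beta> = 1 \<or> p / (p - 1) < 1 / (1 - \<beta>)"
  obtains b where "b \<in> borel_measurable borel" "\<And>r. b r \<ge> 0"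
    "(\<integral>\<^sup>+r\<in>{0..}. ennreal (exp (- c * r) * b r) \<partial>lebesgue) < \<infinity>"
    "\<And>\<eta>. \<eta> > 0 \<Longrightarrow> \<exists>C>0. \<forall>r>0. \<forall>a\<ge>0.
      singular_kernel M c \<beta> r * a \<le> exp (- c * r) * (\<eta> * b r + C * a powr p)"
proof (cases "p = 1")
  case True
  show thesis
  proof (rule that[of "\<lambda>_. 0"])
    show "\<exists>C>0. \<forall>r>0. \<forall>a\<ge>0. singular_kernel M c \<beta> r * a \<le> exp (- c * r) * (\<eta> * 0 + C * a powr p)" for \<eta>
      using True p(2) M by (intro exI[of _ M]) (auto simp: singular_kernel_def)
  qed auto
next
  case False
  then have p1: "p > 1" using p(1) by simp
  define q where "q = p / (p - 1)"
  have q: "q > 1" "1 / p + 1 / q = 1" using p1 by (auto simp: q_def field_simps)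
  define \<gamma> where "\<gamma> = (\<beta> - 1) * q"
  have \<gamma>: "-1 < \<gamma>" "\<gamma> \<le> 0"
  proof -
    show "-1 < \<gamma>"
    proof (cases "\<beta> = 1")
      case False
      then have "q < 1 / (1 - \<beta>)" "1 - \<beta> > 0" using p(3)[OF p1] \<beta> by (auto simp: q_def)
      then have "q * (1 - \<beta>) < 1" by (simp add: field_simps)
      then show ?thesis by (simp add: \<gamma>_def algebra_simps)
    qed (simp add: \<gamma>_def)
    show "\<gamma> \<le> 0" using \<beta> q(1) by (simp add: \<gamma>_def mult_le_0_iff)
  qed
  show thesis
  proof (rule that[of "\<lambda>r. r powr \<gamma>"])
    show "(\<integral>\<^sup>+r\<in>{0..}. ennreal (exp (- c * r) * r powr \<gamma>) \<partial>lebesgue) < \<infinity>"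
      by (rule nn_integral_exp_powr_finite[OF c \<gamma>])
    fix \<eta> :: real assume \<eta>: "\<eta> > 0"
    define d where "d = (\<eta> * q / M) powr (1 / q)"
    have d: "d > 0" using \<eta> q(1) M by (simp add: d_def)
    have dq: "M * (d powr q / q) = \<eta>"
      using \<eta> q(1) M by (simp add: d_def powr_powr)
    define C where "C = M * ((1 / d) powr p / p)"
    have "C > 0" using M d p1 by (simp add: C_def)
    moreover have "singular_kernel M c \<beta> r * a \<le> exp (- c * r) * (\<eta> * r powr \<gamma> + C * a powr p)"
      if "r > 0" "a \<ge> 0" for r a
    proof -
      have "(a / d) * (d * r powr (\<beta> - 1)) \<le> (a / d) powr p / p + (d * r powr (\<beta> - 1)) powr q / q"
        using p1 q that d by (intro Youngs_inequality) auto
      also have "(a / d) powr p = (1 / d) powr p * a powr p"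
        using that d by (simp add: powr_divide)
      also have "(d * r powr (\<beta> - 1)) powr q = d powr q * r powr \<gamma>"
        using d by (simp add: powr_mult powr_powr \<gamma>_def)
      finally have "a * r powr (\<beta> - 1) \<le> (1 / d) powr p * a powr p / p + d powr q * r powr \<gamma> / q"
        using d by simp
      then have "M * (a * r powr (\<beta> - 1)) \<le> M * ((1 / d) powr p * a powr p / p + d powr q * r powr \<gamma> / q)"
        using M by simp
      also have "\<dots> = C * a powr p + (M * (d powr q / q)) * r powr \<gamma>"
        by (simp add: C_def algebra_simps)
      also have "\<dots> = \<eta> * r powr \<gamma> + C * a powr p" by (simp only: dq add.commute)
      finally have "exp (- c * r) * (M * (a * r powr (\<beta> - 1))) \<le> exp (- c * r) * (\<eta> * r powr \<gamma> + C * a powr p)"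
        by (rule mult_left_mono) simp
      then show ?thesis by (simp add: singular_kernel_def mult_ac)
    qed
    ultimately show "\<exists>C>0. \<forall>r>0. \<forall>a\<ge>0.
        singular_kernel M c \<beta> r * a \<le> exp (- c * r) * (\<eta> * r powr \<gamma> + C * a powr p)"
      by blast
  qed auto
qed

section \<open>Stepanov asymptotically almost periodic functions\<close>

abbreviation Lp_mass :: "real \<Rightarrow> real set \<Rightarrow> (real \<Rightarrow> 'a::real_normed_vector) \<Rightarrow> ennreal"
  where "Lp_mass p S h \<equiv> (\<integral>\<^sup>+s\<in>S. ennreal (norm (h s) powr p) \<partial>lebesgue)"

definition stepanov_dist :: "real \<Rightarrow> (real \<Rightarrow> 'a::real_normed_vector) \<Rightarrow> real \<Rightarrow> real \<Rightarrow> ennreal"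
  where "stepanov_dist p h s t = Lp_mass p {0..1} (\<lambda>r. h (s + r) - h (t + r))"

definition stepanov_aap :: "real \<Rightarrow> (real \<Rightarrow> 'a::real_normed_vector) \<Rightarrow> bool"
  where "stepanov_aap p h \<longleftrightarrow> smeas h \<and> (\<forall>s<0. h s = 0) \<and>
    (\<forall>x\<ge>0. Lp_mass p {x..x + 1} h < \<infinity>) \<and>
    aap_dist (2 powr p) (\<lambda>s t. enn2real (stepanov_dist p h s t))"

lemma smeas_norm_powr: "smeas h \<Longrightarrow> (\<lambda>s. ennreal (norm (h s) powr p)) \<in> borel_measurable lebesgue"
  using smeas_norm[of h] by measurable

lemma nn_integral_norm_powr_shift:
  assumes "smeas h"
  shows "Lp_mass p {0..1} (\<lambda>r. h (x + r)) =
    Lp_mass p {x..x + 1} h"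
  using nn_integral_Icc_shift[OF smeas_norm_powr[OF assms, where p=p], where x=x and a=0 and b=1] by simp

lemma nn_integral_norm_add_powr_le:
  fixes h k :: "real \<Rightarrow> 'a::real_normed_vector"
  assumes h: "smeas h" and k: "smeas k" and p: "p \<ge> 0" and S: "S \<in> sets lebesgue"
    and le: "\<And>s. s \<in> S \<Longrightarrow> norm (f s) \<le> norm (h s) + norm (k s)"
  shows "Lp_mass p S f \<le> ennreal (2 powr p) *
    (Lp_mass p S h + Lp_mass p S k)"
proof -
  have [measurable]: "(\<lambda>s. ennreal (norm (h s) powr p)) \<in> borel_measurable lebesgue"
      "(\<lambda>s. ennreal (norm (k s) powr p)) \<in> borel_measurable lebesgue" "S \<in> sets lebesgue"
    by (rule smeas_norm_powr[OF h] smeas_norm_powr[OF k] S)+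
  have "Lp_mass p S f \<le>
      (\<integral>\<^sup>+s. ennreal (2 powr p) * (ennreal (norm (h s) powr p) * indicator S s + ennreal (norm (k s) powr p) * indicator S s) \<partial>lebesgue)"
  proof (intro nn_integral_mono)
    fix s
    have "norm (f s) powr p \<le> 2 powr p * (norm (h s) powr p + norm (k s) powr p)" if "s \<in> S"
    proof -
      have "norm (f s) powr p \<le> (norm (h s) + norm (k s)) powr p"
        using le[OF that] p by (intro powr_mono2) auto
      also have "\<dots> \<le> 2 powr p * (norm (h s) powr p + norm (k s) powr p)"
        using p by (intro powr_add_le) auto
      finally show ?thesis .
    qed
    then show "ennreal (norm (f s) powr p) * indicator S s \<le> ennreal (2 powr p) *
        (ennreal (norm (h s) powr p) * indicator S s + ennreal (norm (k s) powr p) * indicator S s)"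
      by (auto simp: indicator_def ennreal_mult[symmetric] ennreal_plus[symmetric]
          simp del: ennreal_plus intro!: ennreal_leI)
  qed
  also have "\<dots> = ennreal (2 powr p) * (Lp_mass p S h
      + Lp_mass p S k)"
    by (simp add: nn_integral_cmult nn_integral_add)
  finally show ?thesis .
qed

lemma stepanov_dist_shift:
  assumes "smeas h"
  shows "stepanov_dist p h (x + a) x = Lp_mass p {x + a..x + a + 1} (\<lambda>s. h s - h (s - a))"
proof -
  have "smeas (\<lambda>s. h s - h (s - a))"
    using smeas_diff[OF assms smeas_shift[OF assms, of "- a"]] by simp
  from nn_integral_norm_powr_shift[OF this, of "x + a" p] show ?thesis
    by (simp add: stepanov_dist_def algebra_simps)
qed

lemma stepanov_dist_commute: "stepanov_dist p h s t = stepanov_dist p h t s"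
  by (simp add: stepanov_dist_def norm_minus_commute)

lemma stepanov_dist_finite:
  fixes h :: "real \<Rightarrow> 'a::real_normed_vector"
  assumes h: "smeas h" and p: "p \<ge> 0"
    and W: "\<And>x. x \<ge> 0 \<Longrightarrow> Lp_mass p {x..x + 1} h < \<infinity>"
    and st: "s \<ge> 0" "t \<ge> 0"
  shows "stepanov_dist p h s t < \<infinity>"
proof -
  have 1: "Lp_mass p {0..1} (\<lambda>r. h (x + r)) < \<infinity>" if "x \<ge> 0" for x
    using W[OF that] nn_integral_norm_powr_shift[OF h] by metis
  have "stepanov_dist p h s t \<le> ennreal (2 powr p) *
    (Lp_mass p {0..1} (\<lambda>r. h (s + r)) + Lp_mass p {0..1} (\<lambda>r. h (t + r)))"
    unfolding stepanov_dist_def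
    by (intro nn_integral_norm_add_powr_le smeas_shift h p norm_triangle_ineq4) simp
  also have "\<dots> < \<infinity>"
    using 1[OF st(1)] 1[OF st(2)] by (simp add: ennreal_mult_less_top)
  finally show ?thesis .
qed

lemma stepanov_aapI:
  fixes h :: "real \<Rightarrow> 'a::real_normed_vector"
  assumes h: "smeas h" "\<And>s. s < 0 \<Longrightarrow> h s = 0" and p: "p \<ge> 0"
    and W: "\<And>x. x \<ge> 0 \<Longrightarrow> Lp_mass p {x..x + 1} h < \<infinity>"
    and cont: "\<And>t \<epsilon>. t \<ge> 0 \<Longrightarrow> \<epsilon> > 0 \<Longrightarrow> \<forall>\<^sub>F s in at t within {0..}. stepanov_dist p h s t \<le> ennreal \<epsilon>"
    and per: "\<And>\<epsilon>. \<epsilon> > 0 \<Longrightarrow> almost_periods (\<lambda>t \<tau>. stepanov_dist p h (t + \<tau>) t \<le> ennreal \<epsilon>)"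
  shows "stepanov_aap p h"
proof -
  let ?D = "\<lambda>s t. enn2real (stepanov_dist p h s t)"
  have fin: "stepanov_dist p h s t < \<infinity>" if "s \<ge> 0" "t \<ge> 0" for s t
    using stepanov_dist_finite[OF h(1) p W that] .
  have le: "?D s t \<le> \<epsilon>" if "stepanov_dist p h s t \<le> ennreal \<epsilon>" "\<epsilon> > 0" for s t \<epsilon>
    using enn2real_mono[OF that(1)] that(2) by simp
  have tri: "?D r t \<le> 2 powr p * (?D r s + ?D s t)" if "r \<ge> 0" "s \<ge> 0" "t \<ge> 0" for r s t
  proof -
    have "stepanov_dist p h r t \<le> ennreal (2 powr p) * (stepanov_dist p h r s + stepanov_dist p h s t)"
      unfolding stepanov_dist_def
    proof (intro nn_integral_norm_add_powr_le smeas_diff smeas_shift h p)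
      show "norm (h (r + x) - h (t + x)) \<le> norm (h (r + x) - h (s + x)) + norm (h (s + x) - h (t + x))" for x
        using norm_triangle_ineq[of "h (r + x) - h (s + x)" "h (s + x) - h (t + x)"] by simp
    qed simp
    moreover have "ennreal (2 powr p) * (stepanov_dist p h r s + stepanov_dist p h s t) < \<infinity>"
      using fin that by (simp add: ennreal_mult_less_top)
    ultimately have "?D r t \<le> enn2real (ennreal (2 powr p) * (stepanov_dist p h r s + stepanov_dist p h s t))"
      by (intro enn2real_mono) auto
    also have "\<dots> = 2 powr p * (?D r s + ?D s t)"
      using fin that by (simp add: enn2real_mult enn2real_plus)
    finally show ?thesis .
  qed
  have "aap_dist (2 powr p) ?D"
    unfolding aap_dist_def
  proof (intro conjI allI impI)
    show "2 powr p \<ge> 1" using p by (simp add: ge_one_powr_ge_zero)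
    show "?D s t = ?D t s" for s t by (simp add: stepanov_dist_commute)
    show "?D t t = 0" for t
    proof -
      have "stepanov_dist p h t t = 0" by (simp add: stepanov_dist_def)
      then show ?thesis by simp
    qed
    show "((\<lambda>s. ?D s t) \<longlongrightarrow> 0) (at t within {0..})" if "t \<ge> 0" for t
    proof (rule tendstoI)
      fix e :: real assume "e > 0"
      then have "\<forall>\<^sub>F s in at t within {0..}. stepanov_dist p h s t \<le> ennreal (e / 2)"
        using cont[OF that] by simp
      then show "\<forall>\<^sub>F s in at t within {0..}. dist (?D s t) 0 < e"
        by eventually_elim (use le[of _ _ "e / 2"] \<open>e > 0\<close> in fastforce)
    qed
    show "almost_periods (\<lambda>t \<tau>. ?D (t + \<tau>) t \<le> \<epsilon>)" if "\<epsilon> > 0" for \<epsilon>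
      by (rule almost_periods_mono[OF per[OF that] order_refl], rule le[OF _ that]) simp
  qed (simp_all add: tri)
  then show ?thesis
    unfolding stepanov_aap_def using h W by blast
qed

context
  fixes p :: real and h :: "real \<Rightarrow> 'a::real_normed_vector"
  assumes h: "stepanov_aap p h" and p: "p \<ge> 0"
begin

lemma stepanov_aap_smeas: "smeas h"
  and stepanov_aap_negative: "s < 0 \<Longrightarrow> h s = 0"
  and stepanov_aap_window: "x \<ge> 0 \<Longrightarrow> Lp_mass p {x..x + 1} h < \<infinity>"
  and stepanov_aap_dist: "aap_dist (2 powr p) (\<lambda>s t. enn2real (stepanov_dist p h s t))"
  using h by (simp_all add: stepanov_aap_def)

lemma stepanov_aap_dist_finite: "s \<ge> 0 \<Longrightarrow> t \<ge> 0 \<Longrightarrow> stepanov_dist p h s t < \<infinity>"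
  by (rule stepanov_dist_finite[OF stepanov_aap_smeas p stepanov_aap_window])

lemma stepanov_aap_dist_le:
  assumes "s \<ge> 0" "t \<ge> 0" "enn2real (stepanov_dist p h s t) \<le> \<epsilon>"
  shows "stepanov_dist p h s t \<le> ennreal \<epsilon>"
  using stepanov_aap_dist_finite[OF assms(1,2)] assms(3) ennreal_leI[OF assms(3)] by simp

lemma stepanov_aap_bounded:
  obtains B where "B > 0" "\<And>x. x \<ge> 0 \<Longrightarrow> Lp_mass p {x..x + 1} h \<le> ennreal B"
proof -
  obtain B0 where B0: "\<And>t. t \<ge> 0 \<Longrightarrow> enn2real (stepanov_dist p h t 0) \<le> B0"
    using aap_dist_bounded[OF stepanov_aap_dist] by blast
  have B0': "B0 \<ge> 0" using B0[of 0] enn2real_nonneg order_trans by blast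
  obtain B1 where B1: "B1 \<ge> 0" "Lp_mass p {0..0+1} h = ennreal B1"
    using stepanov_aap_window[of 0] by (cases "Lp_mass p {0..0+1} h") auto
  have "Lp_mass p {x..x + 1} h \<le> ennreal (2 powr p * (B0 + B1) + 1)"
    if x: "x \<ge> 0" for x
  proof -
    have "Lp_mass p {x..x + 1} h =
        Lp_mass p {0..1} (\<lambda>r. h (x + r))"
      by (rule nn_integral_norm_powr_shift[OF stepanov_aap_smeas, symmetric])
    also have "\<dots> \<le> ennreal (2 powr p) * (Lp_mass p {0..1} (\<lambda>r. h (x + r) - h (0 + r))
        + Lp_mass p {0..1} (\<lambda>r. h (0 + r)))"
    proof (intro nn_integral_norm_add_powr_le smeas_diff smeas_shift stepanov_aap_smeas p)
      show "norm (h (x + r)) \<le> norm (h (x + r) - h (0 + r)) + norm (h (0 + r))" for r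
        using norm_triangle_ineq[of "h (x + r) - h r" "h r"] by simp
    qed simp
    also have "Lp_mass p {0..1} (\<lambda>r. h (x + r) - h (0 + r)) = stepanov_dist p h x 0"
      by (simp add: stepanov_dist_def)
    also have "Lp_mass p {0..1} (\<lambda>r. h (0 + r)) = ennreal B1"
      using B1(2) by simp
    also have "ennreal (2 powr p) * (stepanov_dist p h x 0 + ennreal B1) \<le> ennreal (2 powr p) * (ennreal B0 + ennreal B1)"
      using x by (intro mult_left_mono add_mono stepanov_aap_dist_le B0) auto
    also have "\<dots> = ennreal (2 powr p * (B0 + B1))"
      using B0' B1(1) by (simp add: ennreal_mult)
    also have "\<dots> \<le> ennreal (2 powr p * (B0 + B1) + 1)" by (intro ennreal_leI) simp
    finally show ?thesis .
  qed
  moreover have "2 powr p * (B0 + B1) + 1 > 0" using B0' B1(1) by (intro add_nonneg_pos mult_nonneg_nonneg) auto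
  ultimately show thesis using that by blast
qed

lemma stepanov_aap_almost_periods:
  "\<epsilon> > 0 \<Longrightarrow> almost_periods (\<lambda>t \<tau>. stepanov_dist p h (t + \<tau>) t \<le> ennreal \<epsilon>)"
  by (rule almost_periods_mono[OF aap_dist_almost_periods[OF stepanov_aap_dist] order_refl])
    (auto intro!: stepanov_aap_dist_le)

lemma stepanov_aap_uniform:
  assumes "\<epsilon> > 0"
  obtains \<delta> where "\<delta> > 0" "\<And>s t. s \<ge> 0 \<Longrightarrow> t \<ge> 0 \<Longrightarrow> \<bar>s - t\<bar> < \<delta> \<Longrightarrow> stepanov_dist p h s t \<le> ennreal \<epsilon>"
proof -
  obtain \<delta> where "\<delta> > 0" "\<And>s t. s \<ge> 0 \<Longrightarrow> t \<ge> 0 \<Longrightarrow> \<bar>s - t\<bar> < \<delta> \<Longrightarrow> enn2real (stepanov_dist p h s t) \<le> \<epsilon>"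
    by (rule aap_dist_uniform[OF stepanov_aap_dist assms]) blast
  then show thesis using that stepanov_aap_dist_le by blast
qed

lemma stepanov_aap_continuous:
  assumes "t \<ge> 0" "\<epsilon> > 0"
  shows "\<forall>\<^sub>F s in at t within {0..}. stepanov_dist p h s t \<le> ennreal \<epsilon>"
proof -
  obtain \<delta> where \<delta>: "\<delta> > 0" "\<And>s t. s \<ge> 0 \<Longrightarrow> t \<ge> 0 \<Longrightarrow> \<bar>s - t\<bar> < \<delta> \<Longrightarrow> stepanov_dist p h s t \<le> ennreal \<epsilon>"
    using stepanov_aap_uniform[OF assms(2)] by blast
  show ?thesis
    unfolding eventually_at using \<delta> assms(1) by (intro exI[of _ \<delta>]) (auto simp: dist_real_def)
qed

end

lemma stepanov_aap_add:
  fixes h k :: "real \<Rightarrow> 'a::real_normed_vector"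
  assumes h: "stepanov_aap p h" and k: "stepanov_aap p k" and p: "p \<ge> 0"
  shows "stepanov_aap p (\<lambda>s. h s + k s)"
proof (rule stepanov_aapI)
  note hs = stepanov_aap_smeas[OF h p] and ks = stepanov_aap_smeas[OF k p]
  show "smeas (\<lambda>s. h s + k s)" by (intro smeas_add hs ks)
  show "h s + k s = 0" if "s < 0" for s
    using stepanov_aap_negative[OF h p that] stepanov_aap_negative[OF k p that] by simp
  have D: "stepanov_dist p (\<lambda>s. h s + k s) s t \<le> ennreal (2 powr p) * (stepanov_dist p h s t + stepanov_dist p k s t)"
    for s t
    unfolding stepanov_dist_def
  proof (intro nn_integral_norm_add_powr_le smeas_diff smeas_shift hs ks p)
    show "norm (h (s + r) + k (s + r) - (h (t + r) + k (t + r))) \<le>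
        norm (h (s + r) - h (t + r)) + norm (k (s + r) - k (t + r))" for r
      using norm_triangle_ineq[of "h (s + r) - h (t + r)" "k (s + r) - k (t + r)"]
      by (simp add: algebra_simps)
  qed simp
  show "Lp_mass p {x..x + 1} (\<lambda>s. h s + k s) < \<infinity>" if x: "x \<ge> 0" for x
  proof -
    have "Lp_mass p {x..x + 1} (\<lambda>s. h s + k s) \<le> ennreal (2 powr p) *
      (Lp_mass p {x..x + 1} h + Lp_mass p {x..x + 1} k)"
      by (intro nn_integral_norm_add_powr_le hs ks p norm_triangle_ineq) simp
    also have "\<dots> < \<infinity>"
      using stepanov_aap_window[OF h p x] stepanov_aap_window[OF k p x] by (simp add: ennreal_mult_less_top)
    finally show ?thesis .
  qed
  have small: "stepanov_dist p (\<lambda>s. h s + k s) s t \<le> ennreal \<epsilon>"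
    if "\<epsilon> > 0" "stepanov_dist p h s t \<le> ennreal (\<epsilon> / (2 * 2 powr p))"
      "stepanov_dist p k s t \<le> ennreal (\<epsilon> / (2 * 2 powr p))" for s t \<epsilon>
  proof -
    have "stepanov_dist p (\<lambda>s. h s + k s) s t \<le>
        ennreal (2 powr p) * (ennreal (\<epsilon> / (2 * 2 powr p)) + ennreal (\<epsilon> / (2 * 2 powr p)))"
      using that by (intro order_trans[OF D] mult_left_mono add_mono) auto
    also have "\<dots> = ennreal \<epsilon>"
      using that(1) by (simp add: ennreal_plus[symmetric] ennreal_mult[symmetric] del: ennreal_plus)
    finally show ?thesis .
  qed
  have pos: "\<epsilon> / (2 * 2 powr p) > 0" if "\<epsilon> > 0" for \<epsilon> using that by simp
  show "\<forall>\<^sub>F s in at t within {0..}. stepanov_dist p (\<lambda>s. h s + k s) s t \<le> ennreal \<epsilon>"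
    if "t \<ge> 0" "\<epsilon> > 0" for t \<epsilon>
    using stepanov_aap_continuous[OF h p that(1) pos[OF that(2)]]
      stepanov_aap_continuous[OF k p that(1) pos[OF that(2)]]
    by eventually_elim (rule small[OF that(2)])
  show "almost_periods (\<lambda>t \<tau>. stepanov_dist p (\<lambda>s. h s + k s) (t + \<tau>) t \<le> ennreal \<epsilon>)"
    if \<epsilon>: "\<epsilon> > 0" for \<epsilon>
  proof -
    let ?D = "\<lambda>s t. enn2real (stepanov_dist p h s t) + enn2real (stepanov_dist p k s t)"
    have "almost_periods (\<lambda>t \<tau>. ?D (t + \<tau>) t \<le> \<epsilon> / (2 * 2 powr p))"
      by (rule aap_dist_almost_periods[OF aap_dist_add[OF stepanov_aap_dist[OF h p] stepanov_aap_dist[OF k p]] pos[OF \<epsilon>]])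
    then show ?thesis
    proof (rule almost_periods_mono[OF _ order_refl], intro small[OF \<epsilon>])
      fix m \<tau> t :: real
      assume *: "m > 0" "\<tau> \<ge> 0" "t \<ge> m + 0" "\<And>t. t \<ge> m \<Longrightarrow> ?D (t + \<tau>) t \<le> \<epsilon> / (2 * 2 powr p)"
      then have "t \<ge> 0" "t + \<tau> \<ge> 0" "?D (t + \<tau>) t \<le> \<epsilon> / (2 * 2 powr p)" by auto
      then show "stepanov_dist p h (t + \<tau>) t \<le> ennreal (\<epsilon> / (2 * 2 powr p))"
          "stepanov_dist p k (t + \<tau>) t \<le> ennreal (\<epsilon> / (2 * 2 powr p))"
        using enn2real_nonneg[of "stepanov_dist p h (t + \<tau>) t"] enn2real_nonneg[of "stepanov_dist p k (t + \<tau>) t"]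
        by (intro stepanov_aap_dist_le[OF h p] stepanov_aap_dist_le[OF k p]; linarith)+
    qed
  qed
qed (rule p)

lemma stepanov_aap_zero: "p \<ge> 0 \<Longrightarrow> stepanov_aap p (\<lambda>_. 0 :: 'a::real_normed_vector)"
  by (rule stepanov_aapI) (auto simp: stepanov_dist_def intro: almost_periods_tail)

lemma stepanov_aap_sum:
  fixes h :: "'i \<Rightarrow> real \<Rightarrow> 'a::real_normed_vector"
  assumes "finite I" "\<And>i. i \<in> I \<Longrightarrow> stepanov_aap p (h i)" and p: "p \<ge> 0"
  shows "stepanov_aap p (\<lambda>s. \<Sum>i\<in>I. h i s)"
  using assms(1,2)
  by (induction I rule: finite_induct) (auto intro: stepanov_aap_add stepanov_aap_zero p)

lemma stepanov_aap_scaleR: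
  fixes h :: "real \<Rightarrow> 'a::real_normed_vector"
  assumes h: "stepanov_aap p h" and \<alpha>: "asymptotically_almost_periodic \<alpha>" and p: "p \<ge> 1"
  shows "stepanov_aap p (\<lambda>s. \<alpha> s *\<^sub>R h s)"
proof (rule stepanov_aapI)
  have p0: "p \<ge> 0" using p by simp
  note hs = stepanov_aap_smeas[OF h p0]
  obtain A where A: "A > 0" "\<And>t. t \<ge> 0 \<Longrightarrow> norm (\<alpha> t) \<le> A" using aap_norm_bounded[OF \<alpha>] by blast
  obtain B where B: "B > 0"
      "\<And>x. x \<ge> 0 \<Longrightarrow> Lp_mass p {x..x + 1} h \<le> ennreal B"
    using stepanov_aap_bounded[OF h p0] by blast
  define K where "K = A + 1"
  have K: "K \<ge> 1" using A(1) by (simp add: K_def)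
  have cut: "smeas (\<lambda>s. if s \<in> {0..} then \<alpha> s else 0)"
    by (rule smeas_continuous_on[OF aap_continuous_on[OF \<alpha>]]) simp
  have "smeas (\<lambda>s. (if s \<in> {0..} then \<alpha> s else 0) *\<^sub>R h s)"
    by (rule smeas_compose[where G="\<lambda>y s. (if s \<in> {0..} then \<alpha> s else 0) *\<^sub>R y", OF _ _ hs])
      (auto intro!: smeas_continuous_compose[OF _ cut, of "\<lambda>r. r *\<^sub>R y" for y, simplified]
        always_eventually continuous_intros)
  moreover have "(\<lambda>s. (if s \<in> {0..} then \<alpha> s else 0) *\<^sub>R h s) = (\<lambda>s. \<alpha> s *\<^sub>R h s)"
    using stepanov_aap_negative[OF h p0] by (force simp: fun_eq_iff)
  ultimately show "smeas (\<lambda>s. \<alpha> s *\<^sub>R h s)" by simp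
  show "\<alpha> s *\<^sub>R h s = 0" if "s < 0" for s using stepanov_aap_negative[OF h p0 that] by simp
  have scale: "Lp_mass p S f \<le>
      ennreal (a powr p) * Lp_mass p S k"
    if k: "smeas k" and S: "S \<in> sets lebesgue" and a: "a \<ge> 0" and le: "\<And>s. s \<in> S \<Longrightarrow> norm (f s) \<le> a * norm (k s)"
    for a S and f k :: "real \<Rightarrow> 'a"
  proof -
    have "Lp_mass p S f \<le>
        (\<integral>\<^sup>+s. ennreal (a powr p) * (ennreal (norm (k s) powr p) * indicator S s) \<partial>lebesgue)"
    proof (intro nn_integral_mono)
      fix s
      have "norm (f s) powr p \<le> a powr p * norm (k s) powr p" if "s \<in> S"
        using le[OF that] p0 a by (simp add: powr_mult[symmetric] powr_mono2)
      then show "ennreal (norm (f s) powr p) * indicator S s \<le> ennreal (a powr p) * (ennreal (norm (k s) powr p) * indicator S s)"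
        by (auto simp: indicator_def ennreal_mult[symmetric] intro!: ennreal_leI)
    qed
    also have "\<dots> = ennreal (a powr p) * Lp_mass p S k"
      using smeas_norm_powr[OF k, of p] S by (intro nn_integral_cmult) auto
    finally show ?thesis .
  qed
  show "Lp_mass p {x..x + 1} (\<lambda>s. \<alpha> s *\<^sub>R h s) < \<infinity>" if x: "x \<ge> 0" for x
  proof -
    have "Lp_mass p {x..x + 1} (\<lambda>s. \<alpha> s *\<^sub>R h s) \<le>
        ennreal (A powr p) * Lp_mass p {x..x + 1} h"
      using x A by (intro scale hs) (auto intro!: mult_right_mono)
    also have "\<dots> < \<infinity>"
      using stepanov_aap_window[OF h p0 x] by (simp add: ennreal_mult_less_top)
    finally show ?thesis .
  qed
  have D: "stepanov_dist p (\<lambda>s. \<alpha> s *\<^sub>R h s) s t \<le> ennreal (2 powr p) * (ennreal (K powr p) * stepanov_dist p h s t + ennreal (\<omega> powr p * B))"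
    if st: "s \<ge> 0" "t \<ge> 0" and \<omega>: "\<And>r. r \<in> {0..1} \<Longrightarrow> \<bar>\<alpha> (s + r) - \<alpha> (t + r)\<bar> \<le> \<omega>" for s t \<omega>
  proof -
    have \<omega>0: "\<omega> \<ge> 0" using \<omega>[of 0] by simp
    have 1: "smeas (\<lambda>r. K *\<^sub>R (h (s + r) - h (t + r)))"
      by (intro smeas_continuous_compose[where G="\<lambda>y. K *\<^sub>R y"] smeas_diff smeas_shift hs continuous_intros)
    have 2: "smeas (\<lambda>r. \<omega> *\<^sub>R h (t + r))"
      by (intro smeas_continuous_compose[where G="\<lambda>y. \<omega> *\<^sub>R y"] smeas_shift hs continuous_intros)
    have "stepanov_dist p (\<lambda>s. \<alpha> s *\<^sub>R h s) s t \<le> ennreal (2 powr p) *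
        (Lp_mass p {0..1} (\<lambda>r. K *\<^sub>R (h (s + r) - h (t + r))) +
         Lp_mass p {0..1} (\<lambda>r. \<omega> *\<^sub>R h (t + r)))"
      unfolding stepanov_dist_def
    proof (rule nn_integral_norm_add_powr_le[OF 1 2 p0])
      fix r :: real assume r: "r \<in> {0..1}"
      have "norm (\<alpha> (s + r) *\<^sub>R h (s + r) - \<alpha> (t + r) *\<^sub>R h (t + r)) =
          norm (\<alpha> (s + r) *\<^sub>R (h (s + r) - h (t + r)) + (\<alpha> (s + r) - \<alpha> (t + r)) *\<^sub>R h (t + r))"
        by (simp add: algebra_simps)
      also have "\<dots> \<le> \<bar>\<alpha> (s + r)\<bar> * norm (h (s + r) - h (t + r)) + \<bar>\<alpha> (s + r) - \<alpha> (t + r)\<bar> * norm (h (t + r))"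
        by (intro order_trans[OF norm_triangle_ineq]) simp
      also have "\<dots> \<le> K * norm (h (s + r) - h (t + r)) + \<omega> * norm (h (t + r))"
        using A(2)[of "s + r"] st r \<omega>[OF r] by (intro add_mono mult_right_mono) (auto simp: K_def)
      finally show "norm (\<alpha> (s + r) *\<^sub>R h (s + r) - \<alpha> (t + r) *\<^sub>R h (t + r)) \<le>
          norm (K *\<^sub>R (h (s + r) - h (t + r))) + norm (\<omega> *\<^sub>R h (t + r))"
        using K \<omega>0 by simp
    qed simp
    also have "Lp_mass p {0..1} (\<lambda>r. K *\<^sub>R (h (s + r) - h (t + r))) \<le>
        ennreal (K powr p) * stepanov_dist p h s t"
      unfolding stepanov_dist_def using K
      by (intro scale smeas_diff smeas_shift hs) auto
    also have "Lp_mass p {0..1} (\<lambda>r. \<omega> *\<^sub>R h (t + r)) \<le>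
        ennreal (\<omega> powr p) * Lp_mass p {0..1} (\<lambda>r. h (t + r))"
      using \<omega>0 by (intro scale smeas_shift hs) auto
    also have "Lp_mass p {0..1} (\<lambda>r. h (t + r)) \<le> ennreal B"
      using B(2)[OF st(2)] by (simp only: nn_integral_norm_powr_shift[OF hs])
    finally show ?thesis
      using B(1) by (simp add: ennreal_mult mult_left_mono add_mono)
  qed
  have small: "\<exists>\<delta>>0. \<forall>s\<ge>0. \<forall>t\<ge>0. stepanov_dist p h s t \<le> ennreal \<delta> \<and> (\<forall>r\<in>{0..1}. \<bar>\<alpha> (s + r) - \<alpha> (t + r)\<bar> \<le> \<delta>) \<longrightarrow>
      stepanov_dist p (\<lambda>s. \<alpha> s *\<^sub>R h s) s t \<le> ennreal \<epsilon>" if \<epsilon>: "\<epsilon> > 0" for \<epsilon>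
  proof -
    define N where "N = 2 powr p * (K powr p + B)"
    have N: "N > 0" using B(1) K by (simp add: N_def add_nonneg_pos)
    define \<delta> where "\<delta> = min 1 (\<epsilon> / N)"
    have \<delta>: "\<delta> > 0" "\<delta> \<le> 1" "N * \<delta> \<le> \<epsilon>"
      using \<epsilon> N by (auto simp: \<delta>_def min_def field_simps)
    have "stepanov_dist p (\<lambda>s. \<alpha> s *\<^sub>R h s) s t \<le> ennreal \<epsilon>"
      if st: "s \<ge> 0" "t \<ge> 0" "stepanov_dist p h s t \<le> ennreal \<delta>" "\<And>r. r \<in> {0..1} \<Longrightarrow> \<bar>\<alpha> (s + r) - \<alpha> (t + r)\<bar> \<le> \<delta>" for s t
    proof -
      have "\<delta> powr p \<le> \<delta>" using powr_mono'[of 1 p \<delta>] p \<delta> by simp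
      have "stepanov_dist p (\<lambda>s. \<alpha> s *\<^sub>R h s) s t \<le> ennreal (2 powr p) * (ennreal (K powr p) * ennreal \<delta> + ennreal (\<delta> powr p * B))"
        using st by (intro order_trans[OF D] mult_left_mono add_mono) auto
      also have "\<dots> = ennreal (2 powr p * (K powr p * \<delta> + \<delta> powr p * B))"
        using \<delta> B(1) by (simp add: ennreal_mult ennreal_plus)
      also have "\<dots> \<le> ennreal (2 powr p * (K powr p * \<delta> + \<delta> * B))"
        using \<open>\<delta> powr p \<le> \<delta>\<close> B(1) by (intro ennreal_leI mult_left_mono add_left_mono mult_right_mono) auto
      also have "\<dots> = ennreal (N * \<delta>)" by (simp add: N_def algebra_simps)
      also have "\<dots> \<le> ennreal \<epsilon>" by (intro ennreal_leI \<delta>)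
      finally show ?thesis .
    qed
    then show ?thesis using \<delta>(1) by blast
  qed
  have \<alpha>D: "aap_dist 1 (\<lambda>s t. norm (\<alpha> s - \<alpha> t))"
    using \<alpha> by (simp add: asymptotically_almost_periodic_iff_aap_dist)
  show "\<forall>\<^sub>F s in at t within {0..}. stepanov_dist p (\<lambda>s. \<alpha> s *\<^sub>R h s) s t \<le> ennreal \<epsilon>"
    if t: "t \<ge> 0" and \<epsilon>: "\<epsilon> > 0" for t \<epsilon>
  proof -
    obtain \<delta> where \<delta>: "\<delta> > 0" "\<And>s t. s \<ge> 0 \<Longrightarrow> t \<ge> 0 \<Longrightarrow> stepanov_dist p h s t \<le> ennreal \<delta> \<Longrightarrow>
        (\<And>r. r \<in> {0..1} \<Longrightarrow> \<bar>\<alpha> (s + r) - \<alpha> (t + r)\<bar> \<le> \<delta>) \<Longrightarrow>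
        stepanov_dist p (\<lambda>s. \<alpha> s *\<^sub>R h s) s t \<le> ennreal \<epsilon>"
      using small[OF \<epsilon>] by metis
    obtain d1 where d1: "d1 > 0" "\<And>s t. s \<ge> 0 \<Longrightarrow> t \<ge> 0 \<Longrightarrow> \<bar>s - t\<bar> < d1 \<Longrightarrow> stepanov_dist p h s t \<le> ennreal \<delta>"
      using stepanov_aap_uniform[OF h p0 \<delta>(1)] by blast
    obtain d2 where d2: "d2 > 0" "\<And>s t. s \<ge> 0 \<Longrightarrow> t \<ge> 0 \<Longrightarrow> \<bar>s - t\<bar> < d2 \<Longrightarrow> norm (\<alpha> s - \<alpha> t) \<le> \<delta>"
      by (rule aap_dist_uniform[OF \<alpha>D \<delta>(1)]) blast
    have "stepanov_dist p (\<lambda>s. \<alpha> s *\<^sub>R h s) s t \<le> ennreal \<epsilon>" if s: "s \<ge> 0" "dist s t < min d1 d2" for s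
    proof (rule \<delta>(2)[OF s(1) t])
      show "stepanov_dist p h s t \<le> ennreal \<delta>" using s t by (intro d1) (auto simp: dist_real_def)
      show "\<bar>\<alpha> (s + r) - \<alpha> (t + r)\<bar> \<le> \<delta>" if "r \<in> {0..1}" for r
        using d2(2)[of "s + r" "t + r"] s t that by (auto simp: dist_real_def)
    qed
    then show ?thesis
      unfolding eventually_at using d1(1) d2(1) by (auto intro!: exI[of _ "min d1 d2"])
  qed
  show "almost_periods (\<lambda>t \<tau>. stepanov_dist p (\<lambda>s. \<alpha> s *\<^sub>R h s) (t + \<tau>) t \<le> ennreal \<epsilon>)"
    if \<epsilon>: "\<epsilon> > 0" for \<epsilon>
  proof -
    obtain \<delta> where \<delta>: "\<delta> > 0" "\<And>s t. s \<ge> 0 \<Longrightarrow> t \<ge> 0 \<Longrightarrow> stepanov_dist p h s t \<le> ennreal \<delta> \<Longrightarrow>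
        (\<And>r. r \<in> {0..1} \<Longrightarrow> \<bar>\<alpha> (s + r) - \<alpha> (t + r)\<bar> \<le> \<delta>) \<Longrightarrow>
        stepanov_dist p (\<lambda>s. \<alpha> s *\<^sub>R h s) s t \<le> ennreal \<epsilon>"
      using small[OF \<epsilon>] by metis
    let ?D = "\<lambda>s t. enn2real (stepanov_dist p h s t) + norm (\<alpha> s - \<alpha> t)"
    have "almost_periods (\<lambda>t \<tau>. ?D (t + \<tau>) t \<le> \<delta>)"
      by (rule aap_dist_almost_periods[OF aap_dist_add[OF stepanov_aap_dist[OF h p0] \<alpha>D] \<delta>(1)])
    then show ?thesis
    proof (rule almost_periods_mono[OF _ order_refl], intro \<delta>(2))
      fix m \<tau> t :: real
      assume *: "m > 0" "\<tau> \<ge> 0" "t \<ge> m + 0" "\<And>t. t \<ge> m \<Longrightarrow> ?D (t + \<tau>) t \<le> \<delta>"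
      then show nn: "t + \<tau> \<ge> 0" "t \<ge> 0" by auto
      show "stepanov_dist p h (t + \<tau>) t \<le> ennreal \<delta>"
        using nn *(3) *(4)[of t] norm_ge_zero[of "\<alpha> (t + \<tau>) - \<alpha> t"]
        by (intro stepanov_aap_dist_le[OF h p0]; linarith)
      show "\<bar>\<alpha> (t + \<tau> + r) - \<alpha> (t + r)\<bar> \<le> \<delta>" if "r \<in> {0..1}" for r
      proof -
        have "?D (t + r + \<tau>) (t + r) \<le> \<delta>" using that *(3) by (intro *(4)) auto
        moreover have "t + \<tau> + r = t + r + \<tau>" by simp
        ultimately show ?thesis
          using enn2real_nonneg[of "stepanov_dist p h (t + r + \<tau>) (t + r)"]
          by (simp only: real_norm_def)
      qed
    qed
  qed
qed (use p in simp)

section \<open>Convolution with a singular operator family\<close>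

lemma AE_lebesgue_neq: "AE s in lebesgue. s \<noteq> (t::real)"
  by (rule AE_completion[OF AE_lborel_singleton])

locale singular_family =
  fixes T :: "real \<Rightarrow> 'a::banach \<Rightarrow>\<^sub>L 'a" and M c \<beta> p :: real
  assumes T_cont: "continuous_on {0<..} T"
    and T_bound: "\<And>t. t > 0 \<Longrightarrow> norm (T t) \<le> M * exp (- c * t) * t powr (\<beta> - 1)"
    and M: "M > 0" and c: "c > 0" and \<beta>: "0 < \<beta>" "\<beta> \<le> 1" and p: "p \<ge> 1" and p1: "p = 1 \<Longrightarrow> \<beta> = 1"
    and pgt1: "p > 1 \<Longrightarrow> \<beta> = 1 \<or> p / (p - 1) < 1 / (1 - \<beta>)"
begin

abbreviation kern :: "real \<Rightarrow> real"
  where "kern \<equiv> singular_kernel M c \<beta>"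

definition conv :: "(real \<Rightarrow> 'a) \<Rightarrow> real \<Rightarrow> 'a"
  where "conv h t = integral {0..t} (\<lambda>s. T (t - s) (h s))"

definition kern_int :: "(real \<Rightarrow> 'a) \<Rightarrow> real \<Rightarrow> ennreal"
  where "kern_int h t = (\<integral>\<^sup>+s\<in>{0..t}. ennreal (kern (t - s) * norm (h s)) \<partial>lebesgue)"

lemma kern_nonneg: "kern r \<ge> 0"
  using M by (simp add: singular_kernel_nonneg)

lemma smeas_conv_integrand:
  assumes h: "smeas h"
  shows "smeas (\<lambda>s. if s \<in> {0..t} then T (t - s) (h s) else 0)"
proof (rule smeas_cong_AE)
  have 1: "smeas (\<lambda>s. if s \<in> {0..<t} then T (t - s) x else 0)" for x
  proof (rule smeas_continuous_on)
    have "continuous_on {0..<t} (\<lambda>s. T (t - s))"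
      by (rule continuous_on_compose2[OF T_cont]) (auto intro: continuous_intros)
    then show "continuous_on {0..<t} (\<lambda>s. T (t - s) x)"
      by (intro continuous_intros)
  qed simp
  have "isCont (\<lambda>x. if s \<in> {0..<t} then T (t - s) x else 0) x" for s x
    by (cases "s \<in> {0..<t}") (auto intro!: continuous_intros)
  then show "smeas (\<lambda>s. if s \<in> {0..<t} then T (t - s) (h s) else 0)"
    by (intro smeas_compose[where G="\<lambda>x s. if s \<in> {0..<t} then T (t - s) x else 0", OF 1 _ h]
        always_eventually allI)
  show "AE s in lebesgue. (if s \<in> {0..<t} then T (t - s) (h s) else 0) = (if s \<in> {0..t} then T (t - s) (h s) else 0)"
    using AE_lebesgue_neq[of t] by eventually_elim auto
qed

lemma nn_integral_conv_integrand_le: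
  "(\<integral>\<^sup>+s\<in>{0..t}. ennreal (norm (T (t - s) (h s))) \<partial>lebesgue) \<le> kern_int h t"
  unfolding kern_int_def
proof (rule nn_integral_mono_AE)
  show "AE s in lebesgue. ennreal (norm (T (t - s) (h s))) * indicator {0..t} s \<le>
      ennreal (kern (t - s) * norm (h s)) * indicator {0..t} s"
    using AE_lebesgue_neq[of t]
  proof eventually_elim
    case (elim s)
    have "norm (T (t - s) (h s)) \<le> kern (t - s) * norm (h s)" if "s < t"
    proof -
      have "norm (T (t - s) (h s)) \<le> norm (T (t - s)) * norm (h s)" by (rule norm_blinfun)
      also have "\<dots> \<le> kern (t - s) * norm (h s)"
        using T_bound[of "t - s"] that by (intro mult_right_mono) (auto simp: singular_kernel_def)
      finally show ?thesis .
    qed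
    then show ?case using elim by (auto simp: indicator_def intro: ennreal_leI)
  qed
qed

lemma conv_bochner_integrable:
  assumes h: "smeas h" and fin: "kern_int h t < \<infinity>"
  shows "bochner_integrable_on (\<lambda>s. T (t - s) (h s)) {0..t}"
  using smeas_conv_integrand[OF h] le_less_trans[OF nn_integral_conv_integrand_le fin]
  by (simp add: bochner_integrable_on_iff)

lemma conv_integrable:
  assumes "smeas h" "kern_int h t < \<infinity>"
  shows "(\<lambda>s. T (t - s) (h s)) integrable_on {0..t}"
  by (rule bochner_integrable_on_imp(1)[OF conv_bochner_integrable[OF assms]])

lemma norm_conv_le:
  assumes "smeas h" "kern_int h t < \<infinity>"
  shows "ennreal (norm (conv h t)) \<le> kern_int h t"
  unfolding conv_def
  by (rule order_trans[OF bochner_integrable_on_imp(2)[OF conv_bochner_integrable[OF assms]]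
        nn_integral_conv_integrand_le])

lemma conv_diff:
  assumes "smeas h" "kern_int h t < \<infinity>" "smeas k" "kern_int k t < \<infinity>"
  shows "conv (\<lambda>s. h s - k s) t = conv h t - conv k t"
  unfolding conv_def
  using integral_diff[OF conv_integrable[OF assms(1,2)] conv_integrable[OF assms(3,4)]]
  by (simp add: blinfun.diff_right)

lemma conv_shift:
  assumes neg: "\<And>s. s < 0 \<Longrightarrow> h s = 0" and t: "t \<ge> 0" "\<tau> \<ge> 0"
    and h: "smeas h" and fin: "kern_int h t < \<infinity>" "kern_int h (t + \<tau>) < \<infinity>"
  shows "conv h (t + \<tau>) - conv h t = conv (\<lambda>s. h s - h (s - \<tau>)) (t + \<tau>)"
proof -
  have "((\<lambda>s. T (t - s) (h s)) has_integral conv h t) {0..t}"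
    using conv_integrable[OF h fin(1)] by (simp add: conv_def has_integral_integral)
  from has_integral_shift_real_ivl[OF this, of "- \<tau>"]
  have "((\<lambda>s. T (t + \<tau> - s) (h (s - \<tau>))) has_integral conv h t) {\<tau>..t + \<tau>}"
    by (simp add: algebra_simps)
  then have "((\<lambda>s. if s \<in> {\<tau>..t + \<tau>} then T (t + \<tau> - s) (h (s - \<tau>)) else 0) has_integral conv h t) {0..t + \<tau>}"
    using t by (subst has_integral_restrict) auto
  then have 1: "((\<lambda>s. T (t + \<tau> - s) (h (s - \<tau>))) has_integral conv h t) {0..t + \<tau>}"
    by (rule has_integral_eq[rotated]) (auto simp: neg)
  have 2: "((\<lambda>s. T (t + \<tau> - s) (h s)) has_integral conv h (t + \<tau>)) {0..t + \<tau>}"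
    using conv_integrable[OF h fin(2)] by (simp add: conv_def has_integral_integral)
  have "((\<lambda>s. T (t + \<tau> - s) (h s - h (s - \<tau>))) has_integral conv h (t + \<tau>) - conv h t) {0..t + \<tau>}"
    using has_integral_diff[OF 2 1] by (simp add: blinfun.diff_right)
  then show ?thesis by (simp add: conv_def integral_unique)
qed

lemma kern_int_le:
  assumes "\<eta> > 0"
  obtains C where "C > 0" "\<And>t h. t \<ge> 0 \<Longrightarrow> smeas h \<Longrightarrow> kern_int h t \<le> ennreal \<eta> +
    ennreal C * (\<integral>\<^sup>+s\<in>{0..t}. ennreal (exp (- c * (t - s))) * ennreal (norm (h s) powr p) \<partial>lebesgue)"
proof -
  obtain b where b: "b \<in> borel_measurable borel" "\<And>r. b r \<ge> 0"
    "(\<integral>\<^sup>+r\<in>{0..}. ennreal (exp (- c * r) * b r) \<partial>lebesgue) < \<infinity>"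
    "\<And>\<eta>. \<eta> > 0 \<Longrightarrow> \<exists>C>0. \<forall>r>0. \<forall>a\<ge>0. kern r * a \<le> exp (- c * r) * (\<eta> * b r + C * a powr p)"
    by (rule singular_kernel_young[OF M c \<beta>(2) p p1 pgt1]) (assumption | blast)+
  have [measurable]: "b \<in> borel_measurable lebesgue" using b(1) by (simp add: measurable_completion)
  have [measurable]: "(\<lambda>s. b (t - s)) \<in> borel_measurable lebesgue" for t
    by (rule measurable_compose[OF _ b(1)]) measurable
  obtain K where K: "K \<ge> 0" "(\<integral>\<^sup>+r\<in>{0..}. ennreal (exp (- c * r) * b r) \<partial>lebesgue) = ennreal K"
    using b(3) by (cases "(\<integral>\<^sup>+r\<in>{0..}. ennreal (exp (- c * r) * b r) \<partial>lebesgue)") auto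
  define \<eta>' where "\<eta>' = \<eta> / (K + 1)"
  have \<eta>': "\<eta>' > 0" "\<eta>' * K \<le> \<eta>" using assms K(1) by (auto simp: \<eta>'_def field_simps)
  obtain C where C: "C > 0" "\<And>r a. r > 0 \<Longrightarrow> a \<ge> 0 \<Longrightarrow> kern r * a \<le> exp (- c * r) * (\<eta>' * b r + C * a powr p)"
    using b(4)[OF \<eta>'(1)] by blast
  have "kern_int h t \<le> ennreal \<eta> +
      ennreal C * (\<integral>\<^sup>+s\<in>{0..t}. ennreal (exp (- c * (t - s))) * ennreal (norm (h s) powr p) \<partial>lebesgue)"
    if t: "t \<ge> 0" and h: "smeas h" for t h
  proof -
    note [measurable] = smeas_norm_powr[OF h, of p]
    have "kern_int h t \<le> (\<integral>\<^sup>+s. (ennreal \<eta>' * (ennreal (exp (- c * (t - s)) * b (t - s)) * indicator {0..t} s) +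
        ennreal C * (ennreal (exp (- c * (t - s))) * ennreal (norm (h s) powr p) * indicator {0..t} s)) \<partial>lebesgue)"
      unfolding kern_int_def
    proof (rule nn_integral_mono_AE)
      show "AE s in lebesgue. ennreal (kern (t - s) * norm (h s)) * indicator {0..t} s \<le>
          ennreal \<eta>' * (ennreal (exp (- c * (t - s)) * b (t - s)) * indicator {0..t} s) +
          ennreal C * (ennreal (exp (- c * (t - s))) * ennreal (norm (h s) powr p) * indicator {0..t} s)"
        using AE_lebesgue_neq[of t]
      proof eventually_elim
        case (elim s)
        show ?case
        proof (cases "s \<in> {0..t}")
          case True
          have "ennreal (kern (t - s) * norm (h s)) \<le>
              ennreal (exp (- c * (t - s)) * (\<eta>' * b (t - s) + C * norm (h s) powr p))"
            using True elim by (intro ennreal_leI C) auto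
          also have "\<dots> = ennreal (\<eta>' * (exp (- c * (t - s)) * b (t - s)) + C * (exp (- c * (t - s)) * norm (h s) powr p))"
            by (simp add: algebra_simps)
          also have "\<dots> = ennreal \<eta>' * ennreal (exp (- c * (t - s)) * b (t - s)) +
              ennreal C * (ennreal (exp (- c * (t - s))) * ennreal (norm (h s) powr p))"
            using \<eta>'(1) C(1) b(2) by (simp add: ennreal_plus ennreal_mult)
          finally show ?thesis using True by simp
        qed simp
      qed
    qed
    also have "\<dots> = ennreal \<eta>' * (\<integral>\<^sup>+s\<in>{0..t}. ennreal (exp (- c * (t - s)) * b (t - s)) \<partial>lebesgue) +
        ennreal C * (\<integral>\<^sup>+s\<in>{0..t}. ennreal (exp (- c * (t - s))) * ennreal (norm (h s) powr p) \<partial>lebesgue)"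
      by (subst nn_integral_add) (auto simp: nn_integral_cmult)
    also have "(\<integral>\<^sup>+s\<in>{0..t}. ennreal (exp (- c * (t - s)) * b (t - s)) \<partial>lebesgue) =
        (\<integral>\<^sup>+r\<in>{0..t}. ennreal (exp (- c * r) * b r) \<partial>lebesgue)"
      by (rule nn_integral_Icc_reflect[where F="\<lambda>r. ennreal (exp (- c * r) * b r)"]) measurable
    also have "\<dots> \<le> (\<integral>\<^sup>+r\<in>{0..}. ennreal (exp (- c * r) * b r) \<partial>lebesgue)"
      by (intro nn_integral_mono) (auto simp: indicator_def)
    also have "ennreal \<eta>' * (\<integral>\<^sup>+r\<in>{0..}. ennreal (exp (- c * r) * b r) \<partial>lebesgue) = ennreal (\<eta>' * K)"
      using \<eta>'(1) K by (simp add: ennreal_mult)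
    also have "\<dots> \<le> ennreal \<eta>" by (rule ennreal_leI[OF \<eta>'(2)])
    finally show ?thesis by (simp add: add_mono mult_left_mono)
  qed
  then show thesis using that C(1) by blast
qed

lemma stepanov_kern_int_bounded:
  assumes h: "stepanov_aap p h"
  obtains B where "B > 0" "\<And>t. t \<ge> 0 \<Longrightarrow> kern_int h t \<le> ennreal B"
proof -
  have p0: "p \<ge> 0" using p by simp
  note hs = stepanov_aap_smeas[OF h p0]
  obtain C where C: "C > 0" "\<And>t h. t \<ge> 0 \<Longrightarrow> smeas h \<Longrightarrow> kern_int h t \<le> ennreal 1 +
      ennreal C * (\<integral>\<^sup>+s\<in>{0..t}. ennreal (exp (- c * (t - s))) * ennreal (norm (h s) powr p) \<partial>lebesgue)"
    using kern_int_le[of 1] by auto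
  obtain B where B: "B > 0"
      "\<And>x. x \<ge> 0 \<Longrightarrow> Lp_mass p {x..x + 1} h \<le> ennreal B"
    using stepanov_aap_bounded[OF h p0] by blast
  define S where "S = 1 / (1 - exp (- c))"
  have S: "S > 0" using c by (simp add: S_def)
  have "kern_int h t \<le> ennreal (1 + C * (S * B))" if t: "t \<ge> 0" for t
  proof -
    have "kern_int h t \<le> ennreal 1 + ennreal C * (ennreal S * ennreal B)"
      unfolding S_def using smeas_norm_powr[OF hs] t c
      by (intro order_trans[OF C(2)[OF t hs]] add_left_mono mult_left_mono nn_integral_exp_windows B) auto
    also have "\<dots> = ennreal (1 + C * (S * B))"
      using S B(1) C(1) by (simp add: ennreal_mult ennreal_plus)
    finally show ?thesis .
  qed
  moreover have "1 + C * (S * B) > 0" using S B(1) C(1) by (simp add: add_pos_pos)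
  ultimately show thesis using that by blast
qed

lemma conv_stepanov_aap:
  assumes h: "stepanov_aap p h"
  shows "asymptotically_almost_periodic (conv h)"
proof -
  have p0: "p \<ge> 0" using p by simp
  note hs = stepanov_aap_smeas[OF h p0] and neg = stepanov_aap_negative[OF h p0]
  obtain B where B: "B > 0"
      "\<And>x. x \<ge> 0 \<Longrightarrow> Lp_mass p {x..x + 1} h \<le> ennreal B"
    using stepanov_aap_bounded[OF h p0] by blast
  obtain B1 where B1: "\<And>t. t \<ge> 0 \<Longrightarrow> kern_int h t \<le> ennreal B1"
    using stepanov_kern_int_bounded[OF h] by metis
  have fin: "kern_int h t < \<infinity>" if "t \<ge> 0" for t
    using le_less_trans[OF B1[OF that]] by simp
  define S where "S = 1 / (1 - exp (- c))"
  have S: "S > 0" using c by (simp add: S_def)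
  define \<Delta> where "\<Delta> \<tau> s = h s - h (s - \<tau>)" for \<tau> s
  have \<Delta>s: "smeas (\<Delta> \<tau>)" for \<tau>
    unfolding \<Delta>_def using smeas_diff[OF hs smeas_shift[OF hs, of "- \<tau>"]] by simp
  have \<Delta>m: "(\<lambda>s. ennreal (norm (\<Delta> \<tau> s) powr p)) \<in> borel_measurable lebesgue" for \<tau>
    by (rule smeas_norm_powr[OF \<Delta>s])
  have negwin: "Lp_mass p {x..x + 1} h \<le> ennreal B" for x
  proof -
    have "Lp_mass p {x..x + 1} h \<le>
        Lp_mass p {max 0 x..max 0 x + 1} h"
      by (intro nn_integral_mono) (auto simp: indicator_def neg)
    then show ?thesis using B(2)[of "max 0 x"] by simp
  qed
  define B' where "B' = 2 powr p * (B + B)"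
  have B': "B' > 0" using B(1) by (simp add: B'_def)
  have \<Delta>B: "Lp_mass p {x..x + 1} (\<Delta> \<tau>) \<le> ennreal B'" for x \<tau>
  proof -
    have "Lp_mass p {x..x + 1} (\<Delta> \<tau>) \<le> ennreal (2 powr p) *
      (Lp_mass p {x..x + 1} h +
       Lp_mass p {x..x + 1} (\<lambda>s. h (- \<tau> + s)))"
      by (intro nn_integral_norm_add_powr_le hs smeas_shift p0)
        (simp_all add: \<Delta>_def norm_triangle_ineq4)
    also have "Lp_mass p {x..x + 1} (\<lambda>s. h (- \<tau> + s)) =
        Lp_mass p {- \<tau> + x..- \<tau> + x + 1} h"
      using nn_integral_Icc_shift[OF smeas_norm_powr[OF hs, of p], where x="- \<tau>" and a=x and b="x + 1"]
      by (simp only: add.assoc)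
    also have "ennreal (2 powr p) * (Lp_mass p {x..x + 1} h +
        Lp_mass p {- \<tau> + x..- \<tau> + x + 1} h) \<le> ennreal (2 powr p) * (ennreal B + ennreal B)"
      by (intro mult_left_mono add_mono negwin) simp
    also have "\<dots> = ennreal B'" using B(1) by (simp add: B'_def ennreal_mult[symmetric] ennreal_plus[symmetric] del: ennreal_plus)
    finally show ?thesis .
  qed
  have \<Delta>D: "Lp_mass p {x..x + 1} (\<Delta> \<tau>) = stepanov_dist p h x (x - \<tau>)" for x \<tau>
    using stepanov_dist_shift[OF hs, of p "x - \<tau>" \<tau>] by (simp add: \<Delta>_def)
  have \<Delta>fin: "kern_int (\<Delta> \<tau>) t < \<infinity>" if t: "t \<ge> 0" for \<tau> t
  proof -
    obtain C where C: "C > 0" "\<And>t h. t \<ge> 0 \<Longrightarrow> smeas h \<Longrightarrow> kern_int h t \<le> ennreal 1 +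
        ennreal C * (\<integral>\<^sup>+s\<in>{0..t}. ennreal (exp (- c * (t - s))) * ennreal (norm (h s) powr p) \<partial>lebesgue)"
      using kern_int_le[of 1] by auto
    have "kern_int (\<Delta> \<tau>) t \<le> ennreal 1 + ennreal C * (ennreal S * ennreal B')"
      unfolding S_def
      by (intro order_trans[OF C(2)[OF t \<Delta>s]] add_left_mono mult_left_mono nn_integral_exp_windows \<Delta>m \<Delta>B c t) simp
    also have "\<dots> < \<infinity>" by (simp add: ennreal_mult_less_top)
    finally show ?thesis .
  qed
  have diff: "ennreal (norm (conv h (t + \<tau>) - conv h t)) \<le> kern_int (\<Delta> \<tau>) (t + \<tau>)" if "t \<ge> 0" "\<tau> \<ge> 0" for t \<tau>
    using conv_shift[OF neg that hs fin fin] norm_conv_le[OF \<Delta>s \<Delta>fin, of "t + \<tau>" \<tau>] that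
    by (simp add: \<Delta>_def[abs_def])
  show ?thesis
  proof (rule asymptotically_almost_periodicI)
    have right: "\<exists>\<delta>>0. \<forall>t\<ge>0. \<forall>\<tau>\<ge>0. \<tau> < \<delta> \<longrightarrow> norm (conv h (t + \<tau>) - conv h t) \<le> \<epsilon>" if \<epsilon>: "\<epsilon> > 0" for \<epsilon>
    proof -
      obtain C where C: "C > 0" "\<And>t h. t \<ge> 0 \<Longrightarrow> smeas h \<Longrightarrow> kern_int h t \<le> ennreal (\<epsilon> / 2) +
          ennreal C * (\<integral>\<^sup>+s\<in>{0..t}. ennreal (exp (- c * (t - s))) * ennreal (norm (h s) powr p) \<partial>lebesgue)"
        using kern_int_le[of "\<epsilon> / 2"] \<epsilon> by auto
      define e where "e = \<epsilon> / (4 * C * S)"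
      have e: "e > 0" "C * (S * (e + e)) = \<epsilon> / 2" using \<epsilon> C(1) S by (simp_all add: e_def)
      obtain d1 where d1: "d1 > 0" "\<And>s t. s \<ge> 0 \<Longrightarrow> t \<ge> 0 \<Longrightarrow> \<bar>s - t\<bar> < d1 \<Longrightarrow> stepanov_dist p h s t \<le> ennreal e"
        using stepanov_aap_uniform[OF h p0 e(1)] by blast
      have "\<exists>d>0. \<forall>\<tau>\<in>{0..<d}. Lp_mass p {0..\<tau>} h \<le> ennreal e"
      proof -
        define w where "w s = (if s \<in> {0..1} then norm (h s) powr p else 0)" for s :: real
        have wm: "w \<in> borel_measurable lebesgue"
          unfolding w_def using smeas_norm[OF hs] by measurable
        have "(\<integral>\<^sup>+s. ennreal (norm (w s)) \<partial>lebesgue) = Lp_mass p {0..0+1} h"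
          by (intro nn_integral_cong) (auto simp: w_def)
        also have "\<dots> < \<infinity>" using stepanov_aap_window[OF h p0, of 0] by simp
        finally have iw: "integrable lebesgue w" using wm by (intro integrableI_bounded) auto
        have wi: "w integrable_on {a..b}" for a b
          by (rule integrable_on_subinterval[OF integrable_on_lebesgue[OF iw]]) simp
        have "continuous_on {0..1} (\<lambda>\<tau>. integral {0..\<tau>} w)"
          by (rule indefinite_integral_continuous_1[OF wi])
        then have "((\<lambda>\<tau>. integral {0..\<tau>} w) \<longlongrightarrow> integral {0..0} w) (at 0 within {0..1})"
          unfolding continuous_on by (rule bspec) simp
        then have "\<forall>\<^sub>F \<tau> in at 0 within {0..1}. dist (integral {0..\<tau>} w) 0 < e"
          using e(1) by (intro tendstoD) auto
        then obtain d where d: "d > 0" "\<And>\<tau>. \<tau> \<in> {0..1} \<Longrightarrow> \<tau> \<noteq> 0 \<Longrightarrow> \<bar>\<tau>\<bar> < d \<Longrightarrow> \<bar>integral {0..\<tau>} w\<bar> < e"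
          unfolding eventually_at by (auto simp: dist_real_def)
        have "Lp_mass p {0..\<tau>} h \<le> ennreal e" if \<tau>: "\<tau> \<in> {0..<min d 1}" for \<tau>
        proof -
          have "integral {0..\<tau>} w \<le> e" using d(2)[of \<tau>] \<tau> e(1) by (cases "\<tau> = 0") auto
          have "((\<lambda>s. if s \<in> {0..\<tau>} then w s else 0) has_integral integral {0..\<tau>} w) UNIV"
            using integrable_integral[OF wi] by (simp only: has_integral_restrict_UNIV)
          then have "(\<integral>\<^sup>+s. ennreal (if s \<in> {0..\<tau>} then w s else 0) \<partial>lebesgue) = ennreal (integral {0..\<tau>} w)"
            by (subst (asm) has_integral_iff_nn_integral_lebesgue) (auto simp: w_def)
          moreover have "Lp_mass p {0..\<tau>} h = (\<integral>\<^sup>+s. ennreal (if s \<in> {0..\<tau>} then w s else 0) \<partial>lebesgue)"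
            using \<tau> by (intro nn_integral_cong) (auto simp: w_def)
          ultimately show ?thesis using \<open>integral {0..\<tau>} w \<le> e\<close> by (simp add: ennreal_leI)
        qed
        then show ?thesis using d(1) by (intro exI[of _ "min d 1"]) auto
      qed
      then obtain d2 where d2: "d2 > 0" "\<And>\<tau>. \<tau> \<in> {0..<d2} \<Longrightarrow> Lp_mass p {0..\<tau>} h \<le> ennreal e"
        by blast
      define \<delta> where "\<delta> = min d1 d2"
      have "norm (conv h (t + \<tau>) - conv h t) \<le> \<epsilon>" if t: "t \<ge> 0" and \<tau>: "0 \<le> \<tau>" "\<tau> < \<delta>" for t \<tau>
      proof -
        have win: "Lp_mass p {x..x + 1} (\<Delta> \<tau>) \<le> ennreal (e + e)" if x: "x \<ge> 0" for x
        proof -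
          define y where "y = max x \<tau>"
          note [measurable] = \<Delta>m[of \<tau>] smeas_norm_powr[OF hs, of p]
          have "Lp_mass p {x..x + 1} (\<Delta> \<tau>) \<le>
              (\<integral>\<^sup>+s. ennreal (norm (h s) powr p) * indicator {0..\<tau>} s + ennreal (norm (\<Delta> \<tau> s) powr p) * indicator {y..y + 1} s \<partial>lebesgue)"
            using x \<tau>(1) by (intro nn_integral_mono) (auto simp: indicator_def y_def \<Delta>_def neg)
          also have "\<dots> = Lp_mass p {0..\<tau>} h +
              Lp_mass p {y..y + 1} (\<Delta> \<tau>)"
            by (rule nn_integral_add) measurable
          also have "\<dots> \<le> ennreal e + ennreal e"
            unfolding \<Delta>D using \<tau> x by (intro add_mono d1 d2) (auto simp: \<delta>_def y_def)
          finally show ?thesis using e(1) by (simp only: ennreal_plus less_imp_le)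
        qed
        have "ennreal (norm (conv h (t + \<tau>) - conv h t)) \<le> ennreal (\<epsilon> / 2) + ennreal C * (ennreal S * ennreal (e + e))"
          unfolding S_def using t \<tau>(1) c
          by (intro order_trans[OF diff] order_trans[OF C(2)] add_left_mono mult_left_mono nn_integral_exp_windows \<Delta>m \<Delta>s win) auto
        also have "\<dots> = ennreal (\<epsilon> / 2 + C * (S * (e + e)))"
          using S C(1) e(1) \<epsilon> by (simp only: ennreal_mult[symmetric] ennreal_plus[symmetric] less_imp_le zero_le_mult_iff add_nonneg_nonneg divide_nonneg_nonneg zero_le_numeral simp_thms)
        finally show ?thesis unfolding e(2) using \<epsilon> by simp
      qed
      then show ?thesis using d1(1) d2(1) by (auto simp: \<delta>_def intro!: exI[of _ "min d1 d2"])
    qed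
    show "continuous_on {0..} (conv h)"
      unfolding continuous_on_iff
    proof (intro ballI allI impI)
      fix t e :: real assume t: "t \<in> {0..}" and e: "e > 0"
      obtain \<delta> where \<delta>: "\<delta> > 0" "\<And>t \<tau>. t \<ge> 0 \<Longrightarrow> \<tau> \<ge> 0 \<Longrightarrow> \<tau> < \<delta> \<Longrightarrow> norm (conv h (t + \<tau>) - conv h t) \<le> e / 2"
        using right[of "e / 2"] e by auto
      have "dist (conv h s) (conv h t) < e" if s: "s \<in> {0..}" "dist s t < \<delta>" for s
      proof (cases "s \<le> t")
        case True
        then have "norm (conv h (s + (t - s)) - conv h s) \<le> e / 2" using s by (intro \<delta>) (auto simp: dist_real_def)
        then show ?thesis using e by (simp add: dist_norm norm_minus_commute)
      next
        case False
        then have "norm (conv h (t + (s - t)) - conv h t) \<le> e / 2" using s t by (intro \<delta>) (auto simp: dist_real_def)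
        then show ?thesis using e by (simp add: dist_norm)
      qed
      then show "\<exists>d>0. \<forall>x'\<in>{0..}. dist x' t < d \<longrightarrow> dist (conv h x') (conv h t) < e"
        using \<delta>(1) by blast
    qed
    fix \<epsilon> :: real assume \<epsilon>: "\<epsilon> > 0"
    obtain C where C: "C > 0" "\<And>t h. t \<ge> 0 \<Longrightarrow> smeas h \<Longrightarrow> kern_int h t \<le> ennreal (\<epsilon> / 2) +
        ennreal C * (\<integral>\<^sup>+s\<in>{0..t}. ennreal (exp (- c * (t - s))) * ennreal (norm (h s) powr p) \<partial>lebesgue)"
      using kern_int_le[of "\<epsilon> / 2"] \<epsilon> by auto
    define e where "e = \<epsilon> / (4 * C * S)"
    have e: "e > 0" "C * (S * (e + e)) = \<epsilon> / 2" using \<epsilon> C(1) S by (simp_all add: e_def)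
    obtain d where d: "d > 0" "exp (- c * d) * B' \<le> e"
    proof
      define d where "d = max 1 (ln (B' / e) / c)"
      show "d > 0" by (simp add: d_def)
      have "ln (B' / e) \<le> c * d" using c by (simp add: d_def field_simps max_def)
      then have "B' / e \<le> exp (c * d)" using B' e(1) exp_le_cancel_iff[of "ln (B' / e)" "c * d"] by simp
      then show "exp (- c * d) * B' \<le> e" using e(1) by (simp add: exp_minus field_simps)
    qed
    show "almost_periods (\<lambda>t \<tau>. norm (conv h (t + \<tau>) - conv h t) \<le> \<epsilon>)"
    proof (rule almost_periods_mono[OF stepanov_aap_almost_periods[OF h p0 e(1)] less_imp_le[OF d(1)]])
      fix m \<tau> t :: real
      assume m: "m > 0" and \<tau>0: "\<tau> \<ge> 0" and t: "t \<ge> m + d"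
        and \<tau>: "\<And>t. t \<ge> m \<Longrightarrow> stepanov_dist p h (t + \<tau>) t \<le> ennreal e"
      have t0: "t \<ge> 0" using t m d(1) by simp
      have win: "Lp_mass p {x..x + 1} (\<Delta> \<tau>) \<le> ennreal e" if x: "x \<ge> m + \<tau>" for x
        unfolding \<Delta>D using \<tau>[of "x - \<tau>"] x by simp
      have "ennreal (norm (conv h (t + \<tau>) - conv h t)) \<le> ennreal (\<epsilon> / 2) +
          ennreal C * (ennreal S * (ennreal (exp (- c * (t + \<tau> - (m + \<tau>)))) * ennreal B' + ennreal e))"
        unfolding S_def using t0 \<tau>0 c m t d(1)
        by (intro order_trans[OF diff] order_trans[OF C(2)] add_left_mono mult_left_mono
            nn_integral_exp_windows_eventually \<Delta>m \<Delta>s win \<Delta>B) auto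
      also have "\<dots> = ennreal (\<epsilon> / 2 + C * (S * (exp (- c * (t + \<tau> - (m + \<tau>))) * B' + e)))"
        using S C(1) e(1) \<epsilon> B' by (simp add: ennreal_mult ennreal_plus)
      also have "\<dots> \<le> ennreal (\<epsilon> / 2 + C * (S * (e + e)))"
      proof -
        have "exp (- c * (t + \<tau> - (m + \<tau>))) * B' \<le> exp (- c * d) * B'"
          using t c B' by (intro mult_right_mono) auto
        then show ?thesis using d(2) C(1) S by (intro ennreal_leI add_left_mono mult_left_mono) auto
      qed
      finally show "norm (conv h (t + \<tau>) - conv h t) \<le> \<epsilon>" unfolding e(2) using \<epsilon> by simp
    qed
  qed
qed

end

section \<open>Parametrised Stepanov almost periodic functions\<close>

lemma in_Lp_iff:
  fixes \<phi> :: "real \<Rightarrow> 'a::real_normed_vector"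
  shows "in_Lp p \<phi> \<longleftrightarrow> smeas (\<lambda>s. if s \<in> {0..1} then \<phi> s else 0) \<and>
    Lp_mass p {0..1} \<phi> < \<infinity>"
proof -
  have "integrable (lebesgue_on {0..1}) (\<lambda>s. norm (\<phi> s) powr p) \<longleftrightarrow>
      Lp_mass p {0..1} \<phi> < \<infinity>"
    if sm: "smeas (\<lambda>s. if s \<in> {0..1} then \<phi> s else 0)"
  proof -
    have "(\<lambda>s. norm (if s \<in> {0..1} then \<phi> s else 0)) \<in> borel_measurable lebesgue"
      by (rule smeas_norm[OF sm])
    also have "(\<lambda>s. norm (if s \<in> {0..1} then \<phi> s else 0)) = (\<lambda>s. if s \<in> {0..1} then norm (\<phi> s) else 0)"
      by auto
    finally have "(\<lambda>s. norm (\<phi> s)) \<in> borel_measurable (lebesgue_on {0..1})"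
      by (rule borel_measurable_if_D)
    then have "(\<lambda>s. norm (\<phi> s) powr p) \<in> borel_measurable (lebesgue_on {0..1})"
      by measurable
    moreover have "(\<integral>\<^sup>+s. ennreal (norm (norm (\<phi> s) powr p)) \<partial>lebesgue_on {0..1}) =
        Lp_mass p {0..1} \<phi>"
      by (subst nn_integral_restrict_space) auto
    ultimately show ?thesis by (simp add: integrable_iff_bounded)
  qed
  then show ?thesis
    unfolding in_Lp_def by (subst strongly_measurable_on_iff_smeas) auto
qed

lemma nn_integral_le_Lp_norm:
  fixes \<phi> :: "real \<Rightarrow> 'a::real_normed_vector"
  assumes \<phi>: "in_Lp p \<phi>" and p: "p \<ge> 1" and le: "Lp_norm p \<phi> \<le> \<epsilon>"
  shows "Lp_mass p {0..1} \<phi> \<le> ennreal (\<epsilon> powr p)"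
proof -
  define J where "J = (LINT s|lebesgue_on {0..1}. norm (\<phi> s) powr p)"
  have int: "integrable (lebesgue_on {0..1}) (\<lambda>s. norm (\<phi> s) powr p)"
    using \<phi> by (simp add: in_Lp_def)
  have J: "J \<ge> 0" unfolding J_def by (intro Bochner_Integration.integral_nonneg) auto
  have "Lp_mass p {0..1} \<phi> = (\<integral>\<^sup>+s. ennreal (norm (\<phi> s) powr p) \<partial>lebesgue_on {0..1})"
    by (subst nn_integral_restrict_space) auto
  also have "\<dots> = ennreal J"
    unfolding J_def by (rule nn_integral_eq_integral[OF int]) auto
  also have "J = (J powr (1 / p)) powr p"
    using J p by (simp add: powr_powr)
  also have "\<dots> \<le> \<epsilon> powr p"
    using le p unfolding Lp_norm_def J_def[symmetric] by (intro powr_mono2) auto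
  finally show ?thesis by (simp add: ennreal_leI)
qed

lemma in_Lp_diff:
  fixes \<phi> \<psi> :: "real \<Rightarrow> 'a::real_normed_vector"
  assumes \<phi>: "in_Lp p \<phi>" and \<psi>: "in_Lp p \<psi>" and p: "p \<ge> 0"
  shows "in_Lp p (\<lambda>s. \<phi> s - \<psi> s)"
proof -
  let ?cut = "\<lambda>\<phi> s. if s \<in> {0..1::real} then \<phi> s else 0"
  have sm: "smeas (?cut \<phi>)" "smeas (?cut \<psi>)" using \<phi> \<psi> by (simp_all add: in_Lp_iff)
  have eq: "Lp_mass p {0..1} (?cut \<phi>) = Lp_mass p {0..1} \<phi>"
    for \<phi> :: "real \<Rightarrow> 'a"
    by (intro nn_integral_cong) (auto simp: indicator_def)
  have "Lp_mass p {0..1} (\<lambda>s. \<phi> s - \<psi> s) \<le> ennreal (2 powr p) *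
    (Lp_mass p {0..1} (?cut \<phi>) + Lp_mass p {0..1} (?cut \<psi>))"
    by (rule nn_integral_norm_add_powr_le[OF sm p]) (auto simp: norm_triangle_ineq4)
  also have "\<dots> < \<infinity>"
    unfolding eq using \<phi> \<psi> by (simp add: in_Lp_iff ennreal_mult_less_top)
  finally have "Lp_mass p {0..1} (\<lambda>s. \<phi> s - \<psi> s) < \<infinity>" .
  moreover have "smeas (?cut (\<lambda>s. \<phi> s - \<psi> s))"
  proof -
    have "?cut (\<lambda>s. \<phi> s - \<psi> s) = (\<lambda>s. ?cut \<phi> s - ?cut \<psi> s)" by auto
    then show ?thesis using smeas_diff[OF sm] by simp
  qed
  ultimately show ?thesis by (simp add: in_Lp_iff)
qed

lemma smeas_hat:
  fixes F :: "real \<Rightarrow> 'a \<Rightarrow> 'b::real_normed_vector"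
  assumes F: "\<And>t. t \<ge> 0 \<Longrightarrow> in_Lp p (hat F t x)"
  shows "smeas (\<lambda>s. if s \<ge> 0 then F s x else 0)"
proof -
  have 1: "smeas (\<lambda>s. if s - real k \<in> {0..1} then F s x else 0)" for k :: nat
  proof -
    have "smeas (\<lambda>s. if s \<in> {0..1} then F (real k + s) x else 0)"
      using F[of "real k"] by (simp add: in_Lp_iff hat_def)
    from smeas_shift[OF this, of "- real k"] show ?thesis by (simp cong: if_cong)
  qed
  have 2: "(\<lambda>s::real. nat \<lfloor>s\<rfloor>) \<in> lebesgue \<rightarrow>\<^sub>M count_space UNIV"
    by (rule measurable_compose[OF borel_measurable_lebesgue_ident]) measurable
  have "smeas (\<lambda>s. if s - real (nat \<lfloor>s\<rfloor>) \<in> {0..1} then F s x else 0)"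
    using smeas_select[where G="\<lambda>k s. if s - real k \<in> {0..1} then F s x else 0", OF 1 2] by simp
  moreover have "s - real (nat \<lfloor>s\<rfloor>) \<in> {0..1} \<longleftrightarrow> s \<ge> 0" for s :: real
  proof
    assume "s \<ge> 0"
    moreover have "s - of_int \<lfloor>s\<rfloor> \<le> 1" by linarith
    ultimately show "s - real (nat \<lfloor>s\<rfloor>) \<in> {0..1}" by simp
  qed auto
  ultimately show ?thesis by simp
qed

lemma stepanov_aap_hat:
  fixes F :: "real \<Rightarrow> 'a::real_normed_vector \<Rightarrow> 'b::real_normed_vector"
  assumes F: "Lp_continuous p (hat F)" and p: "p \<ge> 1"
    and per: "\<And>\<epsilon>. \<epsilon> > 0 \<Longrightarrow> almost_periods (\<lambda>t \<tau>.
      Lp_mass p {0..1} (\<lambda>s. hat F (t + \<tau>) x s - hat F t x s) \<le> ennreal \<epsilon>)"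
  shows "stepanov_aap p (\<lambda>s. if s \<ge> 0 then F s x else 0)"
proof (rule stepanov_aapI)
  have Lp: "in_Lp p (hat F t x)" if "t \<ge> 0" for t
    using F that by (simp add: Lp_continuous_def)
  show sm: "smeas (\<lambda>s. if s \<ge> 0 then F s x else 0)" by (rule smeas_hat[OF Lp])
  show "Lp_mass p {t..t + 1} (\<lambda>s. if s \<ge> 0 then F s x else 0) < \<infinity>" if t: "t \<ge> 0" for t
  proof -
    have "Lp_mass p {t..t + 1} (\<lambda>s. if s \<ge> 0 then F s x else 0) =
        Lp_mass p {0..1} (\<lambda>s. if t + s \<ge> 0 then F (t + s) x else 0)"
      by (rule nn_integral_norm_powr_shift[OF sm, symmetric])
    also have "\<dots> = Lp_mass p {0..1} (hat F t x)"
      using t by (intro nn_integral_cong) (auto simp: hat_def indicator_def)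
    also have "\<dots> < \<infinity>" using Lp[OF t] by (simp add: in_Lp_iff)
    finally show ?thesis .
  qed
  have D: "stepanov_dist p (\<lambda>s. if s \<ge> 0 then F s x else 0) s t =
      Lp_mass p {0..1} (\<lambda>r. hat F s x r - hat F t x r)" if "s \<ge> 0" "t \<ge> 0" for s t
    unfolding stepanov_dist_def using that by (intro nn_integral_cong) (auto simp: hat_def indicator_def)
  show "\<forall>\<^sub>F s in at t within {0..}. stepanov_dist p (\<lambda>s. if s \<ge> 0 then F s x else 0) s t \<le> ennreal \<epsilon>"
    if t: "t \<ge> 0" and \<epsilon>: "\<epsilon> > 0" for t \<epsilon>
  proof -
    have lim: "((\<lambda>z. Lp_norm p (\<lambda>s. hat F (fst z) (snd z) s - hat F t x s)) \<longlongrightarrow> 0) (at (t, x) within {0..} \<times> UNIV)"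
      using F t by (simp add: Lp_continuous_def)
    have "filterlim (\<lambda>s. (s, x)) (at (t, x) within {0..} \<times> UNIV) (at t within {0..})"
      unfolding filterlim_at
      by (auto simp: eventually_at_filter intro!: tendsto_intros)
    from filterlim_compose[OF lim this]
    have "((\<lambda>s. Lp_norm p (\<lambda>r. hat F s x r - hat F t x r)) \<longlongrightarrow> 0) (at t within {0..})" by simp
    then have "\<forall>\<^sub>F s in at t within {0..}. Lp_norm p (\<lambda>r. hat F s x r - hat F t x r) < \<epsilon> powr (1 / p)"
      using \<epsilon> by (intro order_tendstoD) auto
    moreover have "\<forall>\<^sub>F s in at t within {0..}. s \<ge> 0" by (simp add: eventually_at_filter)
    ultimately show ?thesis
    proof eventually_elim
      case (elim s)
      have "stepanov_dist p (\<lambda>s. if s \<ge> 0 then F s x else 0) s t \<le> ennreal ((\<epsilon> powr (1 / p)) powr p)"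
        unfolding D[OF elim(2) t] using elim t p
        by (intro nn_integral_le_Lp_norm in_Lp_diff Lp) auto
      then show ?case using \<epsilon> p by (simp add: powr_powr)
    qed
  qed
  show "almost_periods (\<lambda>t \<tau>. stepanov_dist p (\<lambda>s. if s \<ge> 0 then F s x else 0) (t + \<tau>) t \<le> ennreal \<epsilon>)"
    if "\<epsilon> > 0" for \<epsilon>
    by (rule almost_periods_mono[OF per[OF that] order_refl], subst D) auto
qed (use p in auto)

lemma stepanov_aap_APS:
  fixes g :: "real \<Rightarrow> 'a::real_normed_vector \<Rightarrow> 'b::real_normed_vector"
  assumes g: "g \<in> APS p" and p: "p \<ge> 1"
  shows "stepanov_aap p (\<lambda>s. if s \<ge> 0 then g s x else 0)"
proof (rule stepanov_aap_hat[OF _ p])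
  show cont: "Lp_continuous p (hat g)" using g by (simp add: APS_def)
  fix \<epsilon> :: real assume \<epsilon>: "\<epsilon> > 0"
  have "\<epsilon> powr (1 / p) > 0" "compact {x}" using \<epsilon> by auto
  then obtain l where l: "l > 0" "\<And>a. a \<ge> 0 \<Longrightarrow> \<exists>\<tau>\<in>{a..a + l}. \<forall>t\<ge>0. \<forall>x\<in>{x}.
        Lp_norm p (\<lambda>s. hat g (t + \<tau>) x s - hat g t x s) \<le> \<epsilon> powr (1 / p)"
    using g unfolding APS_def by blast
  have "almost_periods (\<lambda>t \<tau>. \<forall>t\<ge>0. Lp_norm p (\<lambda>s. hat g (t + \<tau>) x s - hat g t x s) \<le> \<epsilon> powr (1 / p))"
    unfolding almost_periods_def
  proof (intro exI[of _ l] conjI allI impI)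
    fix a :: real assume "a \<ge> 0"
    then obtain \<tau> where "\<tau> \<in> {a..a + l}" "\<forall>t\<ge>0. Lp_norm p (\<lambda>s. hat g (t + \<tau>) x s - hat g t x s) \<le> \<epsilon> powr (1 / p)"
      using l(2)[of a] by auto
    then show "\<exists>\<tau>\<in>{a..a + l}. \<forall>t\<ge>l. \<forall>t\<ge>0.
        Lp_norm p (\<lambda>s. hat g (t + \<tau>) x s - hat g t x s) \<le> \<epsilon> powr (1 / p)" by blast
  qed (use l(1) in auto)
  then show "almost_periods (\<lambda>t \<tau>. Lp_mass p {0..1} (\<lambda>s. hat g (t + \<tau>) x s - hat g t x s) \<le> ennreal \<epsilon>)"
  proof (rule almost_periods_mono[OF _ order_refl])
    fix m \<tau> t :: real
    assume *: "m > 0" "\<tau> \<ge> 0" "t \<ge> m + 0"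
      "\<And>t. t \<ge> m \<Longrightarrow> \<forall>t\<ge>0. Lp_norm p (\<lambda>s. hat g (t + \<tau>) x s - hat g t x s) \<le> \<epsilon> powr (1 / p)"
    have "Lp_mass p {0..1} (\<lambda>s. hat g (t + \<tau>) x s - hat g t x s) \<le> ennreal ((\<epsilon> powr (1 / p)) powr p)"
      using cont * p unfolding Lp_continuous_def by (intro nn_integral_le_Lp_norm in_Lp_diff) auto
    then show "Lp_mass p {0..1} (\<lambda>s. hat g (t + \<tau>) x s - hat g t x s) \<le> ennreal \<epsilon>"
      using \<epsilon> p by (simp add: powr_powr)
  qed
qed

lemma stepanov_aap_C0_Lp:
  fixes q :: "real \<Rightarrow> 'a::real_normed_vector \<Rightarrow> 'b::real_normed_vector"
  assumes q: "hat q \<in> C0_Lp p" and p: "p \<ge> 1"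
  shows "stepanov_aap p (\<lambda>s. if s \<ge> 0 then q s x else 0)"
proof (rule stepanov_aap_hat[OF _ p])
  show cont: "Lp_continuous p (hat q)" using q by (simp add: C0_Lp_def)
  then have Lp: "in_Lp p (hat q t x)" if "t \<ge> 0" for t
    using that by (simp add: Lp_continuous_def)
  fix \<epsilon> :: real assume \<epsilon>: "\<epsilon> > 0"
  define e where "e = \<epsilon> / (2 * 2 powr p)"
  have e: "e > 0" "2 powr p * (e + e) = \<epsilon>" using \<epsilon> by (simp_all add: e_def)
  have "uniform_limit {x} (\<lambda>t x. Lp_norm p (hat q t x)) (\<lambda>_. 0) at_top"
    using q compact_sing unfolding C0_Lp_def by blast
  then have "\<forall>\<^sub>F t in at_top. \<forall>y\<in>{x}. dist (Lp_norm p (hat q t y)) 0 < e powr (1 / p)"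
    using e(1) by (intro uniform_limitD) auto
  then obtain m where m: "\<And>t. t \<ge> m \<Longrightarrow> Lp_norm p (hat q t x) \<le> e powr (1 / p)"
    unfolding eventually_at_top_linorder by fastforce
  let ?cut = "\<lambda>t s. if s \<in> {0..1::real} then hat q t x s else 0"
  have small: "Lp_mass p {0..1} (?cut t) \<le> ennreal e" if t: "t \<ge> max m 1" for t
  proof -
    have "Lp_mass p {0..1} (?cut t) =
        Lp_mass p {0..1} (hat q t x)"
      by (intro nn_integral_cong) (auto simp: indicator_def)
    also have "\<dots> \<le> ennreal ((e powr (1 / p)) powr p)"
      using t p by (intro nn_integral_le_Lp_norm Lp m) auto
    finally show ?thesis using e(1) p by (simp add: powr_powr)
  qed
  have le: "Lp_mass p {0..1} (\<lambda>s. hat q (t + \<tau>) x s - hat q t x s) \<le> ennreal \<epsilon>"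
    if "t \<ge> max m 1" "\<tau> \<ge> 0" for t \<tau>
  proof -
    have "Lp_mass p {0..1} (\<lambda>s. hat q (t + \<tau>) x s - hat q t x s) \<le> ennreal (2 powr p) *
      (Lp_mass p {0..1} (\<lambda>s. ?cut (t + \<tau>) s) +
       Lp_mass p {0..1} (?cut t))"
    proof (rule nn_integral_norm_add_powr_le)
      show "smeas (?cut (t + \<tau>))" "smeas (?cut t)"
        using Lp[of "t + \<tau>"] Lp[of t] that by (simp_all add: in_Lp_iff)
    qed (use p in \<open>auto simp: norm_triangle_ineq4\<close>)
    also have "\<dots> \<le> ennreal (2 powr p) * (ennreal e + ennreal e)"
      using that by (intro mult_left_mono add_mono small) auto
    also have "\<dots> = ennreal (2 powr p * (e + e))"
      using e(1) by (simp add: ennreal_mult[symmetric] ennreal_plus[symmetric] del: ennreal_plus)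
    finally show ?thesis by (simp only: e(2))
  qed
  then show "almost_periods (\<lambda>t \<tau>. Lp_mass p {0..1} (\<lambda>s. hat q (t + \<tau>) x s - hat q t x s) \<le> ennreal \<epsilon>)"
    by (rule almost_periods_tail)
qed

section \<open>Iterated kernels\<close>

text \<open>As the Lipschitz bound \<open>L\<close> may fail to be measurable, the integrals of this section are lower
  integrals, that is, suprema over measurable minorants.\<close>

lemma nn_integral_cmult_ennreal_le:
  "ennreal a * (\<integral>\<^sup>+x. f x \<partial>N) \<le> (\<integral>\<^sup>+x. ennreal a * f x \<partial>N)"
proof -
  have "ennreal a * (\<integral>\<^sup>+x. f x \<partial>N) = (SUP g\<in>{g. simple_function N g \<and> g \<le> f}. ennreal a * integral\<^sup>S N g)"
    unfolding nn_integral_def by (rule SUP_mult_left_ennreal)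
  also have "\<dots> \<le> (\<integral>\<^sup>+x. ennreal a * f x \<partial>N)"
  proof (rule SUP_least, clarify)
    fix g assume g: "simple_function N g" "g \<le> f"
    have "ennreal a * integral\<^sup>S N g = integral\<^sup>S N (\<lambda>x. ennreal a * g x)"
      using g(1) by (simp add: simple_integral_mult)
    also have "\<dots> = (\<integral>\<^sup>+x. ennreal a * g x \<partial>N)"
      by (rule nn_integral_eq_simple_integral[symmetric]) (use g(1) in auto)
    also have "\<dots> \<le> (\<integral>\<^sup>+x. ennreal a * f x \<partial>N)"
      using g(2) by (intro nn_integral_mono mult_left_mono) (auto simp: le_fun_def)
    finally show "ennreal a * integral\<^sup>S N g \<le> (\<integral>\<^sup>+x. ennreal a * f x \<partial>N)" .
  qed
  finally show ?thesis .
qed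

lemma nn_integral_cmult_ennreal:
  assumes "a \<ge> 0"
  shows "(\<integral>\<^sup>+x. ennreal a * f x \<partial>N) = ennreal a * (\<integral>\<^sup>+x. f x \<partial>N)"
proof (cases "a = 0")
  case False
  then have a: "a > 0" using assms by simp
  have inv: "ennreal a * (ennreal (1 / a) * x) = x" for x
    using a by (simp add: mult.assoc[symmetric] ennreal_mult[symmetric])
  have inv': "ennreal (1 / a) * (ennreal a * x) = x" for x
    using a by (simp add: mult.assoc[symmetric] ennreal_mult[symmetric])
  have "(\<integral>\<^sup>+x. ennreal a * f x \<partial>N) = ennreal a * (ennreal (1 / a) * (\<integral>\<^sup>+x. ennreal a * f x \<partial>N))"
    by (rule inv[symmetric])
  also have "\<dots> \<le> ennreal a * (\<integral>\<^sup>+x. ennreal (1 / a) * (ennreal a * f x) \<partial>N)"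
    by (intro mult_left_mono nn_integral_cmult_ennreal_le) simp
  also have "\<dots> = ennreal a * (\<integral>\<^sup>+x. f x \<partial>N)" by (simp only: inv')
  finally show ?thesis by (intro antisym nn_integral_cmult_ennreal_le)
qed simp

primrec iter_kernel :: "(real \<Rightarrow> real) \<Rightarrow> (real \<Rightarrow> real) \<Rightarrow> nat \<Rightarrow> real \<Rightarrow> ennreal"
  where
    "iter_kernel k L 0 t = 1"
  | "iter_kernel k L (Suc n) t = (\<integral>\<^sup>+s\<in>{0..t}. ennreal (k (t - s) * L s) * iter_kernel k L n s \<partial>lebesgue)"

lemma iter_kernel_bound:
  assumes d0: "\<And>t. t \<ge> 0 \<Longrightarrow> d 0 t \<le> ennreal B" and B: "B \<ge> 0"
    and d: "\<And>n t. t \<ge> 0 \<Longrightarrow> d (Suc n) t \<le> (\<integral>\<^sup>+s\<in>{0..t}. ennreal (k (t - s) * L s) * d n s \<partial>lebesgue)"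
    and t: "t \<ge> 0"
  shows "d n t \<le> ennreal B * iter_kernel k L n t"
  using t
proof (induction n arbitrary: t)
  case (Suc n)
  have "d (Suc n) t \<le> (\<integral>\<^sup>+s\<in>{0..t}. ennreal (k (t - s) * L s) * d n s \<partial>lebesgue)"
    by (rule d[OF Suc.prems])
  also have "\<dots> \<le> (\<integral>\<^sup>+s. ennreal B * (ennreal (k (t - s) * L s) * iter_kernel k L n s * indicator {0..t} s) \<partial>lebesgue)"
  proof (rule nn_integral_mono)
    fix s
    show "ennreal (k (t - s) * L s) * d n s * indicator {0..t} s \<le>
        ennreal B * (ennreal (k (t - s) * L s) * iter_kernel k L n s * indicator {0..t} s)"
    proof (cases "s \<in> {0..t}")
      case True
      then have "ennreal (k (t - s) * L s) * d n s \<le> ennreal (k (t - s) * L s) * (ennreal B * iter_kernel k L n s)"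
        by (intro mult_left_mono Suc.IH) auto
      then show ?thesis using True by (simp add: mult_ac)
    qed simp
  qed
  also have "\<dots> = ennreal B * iter_kernel k L (Suc n) t"
    using B by (simp add: nn_integral_cmult_ennreal)
  finally show ?case .
qed (use d0 in simp)

lemma iterated_integral_cong:
  assumes "\<And>y. (\<And>i. i > n \<Longrightarrow> y i = x i) \<Longrightarrow> (\<And>i. y i \<ge> 0) \<Longrightarrow> F y = F' y" and "\<And>i. x i \<ge> 0"
  shows "iterated_integral n t F x = iterated_integral n t F' x"
  using assms
proof (induction n arbitrary: t x)
  case (Suc n)
  have "iterated_integral n s F (x(Suc n := s)) = iterated_integral n s F' (x(Suc n := s))" if "s \<in> {0..t}" for s
  proof (rule Suc.IH)
    show "(x(Suc n := s)) i \<ge> 0" for i using Suc.prems(2) that by simp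
    fix y :: "nat \<Rightarrow> real" assume y: "\<And>i. i > n \<Longrightarrow> y i = (x(Suc n := s)) i" "\<And>i. y i \<ge> 0"
    show "F y = F' y" by (rule Suc.prems(1)) (use y in auto)
  qed
  then show ?case by (auto simp: indicator_def intro!: nn_integral_cong)
qed simp

lemma iterated_integral_cmult:
  assumes "a \<ge> 0"
  shows "iterated_integral n t (\<lambda>y. ennreal a * F y) x = ennreal a * iterated_integral n t F x"
  by (induction n arbitrary: t x) (simp_all add: nn_integral_cmult_ennreal[OF assms] mult.assoc)

lemma iter_kernel_eq_iterated_integral:
  assumes M: "M > 0" and L: "\<And>t. t \<ge> 0 \<Longrightarrow> L t > 0" and x: "\<And>i. x i \<ge> 0" and t: "t \<ge> 0"
  shows "iter_kernel (singular_kernel M c \<beta>) L (Suc n) t = ennreal (M ^ Suc n) * (ennreal (exp (- c * t)) *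
    iterated_integral (Suc n) t
      (\<lambda>x. ennreal (exp (c * x 1) * (t - x (Suc n)) powr (\<beta> - 1) *
             (\<Prod>i=2..Suc n. (x i - x (i - 1)) powr (\<beta> - 1)) * (\<Prod>i=1..Suc n. L (x i)))) x)"
  using x t
proof (induction n arbitrary: t x)
  case 0
  have "iter_kernel (singular_kernel M c \<beta>) L (Suc 0) t =
      (\<integral>\<^sup>+s. ennreal (M * exp (- c * t)) * (ennreal (exp (c * s) * (t - s) powr (\<beta> - 1) * L s) * indicator {0..t} s) \<partial>lebesgue)"
    unfolding iter_kernel.simps
  proof (rule nn_integral_cong)
    fix s
    have "- c * (t - s) = - c * t + c * s" by (simp add: algebra_simps)
    then have "exp (- c * (t - s)) = exp (- c * t) * exp (c * s)" by (simp only: exp_add)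
    then have "singular_kernel M c \<beta> (t - s) * L s = (M * exp (- c * t)) * (exp (c * s) * (t - s) powr (\<beta> - 1) * L s)"
      by (simp add: singular_kernel_def)
    then show "ennreal (singular_kernel M c \<beta> (t - s) * L s) * 1 * indicator {0..t} s =
        ennreal (M * exp (- c * t)) * (ennreal (exp (c * s) * (t - s) powr (\<beta> - 1) * L s) * indicator {0..t} s)"
      using M L[of s] by (auto simp: indicator_def ennreal_mult[symmetric])
  qed
  also have "\<dots> = ennreal (M * exp (- c * t)) * (\<integral>\<^sup>+s\<in>{0..t}. ennreal (exp (c * s) * (t - s) powr (\<beta> - 1) * L s) \<partial>lebesgue)"
    using M by (intro nn_integral_cmult_ennreal) simp
  finally show ?case using M by (simp add: ennreal_mult mult.assoc)
next
  case (Suc n)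
  let ?G = "\<lambda>n t x. exp (c * x 1) * (t - x (Suc n)) powr (\<beta> - 1) *
      (\<Prod>i=2..Suc n. (x i - x (i - 1)) powr (\<beta> - 1)) * (\<Prod>i=1..Suc n. L (x i))"
  let ?I = "\<lambda>n t x. iterated_integral (Suc n) t (\<lambda>x. ennreal (?G n t x)) x"
  have G0: "?G n t y \<ge> 0" if "\<And>i. y i \<ge> 0" for n t and y :: "nat \<Rightarrow> real"
    using that L by (intro mult_nonneg_nonneg prod_nonneg ballI less_imp_le[OF L]) auto
  have step: "iterated_integral (Suc n) s (\<lambda>x. ennreal (?G (Suc n) t x)) (x(Suc (Suc n) := s)) =
      ennreal ((t - s) powr (\<beta> - 1) * L s) * ?I n s (x(Suc (Suc n) := s))" if s: "s \<in> {0..t}" for s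
  proof -
    have "iterated_integral (Suc n) s (\<lambda>x. ennreal (?G (Suc n) t x)) (x(Suc (Suc n) := s)) =
        iterated_integral (Suc n) s (\<lambda>x. ennreal ((t - s) powr (\<beta> - 1) * L s) * ennreal (?G n s x)) (x(Suc (Suc n) := s))"
    proof (rule iterated_integral_cong)
      show "(x(Suc (Suc n) := s)) i \<ge> 0" for i using Suc.prems(1) s by simp
      fix y :: "nat \<Rightarrow> real" assume y: "\<And>i. i > Suc n \<Longrightarrow> y i = (x(Suc (Suc n) := s)) i" "\<And>i. y i \<ge> 0"
      have ys: "y (Suc (Suc n)) = s" using y(1)[of "Suc (Suc n)"] by simp
      have P: "(\<Prod>i=2..Suc (Suc n). h i) = (\<Prod>i=2..Suc n. h i) * h (Suc (Suc n))"
          "(\<Prod>i=1..Suc (Suc n). h i) = (\<Prod>i=1..Suc n. h i) * h (Suc (Suc n))" for h :: "nat \<Rightarrow> real"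
        using prod.nat_ivl_Suc'[of 2 "Suc n" h] prod.nat_ivl_Suc'[of 1 "Suc n" h] by simp_all
      have G: "?G (Suc n) t y = (t - s) powr (\<beta> - 1) * L s * ?G n s y"
        by (simp only: P ys diff_Suc_1 mult_ac)
      show "ennreal (?G (Suc n) t y) = ennreal ((t - s) powr (\<beta> - 1) * L s) * ennreal (?G n s y)"
        unfolding G by (rule ennreal_mult) (use G0[of y s n] y(2) L[of s] s in auto)
    qed
    also have "\<dots> = ennreal ((t - s) powr (\<beta> - 1) * L s) * ?I n s (x(Suc (Suc n) := s))"
      using L[of s] s by (intro iterated_integral_cmult) auto
    finally show ?thesis .
  qed
  have "iter_kernel (singular_kernel M c \<beta>) L (Suc (Suc n)) t =
      (\<integral>\<^sup>+s. ennreal (M ^ Suc (Suc n) * exp (- c * t)) *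
        (iterated_integral (Suc n) s (\<lambda>x. ennreal (?G (Suc n) t x)) (x(Suc (Suc n) := s)) * indicator {0..t} s) \<partial>lebesgue)"
    unfolding iter_kernel.simps(2)[of _ _ "Suc n"]
  proof (rule nn_integral_cong)
    fix s
    show "ennreal (singular_kernel M c \<beta> (t - s) * L s) * iter_kernel (singular_kernel M c \<beta>) L (Suc n) s * indicator {0..t} s =
      ennreal (M ^ Suc (Suc n) * exp (- c * t)) *
        (iterated_integral (Suc n) s (\<lambda>x. ennreal (?G (Suc n) t x)) (x(Suc (Suc n) := s)) * indicator {0..t} s)"
    proof (cases "s \<in> {0..t}")
      case True
      have IH: "iter_kernel (singular_kernel M c \<beta>) L (Suc n) s =
          ennreal (M ^ Suc n) * (ennreal (exp (- c * s)) * ?I n s (x(Suc (Suc n) := s)))"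
        by (rule Suc.IH) (use Suc.prems True in auto)
      have "- c * (t - s) + - c * s = - c * t" by (simp add: algebra_simps)
      then have "exp (- c * (t - s)) * exp (- c * s) = exp (- c * t)" by (simp only: exp_add[symmetric])
      then have "(singular_kernel M c \<beta> (t - s) * L s) * (M ^ Suc n * exp (- c * s)) =
          (M ^ Suc (Suc n) * exp (- c * t)) * ((t - s) powr (\<beta> - 1) * L s)"
        by (simp add: singular_kernel_def mult_ac)
      moreover have "L s \<ge> 0" using L[of s] True by auto
      ultimately have "ennreal (singular_kernel M c \<beta> (t - s) * L s) * (ennreal (M ^ Suc n) * ennreal (exp (- c * s))) =
          ennreal (M ^ Suc (Suc n) * exp (- c * t)) * ennreal ((t - s) powr (\<beta> - 1) * L s)"
        using M singular_kernel_nonneg[of M c \<beta> "t - s"]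
        by (simp only: ennreal_mult[symmetric] less_imp_le mult_nonneg_nonneg zero_le_power exp_ge_zero powr_ge_zero)
      then show ?thesis using True step[OF True] IH by (simp add: mult.assoc[symmetric])
    qed simp
  qed
  also have "\<dots> = ennreal (M ^ Suc (Suc n) * exp (- c * t)) * ?I (Suc n) t x"
    unfolding iterated_integral.simps(2)[of "Suc n"]
    using M by (intro nn_integral_cmult_ennreal) simp
  finally show ?case using M by (simp add: ennreal_mult mult.assoc)
qed

lemma iter_kernel_le_M_const:
  assumes "M > 0" "\<And>t. t \<ge> 0 \<Longrightarrow> L t > 0" "t \<ge> 0" "n \<ge> 1"
  shows "iter_kernel (singular_kernel M c \<beta>) L n t \<le> M_const M c \<beta> L n"
proof -
  obtain m where m: "n = Suc m" using assms(4) by (cases n) auto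
  show ?thesis
    unfolding M_const_def m
    by (subst iter_kernel_eq_iterated_integral[where x="\<lambda>_. 0"])
      (use assms in \<open>auto intro!: mult_left_mono SUP_upper2[of t]\<close>)
qed

text \<open>If \<open>g\<close> is a simple minorant of the integrand of the first iterated kernel at \<open>t\<close>, cut \<open>[0, t]\<close> into
  \<open>n\<close> pieces of equal \<open>g\<close>-mass. As the kernel is decreasing, each iteration gains the factor
  \<open>(\<integral>g) / n\<close> on the next piece.\<close>

lemma iter_kernel_one_le:
  assumes M: "M > 0" and c: "c > 0" and \<beta>: "\<beta> \<le> 1" and L: "\<And>t. t \<ge> 0 \<Longrightarrow> L t > 0"
    and n: "n \<ge> 1" and less: "iter_kernel (singular_kernel M c \<beta>) L n t < 1" and t: "t \<ge> 0"
  shows "iter_kernel (singular_kernel M c \<beta>) L 1 t \<le> ennreal (real n)"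
proof -
  let ?k = "singular_kernel M c \<beta>"
  let ?f = "\<lambda>s. ennreal (?k (t - s) * L s) * 1 * indicator {0..t} s"
  have "iter_kernel ?k L 1 t = (\<integral>\<^sup>+s. ?f s \<partial>lebesgue)" by simp
  also have "\<dots> = (SUP g\<in>{g. simple_function lebesgue g \<and> g \<le> ?f}. integral\<^sup>S lebesgue g)"
    by (rule nn_integral_def)
  also have "\<dots> \<le> ennreal (real n)"
  proof (rule SUP_least, clarify)
    fix g assume g: "simple_function lebesgue g" "g \<le> ?f"
    have gm [measurable]: "g \<in> borel_measurable lebesgue" using g(1) by (rule borel_measurable_simple_function)
    have gf: "g s \<le> ?f s" for s using g(2) by (simp add: le_fun_def)
    have g0: "g s = 0" if "s \<notin> {0..t}" for s using gf[of s] that by simp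
    have gtop: "g s < top" for s
      by (rule le_less_trans[OF gf]) (auto simp: indicator_def)
    have "finite (enn2real ` range g)" using g(1) by (auto simp: simple_function_def)
    then obtain C0 where C0: "\<And>s. enn2real (g s) \<le> C0"
      by (metis finite_imp_bounded bounded_real abs_le_D1 rangeI image_eqI)
    have C0': "C0 \<ge> 0" using C0[of 0] enn2real_nonneg order_trans by blast
    have gC: "g s \<le> ennreal C0" for s
      using C0[of s] gtop[of s] by (metis ennreal_enn2real ennreal_leI)
    have piece: "(\<integral>\<^sup>+s\<in>{x<..y}. g s \<partial>lebesgue) \<le> ennreal (C0 * (y - x))" if "x \<le> y" for x y
    proof -
      have "(\<integral>\<^sup>+s\<in>{x<..y}. g s \<partial>lebesgue) \<le> (\<integral>\<^sup>+s. ennreal C0 * indicator {x<..y} s \<partial>lebesgue)"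
        by (intro nn_integral_mono mult_right_mono gC) simp
      also have "\<dots> = ennreal (C0 * (y - x))"
        using that C0' by (subst nn_integral_cmult_indicator) (auto simp: ennreal_mult)
      finally show ?thesis .
    qed
    have fin: "(\<integral>\<^sup>+s\<in>{0..y}. g s \<partial>lebesgue) < top" for y
    proof (cases "y \<ge> 0")
      case True
      have "(\<integral>\<^sup>+s\<in>{0..y}. g s \<partial>lebesgue) \<le> (\<integral>\<^sup>+s\<in>{-1<..y}. g s \<partial>lebesgue)"
        by (intro nn_integral_mono) (auto simp: indicator_def)
      also have "\<dots> \<le> ennreal (C0 * (y - -1))" using True by (intro piece) simp
      finally show ?thesis by (rule le_less_trans) simp
    qed simp
    define G where "G y = enn2real (\<integral>\<^sup>+s\<in>{0..y}. g s \<partial>lebesgue)" for y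
    have G: "(\<integral>\<^sup>+s\<in>{0..y}. g s \<partial>lebesgue) = ennreal (G y)" for y
      using fin[of y] by (simp add: G_def)
    have Gnn: "G y \<ge> 0" for y by (simp add: G_def)
    have split: "ennreal (G y) = ennreal (G x) + (\<integral>\<^sup>+s\<in>{x<..y}. g s \<partial>lebesgue)" if "0 \<le> x" "x \<le> y" for x y
    proof -
      have "(\<integral>\<^sup>+s\<in>{0..y}. g s \<partial>lebesgue) = (\<integral>\<^sup>+s. g s * indicator {0..x} s + g s * indicator {x<..y} s \<partial>lebesgue)"
        using that by (intro nn_integral_cong) (auto simp: indicator_def)
      also have "\<dots> = (\<integral>\<^sup>+s\<in>{0..x}. g s \<partial>lebesgue) + (\<integral>\<^sup>+s\<in>{x<..y}. g s \<partial>lebesgue)"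
        by (rule nn_integral_add) measurable
      finally show ?thesis by (simp only: G)
    qed
    have Gmono: "G x \<le> G y" if "0 \<le> x" "x \<le> y" for x y
    proof -
      have "ennreal (G x) \<le> ennreal (G y)" by (subst split[OF that]) simp
      then show ?thesis using Gnn by simp
    qed
    have Glip: "G y \<le> G x + C0 * (y - x)" if "0 \<le> x" "x \<le> y" for x y
    proof -
      have "ennreal (G y) \<le> ennreal (G x) + ennreal (C0 * (y - x))"
        by (subst split[OF that]) (intro add_left_mono piece that)
      then show ?thesis using Gnn C0' that by (simp add: ennreal_plus[symmetric] del: ennreal_plus)
    qed
    have Gcont: "continuous_on {0..t} G"
    proof (rule lipschitz_on_continuous_on[of C0], rule lipschitz_onI)
      fix x y assume "x \<in> {0..t}" "y \<in> {0..t}"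
      then show "dist (G x) (G y) \<le> C0 * dist x y"
        using Gmono[of x y] Glip[of x y] Gmono[of y x] Glip[of y x]
        by (cases "x \<le> y") (auto simp: dist_real_def abs_if algebra_simps)
    qed (rule C0')
    have G0: "G 0 = 0"
    proof -
      have "ennreal (G 0) \<le> (\<integral>\<^sup>+s. ennreal C0 * indicator {0..(0::real)} s \<partial>lebesgue)"
        unfolding G[symmetric] by (intro nn_integral_mono mult_right_mono gC) simp
      also have "\<dots> = 0" by (subst nn_integral_cmult_indicator) auto
      finally show ?thesis using Gnn[of 0] by (simp add: ennreal_eq_0_iff)
    qed
    have total: "integral\<^sup>S lebesgue g = ennreal (G t)"
    proof -
      have "integral\<^sup>S lebesgue g = (\<integral>\<^sup>+s. g s \<partial>lebesgue)"
        using g(1) by (rule nn_integral_eq_simple_integral[symmetric])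
      also have "\<dots> = (\<integral>\<^sup>+s\<in>{0..t}. g s \<partial>lebesgue)"
        using g0 by (intro nn_integral_cong) (auto simp: indicator_def)
      finally show ?thesis by (simp only: G)
    qed
    have "G t \<le> real n"
    proof (cases "G t = 0")
      case False
      define e where "e = G t / real n"
      have e: "e > 0" "real n * e = G t" using False Gnn[of t] n by (auto simp: e_def)
      have "\<exists>y\<in>{0..t}. G y = real i * e" if "i \<le> n" for i
      proof -
        have "real i * e \<le> real n * e" using that e(1) by (intro mult_right_mono) auto
        then show ?thesis
          using IVT'[of G 0 "real i * e" t] G0 t Gcont e by auto
      qed
      then obtain y where y: "\<And>i. i \<le> n \<Longrightarrow> y i \<in> {0..t}" "\<And>i. i \<le> n \<Longrightarrow> G (y i) = real i * e"
        by metis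
      have "\<forall>z\<in>{y i..t}. ennreal (e ^ i) \<le> iter_kernel ?k L i z" if "i \<le> n" for i
        using that
      proof (induction i)
        case (Suc i)
        then have yi: "y i \<in> {0..t}" "y (Suc i) \<in> {0..t}" "G (y i) = real i * e" "G (y (Suc i)) = real (Suc i) * e"
          using y by auto
        have lt: "y i \<le> y (Suc i)"
        proof (rule ccontr)
          assume "\<not> ?thesis"
          then have "G (y (Suc i)) \<le> G (y i)" using yi by (intro Gmono) auto
          then show False using yi e(1) by (simp add: algebra_simps)
        qed
        show ?case
        proof
          fix z assume z: "z \<in> {y (Suc i)..t}"
          have "ennreal (real (Suc i) * e) = ennreal (real i * e) + (\<integral>\<^sup>+s\<in>{y i<..y (Suc i)}. g s \<partial>lebesgue)"
            using split[OF _ lt] yi by simp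
          moreover have "real (Suc i) * e = real i * e + e" by (simp add: algebra_simps)
          ultimately have mass: "(\<integral>\<^sup>+s\<in>{y i<..y (Suc i)}. g s \<partial>lebesgue) = ennreal e"
            using e(1) by (simp add: ennreal_plus ennreal_add_left_cancel)
          have "ennreal (e ^ Suc i) = (\<integral>\<^sup>+s. ennreal (e ^ i) * (g s * indicator {y i<..y (Suc i)} s) \<partial>lebesgue)"
            using e(1) mass by (simp add: nn_integral_cmult_ennreal ennreal_mult mult.commute)
          also have "\<dots> \<le> iter_kernel ?k L (Suc i) z"
            unfolding iter_kernel.simps
          proof (rule nn_integral_mono_AE)
            show "AE s in lebesgue. ennreal (e ^ i) * (g s * indicator {y i<..y (Suc i)} s) \<le>
                ennreal (?k (z - s) * L s) * iter_kernel ?k L i s * indicator {0..z} s"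
              using AE_lebesgue_neq[of z]
            proof eventually_elim
              case (elim s)
              show ?case
              proof (cases "s \<in> {y i<..y (Suc i)}")
                case True
                then have s: "0 \<le> s" "s < z" "s \<in> {y i..t}" "z \<le> t" using elim z yi by auto
                have "g s \<le> ennreal (?k (t - s) * L s)" using gf[of s] s by simp
                also have "\<dots> \<le> ennreal (?k (z - s) * L s)"
                  using s M c \<beta> L[OF s(1)]
                  by (intro ennreal_leI mult_right_mono singular_kernel_antimono) auto
                finally have "g s * ennreal (e ^ i) \<le> ennreal (?k (z - s) * L s) * iter_kernel ?k L i s"
                  using Suc s by (intro mult_mono) auto
                then show ?thesis using True s by (simp add: mult.commute)
              qed simp
            qed
          qed
          finally show "ennreal (e ^ Suc i) \<le> iter_kernel ?k L (Suc i) z" .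
        qed
      qed simp
      then have "ennreal (e ^ n) \<le> iter_kernel ?k L n t" using y(1)[of n] by auto
      then have "ennreal (e ^ n) < ennreal 1" unfolding ennreal_1 using less by (rule le_less_trans)
      then have "e ^ n < 1" using e(1) by (simp only: ennreal_less_iff zero_le_power less_imp_le)
      then have "e < 1" using e(1) by (meson linorder_not_le one_le_power)
      then show ?thesis using e(2) n by (metis less_eq_real_def mult_left_le of_nat_0_le_iff)
    qed simp
    then show "integral\<^sup>S lebesgue g \<le> ennreal (real n)"
      unfolding total by (rule ennreal_leI)
  qed
  finally show ?thesis .
qed

section \<open>The fixed point argument\<close>

locale semilinear = singular_family T M c \<beta> p
  for T :: "real \<Rightarrow> 'a::banach \<Rightarrow>\<^sub>L 'a" and M c \<beta> p :: real +
  fixes f :: "real \<Rightarrow> 'a \<Rightarrow> 'a" and L :: "real \<Rightarrow> real" and w :: "real \<Rightarrow> 'a" and n :: nat and \<theta> :: real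
  assumes f_stepanov: "\<And>x. stepanov_aap p (\<lambda>s. if s \<ge> 0 then f s x else 0)"
    and f_lipschitz: "AE t in lebesgue. t > 0 \<longrightarrow> (\<forall>x y. norm (f t x - f t y) \<le> L t * norm (x - y))"
    and L_pos: "\<And>t. t \<ge> 0 \<Longrightarrow> L t > 0"
    and n: "n \<ge> 1" and \<theta>: "0 \<le> \<theta>" "\<theta> < 1"
    and iter_le: "\<And>t. t \<ge> 0 \<Longrightarrow> iter_kernel (singular_kernel M c \<beta>) L n t \<le> ennreal \<theta>"
    and w: "asymptotically_almost_periodic w"
begin

definition nemytskii :: "(real \<Rightarrow> 'a) \<Rightarrow> real \<Rightarrow> 'a"
  where "nemytskii u s = (if s \<ge> 0 then f s (u s) else 0)"

lemma iter_one_le: "t \<ge> 0 \<Longrightarrow> iter_kernel kern L 1 t \<le> ennreal (real n)"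
proof (rule iter_kernel_one_le[OF M c \<beta>(2) L_pos n])
  show "iter_kernel kern L n t < 1" if "t \<ge> 0"
    using le_less_trans[OF iter_le[OF that], of 1] \<theta> by (simp add: ennreal_less_iff flip: ennreal_1)
qed

lemma smeas_nemytskii:
  assumes u: "continuous_on {0..} u"
  shows "smeas (nemytskii u)"
proof -
  let ?G = "\<lambda>x s. if s \<ge> 0 then f s x else 0"
  have p0: "p \<ge> 0" using p by simp
  have "smeas (\<lambda>s. ?G (if s \<in> {0..} then u s else 0) s)"
  proof (rule smeas_compose[where G="?G"])
    show "smeas (?G x)" for x by (rule stepanov_aap_smeas[OF f_stepanov p0])
    show "smeas (\<lambda>s. if s \<in> {0..} then u s else 0)" by (rule smeas_continuous_on[OF u]) simp
    show "AE s in lebesgue. \<forall>x. isCont (\<lambda>x. ?G x s) x"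
      using f_lipschitz AE_lebesgue_neq[of 0]
    proof eventually_elim
      case (elim s)
      show ?case
      proof (cases "s > 0")
        case True
        then have "(L s)-lipschitz_on UNIV (f s)"
          using elim(1) L_pos[of s] by (intro lipschitz_onI) (auto simp: dist_norm)
        then have "isCont (f s) x" for x
          using lipschitz_on_continuous_on continuous_on_eq_continuous_at[OF open_UNIV] by blast
        then show ?thesis using True by simp
      qed (use elim in simp)
    qed
  qed
  moreover have "(\<lambda>s. ?G (if s \<in> {0..} then u s else 0) s) = nemytskii u" by (auto simp: nemytskii_def)
  ultimately show ?thesis by simp
qed

lemma kern_int_measurable:
  assumes "smeas h"
  shows "(\<lambda>s. ennreal (kern (t - s) * norm (h s))) \<in> borel_measurable lebesgue"
proof -
  have [measurable]: "(\<lambda>s. norm (h s)) \<in> borel_measurable lebesgue" by (rule smeas_norm[OF assms])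
  have [measurable]: "(\<lambda>s. kern (t - s)) \<in> borel_measurable lebesgue"
    by (rule measurable_compose[OF _ singular_kernel_measurable]) measurable
  show ?thesis by measurable
qed

lemma kern_int_add_le:
  assumes "smeas h" "smeas k"
  shows "kern_int (\<lambda>s. h s + k s) t \<le> kern_int h t + kern_int k t"
proof -
  note [measurable] = kern_int_measurable[OF assms(1), of t] kern_int_measurable[OF assms(2), of t]
  have "kern_int (\<lambda>s. h s + k s) t \<le> (\<integral>\<^sup>+s. ennreal (kern (t - s) * norm (h s)) * indicator {0..t} s +
      ennreal (kern (t - s) * norm (k s)) * indicator {0..t} s \<partial>lebesgue)"
    unfolding kern_int_def
  proof (rule nn_integral_mono)
    fix s
    have "kern (t - s) * norm (h s + k s) \<le> kern (t - s) * norm (h s) + kern (t - s) * norm (k s)"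
      using mult_left_mono[OF norm_triangle_ineq kern_nonneg] by (simp add: distrib_left)
    then show "ennreal (kern (t - s) * norm (h s + k s)) * indicator {0..t} s \<le>
        ennreal (kern (t - s) * norm (h s)) * indicator {0..t} s + ennreal (kern (t - s) * norm (k s)) * indicator {0..t} s"
      using kern_nonneg by (auto simp: indicator_def ennreal_plus[symmetric] simp del: ennreal_plus intro: ennreal_leI)
  qed
  also have "\<dots> = kern_int h t + kern_int k t"
    unfolding kern_int_def by (rule nn_integral_add) measurable
  finally show ?thesis .
qed

lemma kern_int_lipschitz_le:
  assumes "\<And>s. s > 0 \<Longrightarrow> (\<And>x y. norm (f s x - f s y) \<le> L s * norm (x - y)) \<Longrightarrow> norm (h s) \<le> L s * d s"
    and d: "\<And>s. s \<ge> 0 \<Longrightarrow> d s \<ge> 0"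
  shows "kern_int h t \<le> (\<integral>\<^sup>+s\<in>{0..t}. ennreal (kern (t - s) * L s) * ennreal (d s) \<partial>lebesgue)"
  unfolding kern_int_def
proof (rule nn_integral_mono_AE)
  show "AE s in lebesgue. ennreal (kern (t - s) * norm (h s)) * indicator {0..t} s \<le>
      ennreal (kern (t - s) * L s) * ennreal (d s) * indicator {0..t} s"
    using f_lipschitz AE_lebesgue_neq[of 0]
  proof eventually_elim
    case (elim s)
    show ?case
    proof (cases "s \<in> {0..t}")
      case True
      then have s: "s > 0" using elim(2) by simp
      have "kern (t - s) * norm (h s) \<le> kern (t - s) * (L s * d s)"
        using assms(1)[OF s] elim(1) s by (intro mult_left_mono kern_nonneg) auto
      then have "ennreal (kern (t - s) * norm (h s)) \<le> ennreal (kern (t - s) * L s * d s)"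
        by (intro ennreal_leI) (simp add: mult.assoc)
      also have "\<dots> = ennreal (kern (t - s) * L s) * ennreal (d s)"
        using kern_nonneg L_pos[of s] d[of s] s by (intro ennreal_mult mult_nonneg_nonneg) auto
      finally show ?thesis using True by simp
    qed simp
  qed
qed

text \<open>Freezing \<open>u\<close> in the second argument of \<open>f\<close> at the points \<open>x\<close> of a finite \<open>\<epsilon>\<close>-net of its range, by
  means of a partition of unity, changes the convolution by at most \<open>\<epsilon> * n\<close>, because the first
  iterated kernel is bounded by \<open>n\<close>. The frozen terms are products of scalar almost periodic and
  Stepanov almost periodic functions.\<close>

lemma nemytskii_approx:
  assumes u: "asymptotically_almost_periodic u" and \<epsilon>: "\<epsilon> > 0"
  obtains h where "stepanov_aap p h" "\<And>t. t \<ge> 0 \<Longrightarrow> kern_int (\<lambda>s. nemytskii u s - h s) t \<le> ennreal \<epsilon>"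
proof -
  define e where "e = \<epsilon> / real n"
  have e: "e > 0" "e * real n = \<epsilon>" using \<epsilon> n by (simp_all add: e_def)
  define K where "K = closure (u ` {0..})"
  have K: "compact K" unfolding K_def by (rule aap_compact_closure[OF u])
  have uK: "u t \<in> K" if "t \<ge> 0" for t
    unfolding K_def using that by (intro subsetD[OF closure_subset]) auto
  obtain N where N: "finite N" "K \<subseteq> (\<Union>x\<in>N. ball x e)"
    using K e(1) unfolding compact_eq_totally_bounded by blast
  define b where "b x y = max 0 (e - dist y x)" for x y :: 'a
  have b0: "b x y \<ge> 0" for x y by (simp add: b_def)
  define B where "B y = (\<Sum>x\<in>N. b x y)" for y
  have Bpos: "B y > 0" if y: "y \<in> K" for y
  proof -
    obtain x where "x \<in> N" "dist x y < e" using N(2) y by auto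
    then show ?thesis
      unfolding B_def using N(1) b0
      by (intro sum_pos2[of N x]) (auto simp: b_def dist_commute)
  qed
  define \<alpha> where "\<alpha> x y = b x y / B y" for x y
  have \<alpha>c: "continuous_on K (\<alpha> x)" for x
  proof -
    have "continuous_on K (b x)" for x unfolding b_def by (intro continuous_intros)
    then show ?thesis
      unfolding \<alpha>_def using Bpos
      by (intro continuous_on_divide) (auto simp: B_def[abs_def] intro!: continuous_intros dest: Bpos)
  qed
  have \<alpha>0: "\<alpha> x y \<ge> 0" if "y \<in> K" for x y using b0 Bpos[OF that] by (simp add: \<alpha>_def)
  have \<alpha>1: "(\<Sum>x\<in>N. \<alpha> x y) = 1" if "y \<in> K" for y
    using Bpos[OF that] by (simp add: \<alpha>_def sum_divide_distrib[symmetric] B_def)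
  define F where "F x s = (if s \<ge> 0 then f s x else 0)" for x s
  define h where "h s = (\<Sum>x\<in>N. \<alpha> x (u s) *\<^sub>R F x s)" for s
  have hs: "stepanov_aap p h"
    unfolding h_def
  proof (rule stepanov_aap_sum[OF N(1)])
    show "stepanov_aap p (\<lambda>s. \<alpha> x (u s) *\<^sub>R F x s)" for x
      unfolding F_def by (rule stepanov_aap_scaleR[OF f_stepanov aap_compose[OF u K uK \<alpha>c] p])
  qed (use p in simp)
  have "kern_int (\<lambda>s. nemytskii u s - h s) t \<le> ennreal \<epsilon>" if t: "t \<ge> 0" for t
  proof -
    have "kern_int (\<lambda>s. nemytskii u s - h s) t \<le> (\<integral>\<^sup>+s\<in>{0..t}. ennreal (kern (t - s) * L s) * ennreal e \<partial>lebesgue)"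
    proof (rule kern_int_lipschitz_le)
      fix s :: real assume s: "s > 0" and lip: "\<And>x y. norm (f s x - f s y) \<le> L s * norm (x - y)"
      have us: "u s \<in> K" using uK s by simp
      have "nemytskii u s - h s = (\<Sum>x\<in>N. \<alpha> x (u s) *\<^sub>R (f s (u s) - f s x))"
        using s \<alpha>1[OF us] by (simp add: nemytskii_def h_def F_def scaleR_diff_right sum_subtractf scaleR_sum_left[symmetric])
      also have "norm \<dots> \<le> (\<Sum>x\<in>N. \<alpha> x (u s) * (L s * e))"
      proof (rule sum_norm_le)
        fix x
        have "\<alpha> x (u s) * norm (f s (u s) - f s x) \<le> \<alpha> x (u s) * (L s * e)"
        proof (cases "dist (u s) x < e")
          case True
          have "norm (f s (u s) - f s x) \<le> L s * norm (u s - x)" by (rule lip)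
          also have "\<dots> \<le> L s * e" using True L_pos[of s] s by (intro mult_left_mono) (auto simp: dist_norm)
          finally show ?thesis using \<alpha>0[OF us] by (intro mult_left_mono)
        next
          case False
          then have "\<alpha> x (u s) = 0" by (simp add: \<alpha>_def b_def)
          then show ?thesis by simp
        qed
        then show "norm (\<alpha> x (u s) *\<^sub>R (f s (u s) - f s x)) \<le> \<alpha> x (u s) * (L s * e)"
          using \<alpha>0[OF us] by simp
      qed
      also have "\<dots> = L s * e" using \<alpha>1[OF us] by (simp add: sum_distrib_right[symmetric])
      finally show "norm (nemytskii u s - h s) \<le> L s * e" .
    qed (use e(1) in simp)
    also have "\<dots> = ennreal e * iter_kernel kern L 1 t"
      using e(1) by (simp add: nn_integral_cmult_ennreal[symmetric] mult_ac)
    also have "\<dots> \<le> ennreal e * ennreal (real n)" by (intro mult_left_mono iter_one_le t) simp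
    also have "\<dots> = ennreal \<epsilon>" using e by (simp add: ennreal_mult[symmetric])
    finally show ?thesis .
  qed
  then show thesis using that hs by blast
qed

lemma
  assumes u: "asymptotically_almost_periodic u"
  shows kern_int_nemytskii_finite: "t \<ge> 0 \<Longrightarrow> kern_int (nemytskii u) t < \<infinity>"
    and conv_nemytskii_aap: "asymptotically_almost_periodic (conv (nemytskii u))"
proof -
  note us = smeas_nemytskii[OF aap_continuous_on[OF u]]
  have p0: "p \<ge> 0" using p by simp
  have hfin: "kern_int h t < \<infinity>" if h: "stepanov_aap p h" and t: "t \<ge> 0" for h t
  proof -
    obtain B where "\<And>t. t \<ge> 0 \<Longrightarrow> kern_int h t \<le> ennreal B"
      using stepanov_kern_int_bounded[OF h] by metis
    then show ?thesis using le_less_trans[of "kern_int h t" "ennreal B" \<infinity>] t by simp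
  qed
  have fin: "kern_int (nemytskii u) t < \<infinity>" if t: "t \<ge> 0" for t
  proof -
    obtain h where h: "stepanov_aap p h" "\<And>t. t \<ge> 0 \<Longrightarrow> kern_int (\<lambda>s. nemytskii u s - h s) t \<le> ennreal 1"
      by (rule nemytskii_approx[OF u zero_less_one]) blast
    note hs = stepanov_aap_smeas[OF h(1) p0]
    have "kern_int (nemytskii u) t \<le> kern_int (\<lambda>s. nemytskii u s - h s) t + kern_int h t"
      using kern_int_add_le[OF smeas_diff[OF us hs] hs, of t] by simp
    also have "\<dots> < \<infinity>"
      using le_less_trans[OF h(2)[OF t], of \<infinity>] hfin[OF h(1) t] by simp
    finally show ?thesis .
  qed
  then show "t \<ge> 0 \<Longrightarrow> kern_int (nemytskii u) t < \<infinity>" .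
  show "asymptotically_almost_periodic (conv (nemytskii u))"
  proof (rule aap_uniform_limit)
    fix \<epsilon> :: real assume \<epsilon>: "\<epsilon> > 0"
    obtain h where h: "stepanov_aap p h" "\<And>t. t \<ge> 0 \<Longrightarrow> kern_int (\<lambda>s. nemytskii u s - h s) t \<le> ennreal \<epsilon>"
      by (rule nemytskii_approx[OF u \<epsilon>]) blast
    note hs = stepanov_aap_smeas[OF h(1) p0]
    have "norm (conv (nemytskii u) t - conv h t) \<le> \<epsilon>" if t: "t \<ge> 0" for t
    proof -
      have "ennreal (norm (conv (\<lambda>s. nemytskii u s - h s) t)) \<le> kern_int (\<lambda>s. nemytskii u s - h s) t"
        by (rule norm_conv_le[OF smeas_diff[OF us hs]]) (use le_less_trans[OF h(2)[OF t], of \<infinity>] in simp)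
      also have "\<dots> \<le> ennreal \<epsilon>" by (rule h(2)[OF t])
      finally show ?thesis
        using conv_diff[OF us fin[OF t] hs hfin[OF h(1) t]] \<epsilon> by simp
    qed
    then show "\<exists>v. asymptotically_almost_periodic v \<and> (\<forall>t\<ge>0. norm (conv (nemytskii u) t - v t) \<le> \<epsilon>)"
      using conv_stepanov_aap[OF h(1)] by blast
  qed
qed

definition \<Gamma> :: "(real \<Rightarrow> 'a) \<Rightarrow> real \<Rightarrow> 'a"
  where "\<Gamma> u t = w t + conv (nemytskii u) t"

lemma \<Gamma>_aap: "asymptotically_almost_periodic u \<Longrightarrow> asymptotically_almost_periodic (\<Gamma> u)"
  unfolding \<Gamma>_def[abs_def] by (rule aap_add[OF w conv_nemytskii_aap])

lemma \<Gamma>_cong: "(\<And>t. t \<ge> 0 \<Longrightarrow> u t = v t) \<Longrightarrow> \<Gamma> u = \<Gamma> v"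
proof -
  assume "\<And>t. t \<ge> 0 \<Longrightarrow> u t = v t"
  then have "nemytskii u = nemytskii v" by (auto simp: nemytskii_def)
  then show ?thesis unfolding \<Gamma>_def by simp
qed

lemma \<Gamma>_diff_le:
  assumes u: "asymptotically_almost_periodic u" and v: "asymptotically_almost_periodic v" and t: "t \<ge> 0"
  shows "ennreal (norm (\<Gamma> u t - \<Gamma> v t)) \<le>
    (\<integral>\<^sup>+s\<in>{0..t}. ennreal (kern (t - s) * L s) * ennreal (norm (u s - v s)) \<partial>lebesgue)"
proof -
  note us = smeas_nemytskii[OF aap_continuous_on[OF u]] and vs = smeas_nemytskii[OF aap_continuous_on[OF v]]
  have "smeas (\<lambda>s. - nemytskii v s)"
    by (rule smeas_continuous_compose[OF _ vs]) (intro continuous_intros)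
  then have "kern_int (\<lambda>s. nemytskii u s - nemytskii v s) t \<le> kern_int (nemytskii u) t + kern_int (\<lambda>s. - nemytskii v s) t"
    using kern_int_add_le[OF us] by force
  also have "\<dots> < \<infinity>"
    using kern_int_nemytskii_finite[OF u t] kern_int_nemytskii_finite[OF v t] by (simp add: kern_int_def)
  finally have "ennreal (norm (conv (\<lambda>s. nemytskii u s - nemytskii v s) t)) \<le> kern_int (\<lambda>s. nemytskii u s - nemytskii v s) t"
    by (rule norm_conv_le[OF smeas_diff[OF us vs]])
  also have "\<dots> \<le> (\<integral>\<^sup>+s\<in>{0..t}. ennreal (kern (t - s) * L s) * ennreal (norm (u s - v s)) \<partial>lebesgue)"
    by (rule kern_int_lipschitz_le) (auto simp: nemytskii_def)
  finally show ?thesis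
    by (simp add: \<Gamma>_def conv_diff[OF us kern_int_nemytskii_finite[OF u t] vs kern_int_nemytskii_finite[OF v t]])
qed

definition bc :: "(real \<Rightarrow> 'a) \<Rightarrow> real \<Rightarrow>\<^sub>C 'a"
  where "bc u = Bcontfun (\<lambda>t. u (max 0 t))"

lemma bc_apply:
  assumes "asymptotically_almost_periodic u"
  shows "apply_bcontfun (bc u) t = u (max 0 t)"
proof -
  obtain B where B: "\<And>t. t \<ge> 0 \<Longrightarrow> norm (u t) \<le> B" by (rule aap_norm_bounded[OF assms]) blast
  have "(\<lambda>t. u (max 0 t)) \<in> bcontfun"
  proof (rule bcontfun_normI)
    show "continuous_on UNIV (\<lambda>t. u (max 0 t))"
      by (rule continuous_on_compose2[OF aap_continuous_on[OF assms]]) (auto intro!: continuous_intros)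
    show "norm (u (max 0 t)) \<le> B" for t by (rule B) simp
  qed
  then show ?thesis by (simp add: bc_def Bcontfun_inverse)
qed

definition AAP :: "(real \<Rightarrow>\<^sub>C 'a) set"
  where "AAP = {x. asymptotically_almost_periodic (apply_bcontfun x)}"

lemma bc_in_AAP:
  assumes "asymptotically_almost_periodic u"
  shows "bc u \<in> AAP"
  unfolding AAP_def by (simp, rule aap_cong[OF assms]) (simp add: bc_apply[OF assms])

lemma complete_AAP: "complete AAP"
proof -
  have "x \<in> AAP" if x: "x \<in> closure AAP" for x
    unfolding AAP_def
  proof (simp, rule aap_uniform_limit)
    fix \<epsilon> :: real assume "\<epsilon> > 0"
    then obtain y where y: "y \<in> AAP" "dist y x < \<epsilon>" using x closure_approachable by blast
    have "norm (apply_bcontfun x t - apply_bcontfun y t) \<le> \<epsilon>" for t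
      using dist_bounded[of x t y] y(2) by (simp add: dist_norm[symmetric] dist_commute)
    then show "\<exists>v. asymptotically_almost_periodic v \<and> (\<forall>t\<ge>0. norm (apply_bcontfun x t - v t) \<le> \<epsilon>)"
      using y(1) unfolding AAP_def by blast
  qed
  then have "closed AAP" using closure_subset_eq by blast
  then show ?thesis by (simp add: complete_eq_closed)
qed

definition \<Gamma>b :: "(real \<Rightarrow>\<^sub>C 'a) \<Rightarrow> real \<Rightarrow>\<^sub>C 'a"
  where "\<Gamma>b x = bc (\<Gamma> (apply_bcontfun x))"

lemma \<Gamma>b_in_AAP: "x \<in> AAP \<Longrightarrow> \<Gamma>b x \<in> AAP"
  unfolding \<Gamma>b_def by (rule bc_in_AAP) (simp add: \<Gamma>_aap AAP_def)

lemma \<Gamma>b_pow_in_AAP: "x \<in> AAP \<Longrightarrow> (\<Gamma>b ^^ m) x \<in> AAP"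
  by (induction m) (auto intro: \<Gamma>b_in_AAP)

lemma \<Gamma>b_apply: "x \<in> AAP \<Longrightarrow> apply_bcontfun (\<Gamma>b x) t = \<Gamma> (apply_bcontfun x) (max 0 t)"
  unfolding \<Gamma>b_def by (rule bc_apply) (simp add: \<Gamma>_aap AAP_def)

lemma \<Gamma>b_pow_contraction:
  assumes x: "x \<in> AAP" and y: "y \<in> AAP"
  shows "dist ((\<Gamma>b ^^ n) x) ((\<Gamma>b ^^ n) y) \<le> \<theta> * dist x y"
proof (rule dist_bound)
  fix t :: real
  define d where "d m t = ennreal (norm (apply_bcontfun ((\<Gamma>b ^^ m) x) t - apply_bcontfun ((\<Gamma>b ^^ m) y) t))" for m t
  have "d n (max 0 t) \<le> ennreal (dist x y) * iter_kernel kern L n (max 0 t)"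
  proof (rule iter_kernel_bound)
    show "d 0 t \<le> ennreal (dist x y)" for t
      using dist_bounded[of x t y] by (simp add: d_def dist_norm[symmetric] ennreal_leI)
    show "d (Suc m) t \<le> (\<integral>\<^sup>+s\<in>{0..t}. ennreal (kern (t - s) * L s) * d m s \<partial>lebesgue)" if t: "t \<ge> 0" for m t
      using \<Gamma>_diff_le[of "apply_bcontfun ((\<Gamma>b ^^ m) x)" "apply_bcontfun ((\<Gamma>b ^^ m) y)" t] t
        \<Gamma>b_pow_in_AAP[OF x, of m] \<Gamma>b_pow_in_AAP[OF y, of m]
      by (simp add: d_def \<Gamma>b_apply) (simp add: AAP_def)
  qed auto
  also have "\<dots> \<le> ennreal (dist x y) * ennreal \<theta>"
    by (intro mult_left_mono iter_le) auto
  also have "\<dots> = ennreal (\<theta> * dist x y)"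
    using \<theta> by (simp add: ennreal_mult mult.commute)
  finally have "norm (apply_bcontfun ((\<Gamma>b ^^ n) x) (max 0 t) - apply_bcontfun ((\<Gamma>b ^^ n) y) (max 0 t)) \<le> \<theta> * dist x y"
    using \<theta> by (simp add: d_def)
  moreover obtain m where m: "n = Suc m" using n by (cases n) auto
  have "apply_bcontfun ((\<Gamma>b ^^ n) z) t = apply_bcontfun ((\<Gamma>b ^^ n) z) (max 0 t)" if "z \<in> AAP" for z
    using \<Gamma>b_apply[OF \<Gamma>b_pow_in_AAP[OF that, of m]] by (simp add: m)
  ultimately show "dist (apply_bcontfun ((\<Gamma>b ^^ n) x) t) (apply_bcontfun ((\<Gamma>b ^^ n) y) t) \<le> \<theta> * dist x y"
    using x y by (simp add: dist_norm)
qed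

lemma \<Gamma>_fixed_point:
  obtains u where "asymptotically_almost_periodic u" "\<And>t. t \<ge> 0 \<Longrightarrow> \<Gamma> u t = u t"
    "\<And>v t. asymptotically_almost_periodic v \<Longrightarrow> (\<And>t. t \<ge> 0 \<Longrightarrow> \<Gamma> v t = v t) \<Longrightarrow> t \<ge> 0 \<Longrightarrow> v t = u t"
proof -
  have "\<exists>!x. x \<in> AAP \<and> (\<Gamma>b ^^ n) x = x"
  proof (rule Banach_fix[OF complete_AAP _ \<theta>])
    show "AAP \<noteq> {}" using bc_in_AAP[OF w] by blast
    show "(\<Gamma>b ^^ n) ` AAP \<subseteq> AAP" using \<Gamma>b_pow_in_AAP by blast
    show "dist ((\<Gamma>b ^^ n) x) ((\<Gamma>b ^^ n) y) \<le> \<theta> * dist x y" if "x \<in> AAP" "y \<in> AAP" for x y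
      by (rule \<Gamma>b_pow_contraction[OF that])
  qed
  then obtain x where x: "x \<in> AAP" "(\<Gamma>b ^^ n) x = x"
    and uniq: "\<And>y. y \<in> AAP \<Longrightarrow> (\<Gamma>b ^^ n) y = y \<Longrightarrow> y = x" by blast
  have "(\<Gamma>b ^^ n) (\<Gamma>b x) = \<Gamma>b x" by (metis funpow_swap1 x(2))
  then have fx: "\<Gamma>b x = x" using uniq \<Gamma>b_in_AAP[OF x(1)] by blast
  show thesis
  proof (rule that)
    show "asymptotically_almost_periodic (apply_bcontfun x)" using x(1) by (simp add: AAP_def)
    show "\<Gamma> (apply_bcontfun x) t = apply_bcontfun x t" if "t \<ge> 0" for t
      using \<Gamma>b_apply[OF x(1), of t] that by (simp add: fx)
    fix v t assume v: "asymptotically_almost_periodic v" "\<And>t. t \<ge> 0 \<Longrightarrow> \<Gamma> v t = v t" and t: "(t::real) \<ge> 0"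
    have "\<Gamma> (apply_bcontfun (bc v)) = \<Gamma> v"
      by (rule \<Gamma>_cong) (simp add: bc_apply[OF v(1)])
    then have "\<Gamma>b (bc v) = bc v"
      by (intro bcontfun_eqI) (simp add: \<Gamma>b_apply[OF bc_in_AAP[OF v(1)]] bc_apply[OF v(1)] v(2))
    then have "(\<Gamma>b ^^ m) (bc v) = bc v" for m by (induction m) auto
    then have "bc v = x" using uniq bc_in_AAP[OF v(1)] by blast
    then show "v t = apply_bcontfun x t" using bc_apply[OF v(1), of t] t by simp
  qed
qed

lemma conv_nemytskii_eq: "conv (nemytskii u) t = integral {0..t} (\<lambda>s. T (t - s) (f s (u s)))"
  unfolding conv_def by (rule integral_cong) (simp add: nemytskii_def)

lemma bochner_integrable_nemytskii:
  assumes u: "asymptotically_almost_periodic u" and t: "t \<ge> 0"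
  shows "bochner_integrable_on (\<lambda>s. T (t - s) (f s (u s))) {0..t}"
proof -
  have "bochner_integrable_on (\<lambda>s. T (t - s) (nemytskii u s)) {0..t}"
    by (rule conv_bochner_integrable[OF smeas_nemytskii[OF aap_continuous_on[OF u]] kern_int_nemytskii_finite[OF u t]])
  moreover have "(\<lambda>s. if s \<in> {0..t} then T (t - s) (nemytskii u s) else 0) = (\<lambda>s. if s \<in> {0..t} then T (t - s) (f s (u s)) else 0)"
    by (auto simp: nemytskii_def)
  moreover have "(\<integral>\<^sup>+s\<in>{0..t}. ennreal (norm (T (t - s) (nemytskii u s))) \<partial>lebesgue) =
      (\<integral>\<^sup>+s\<in>{0..t}. ennreal (norm (T (t - s) (f s (u s)))) \<partial>lebesgue)"
    by (intro nn_integral_cong) (auto simp: nemytskii_def indicator_def)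
  ultimately show ?thesis by (subst (asm) bochner_integrable_on_iff, simp, subst bochner_integrable_on_iff) simp_all
qed

end

theorem theorem2p11:
  fixes A :: "'a::complex_banach \<Rightarrow> 'a set"
    and f g q :: "real \<Rightarrow> 'a \<Rightarrow> 'a"
    and L\<^sub>f :: "real \<Rightarrow> real"
    and u\<^sub>0 :: 'a
    and c \<beta> M p L :: real
    and n :: nat
  assumes "mlo A"
    and "condition_P A c \<beta>"
    and "M > 0"
    and "\<And>t. t > 0 \<Longrightarrow> norm (P_semigroup A c t) \<le> M * exp (- c * t) * t powr (\<beta> - 1)"
    and "point_of_continuity (P_semigroup A c) u\<^sub>0"
    and "p \<ge> 1" and "g \<in> APS p"
    and "L > 0" and "\<And>t x y. t \<ge> 0 \<Longrightarrow> norm (g t x - g t y) \<le> L * norm (x - y)"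
    and "\<And>t x. t \<ge> 0 \<Longrightarrow> f t x = g t x + q t x" and "hat q \<in> C0_Lp p"
    and "p = 1 \<Longrightarrow> \<beta> = 1"
    and "p > 1 \<Longrightarrow> \<beta> = 1 \<or> p / (p - 1) < 1 / (1 - \<beta>)"
    and "\<And>t. t \<ge> 0 \<Longrightarrow> L\<^sub>f t > 0" and "\<And>b. b \<ge> 0 \<Longrightarrow> bounded (L\<^sub>f ` {0..b})"
    and "AE t in lebesgue. t > 0 \<longrightarrow> (\<forall>x y. norm (f t x - f t y) \<le> L\<^sub>f t * norm (x - y))"
    and "n \<ge> 1" and "M_const M c \<beta> L\<^sub>f n < 1"
  shows "\<exists>u. (mild_solution (P_semigroup A c) f u\<^sub>0 u \<and> asymptotically_almost_periodic u) \<and>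
    (\<forall>v. mild_solution (P_semigroup A c) f u\<^sub>0 v \<and> asymptotically_almost_periodic v \<longrightarrow>
      (\<forall>t\<ge>0. v t = u t))"
proof -
  let ?T = "P_semigroup A c"
  define w where "w t = (if t = 0 then u\<^sub>0 else ?T t u\<^sub>0)" for t
  have c: "c > 0" and \<beta>: "0 < \<beta>" "\<beta> \<le> 1" using assms(2) by (auto simp: condition_P_def)
  have T: "continuous_on {0<..} ?T" by (rule continuous_P_semigroup[OF assms(2)])
  have wc: "continuous_on {0..} w"
    unfolding continuous_on
  proof
    fix t :: real assume "t \<in> {0..}"
    then consider "t = 0" | "t > 0" by fastforce
    then show "(w \<longlongrightarrow> w t) (at t within {0..})"
    proof cases
      case 1
      have "((\<lambda>t. ?T t u\<^sub>0) \<longlongrightarrow> u\<^sub>0) (at_right 0)"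
        using assms(5) by (simp add: point_of_continuity_def)
      then have "(w \<longlongrightarrow> u\<^sub>0) (at_right 0)"
        by (rule tendsto_cong[THEN iffD1, rotated]) (auto simp: w_def eventually_at_filter)
      then show ?thesis by (simp add: 1 w_def at_within_Ici_at_right)
    next
      case 2
      have "continuous_on {0<..} (\<lambda>t. ?T t u\<^sub>0)" by (intro continuous_intros T)
      then have "isCont (\<lambda>t. ?T t u\<^sub>0) t" using 2 by (simp add: continuous_on_eq_continuous_at)
      then have "((\<lambda>t. ?T t u\<^sub>0) \<longlongrightarrow> w t) (at t)" using 2 by (simp add: isCont_def w_def)
      moreover have "\<forall>\<^sub>F s in at t. ?T s u\<^sub>0 = w s"
      proof (rule eventually_mono)
        show "\<forall>\<^sub>F s in at t. s \<in> {0<..}" using 2 by (intro eventually_at_in_open') auto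
      qed (simp add: w_def)
      ultimately have "(w \<longlongrightarrow> w t) (at t)" by (simp add: tendsto_cong)
      then show ?thesis by (rule tendsto_within_subset) simp
    qed
  qed
  have "asymptotically_almost_periodic w"
  proof (rule aap_tendsto_zero[OF wc])
    have "((\<lambda>t. M * exp (- c * t) * norm u\<^sub>0) \<longlongrightarrow> 0) at_top"
      using c by real_asymp
    moreover have "\<forall>\<^sub>F t in at_top. norm (w t) \<le> M * exp (- c * t) * norm u\<^sub>0"
      using eventually_ge_at_top[of 1]
    proof eventually_elim
      case (elim t)
      have "norm (w t) \<le> norm (?T t) * norm u\<^sub>0" using elim norm_blinfun by (simp add: w_def)
      also have "\<dots> \<le> M * exp (- c * t) * t powr (\<beta> - 1) * norm u\<^sub>0"
        using elim assms(4)[of t] by (intro mult_right_mono) auto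
      also have "\<dots> \<le> M * exp (- c * t) * 1 * norm u\<^sub>0"
        using elim \<beta> assms(3) powr_mono[of "\<beta> - 1" 0 t] by (intro mult_right_mono mult_left_mono) auto
      finally show ?case by simp
    qed
    ultimately show "(w \<longlongrightarrow> 0) at_top" by (rule Lim_null_comparison[rotated])
  qed
  moreover define \<theta> where "\<theta> = enn2real (M_const M c \<beta> L\<^sub>f n)"
  have \<theta>: "M_const M c \<beta> L\<^sub>f n = ennreal \<theta>" "0 \<le> \<theta>" "\<theta> < 1"
  proof -
    show 1: "M_const M c \<beta> L\<^sub>f n = ennreal \<theta>"
      unfolding \<theta>_def using less_trans[OF assms(18), of top] by simp
    show "0 \<le> \<theta>" by (simp add: \<theta>_def)
    then show "\<theta> < 1" using assms(18) unfolding 1 by (simp add: ennreal_less_iff flip: ennreal_1)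
  qed
  moreover have "stepanov_aap p (\<lambda>s. if s \<ge> 0 then f s x else 0)" for x
  proof -
    have "stepanov_aap p (\<lambda>s. (if s \<ge> 0 then g s x else 0) + (if s \<ge> 0 then q s x else 0))"
      using assms(6) by (intro stepanov_aap_add stepanov_aap_APS stepanov_aap_C0_Lp assms(7,11)) auto
    moreover have "(\<lambda>s. (if s \<ge> 0 then g s x else 0) + (if s \<ge> 0 then q s x else 0)) = (\<lambda>s. if s \<ge> 0 then f s x else 0)"
      using assms(10) by auto
    ultimately show ?thesis by simp
  qed
  moreover have "iter_kernel (singular_kernel M c \<beta>) L\<^sub>f n t \<le> ennreal \<theta>" if "t \<ge> 0" for t
    using iter_kernel_le_M_const[where M=M and c=c and \<beta>=\<beta> and L="L\<^sub>f" and n=n, OF assms(3,14) that assms(17)] \<theta>(1)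
    by simp
  ultimately interpret semilinear ?T M c \<beta> p f "L\<^sub>f" w n \<theta>
    using T c \<beta> assms(3,4,6,12-14,16,17) by unfold_locales auto
  have mild: "mild_solution ?T f u\<^sub>0 u \<longleftrightarrow> (\<forall>t\<ge>0. \<Gamma> u t = u t)"
    if u: "asymptotically_almost_periodic u" for u
    unfolding mild_solution_def \<Gamma>_def conv_nemytskii_eq w_def
    using aap_continuous_on[OF u] bochner_integrable_nemytskii[OF u] by auto
  obtain u where "asymptotically_almost_periodic u" "\<And>t. t \<ge> 0 \<Longrightarrow> \<Gamma> u t = u t"
      "\<And>v t. asymptotically_almost_periodic v \<Longrightarrow> (\<And>t. t \<ge> 0 \<Longrightarrow> \<Gamma> v t = v t) \<Longrightarrow> t \<ge> 0 \<Longrightarrow> v t = u t"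
    using \<Gamma>_fixed_point by blast
  then show ?thesis using mild by blast
qed

end
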